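(* The one-relator group $G=\langle x,y\mid [[x,y],y]=1\rangle$ is not a CSA-group. However, it is $\mathbf{Q}$-faithful, it is residually torsion-free nilpotent, and for every prime $p$ it is residually $p$ and its pro-$p$-completion is torsion-free (hence $G$ does not contain a nonabelian Baumslag-Solitar group).
   Context: Notation: $[x,y]=x^{-1}y^{-1}xy$. A subgroup $H$ of a group $G$ is malnormal if $H\cap x^{-1}Hx=1$ for all $x\in G\setminus H$. A group is a CSA-group if all its maximal abelian subgroups are malnormal. The Baumslag-Solitar groups are $B_{m,n}=\langle x,y\mid yx^my^{-1}=x^n\rangle$, $mn\ne0$. For a prime $p$, a group $G$ is residually $p$ if for every $1\ne g\in G$ there is a normal subgroup of $G$ of finite $p$-power index not containing $g$. $G$ is residually torsion-free nilpotent if for every $1\neq g\in G$ there is a homomorphism from $G$ to a torsion-free nilpotent group not killing $g$. A $\mathbf{Q}$-group is a group $H$ with a map $H\times\mathbf{Q}\to H$, $(h,\alpha)\mapsto h^\alpha$, such that $h^1=h$, $h^0=1$, $1^\alpha=1$, $h^{\alpha+\beta}=h^\alpha h^\beta$, $h^{\alpha\beta}=(h^\alpha)^\beta$, $(g^{-1}hg)^\alpha=g^{-1}h^\alpha g$, and $(gh)^\alpha=g^\alpha h^\alpha$ whenever $g$ and $h$ commute; equivalently, a group in which every element has a unique $n$-th root for every positive integer $n$. The tensor completion of a group $G$ over $\mathbf{Q}$ is the $\mathbf{Q}$-group $G^{\mathbf{Q}}$ with a homomorphism $\lambda:G\to G^{\mathbf{Q}}$ that is universal: every homomorphism from $G$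 to a $\mathbf{Q}$-group factors uniquely through $\lambda$ via a homomorphism of $\mathbf{Q}$-groups. $G$ is $\mathbf{Q}$-faithful if $\lambda$ is injective. *)

theory Defs
  imports "HOL-Algebra.Product_Groups" "HOL-Computational_Algebra.Primes" "HOL.Rat"
begin

section \<open>Group presentations\<close>

text \<open>A word is a list of letters; the letter \<open>(a, True)\<close> stands for the generator \<open>a\<close> and
  \<open>(a, False)\<close> for its inverse. A set of pairs of words is read as a set of defining relations
  \<open>l = r\<close>.\<close>

type_synonym 'g word = "('g \<times> bool) list"

definition winv :: "'g word \<Rightarrow> 'g word" where
  "winv w = rev (map (\<lambda>(a, b). (a, \<not> b)) w)"

definition wpow :: "'g word \<Rightarrow> int \<Rightarrow> 'g word" where
  "wpow w k = (if k \<ge> 0 then concat (replicate (nat k) w)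
               else concat (replicate (nat (- k)) (winv w)))"

definition wcomm :: "'g word \<Rightarrow> 'g word \<Rightarrow> 'g word" where
  "wcomm u v = winv u @ winv v @ u @ v"

inductive pres_eq :: "('g word \<times> 'g word) set \<Rightarrow> 'g word \<Rightarrow> 'g word \<Rightarrow> bool" for R where
  refl: "pres_eq R w w"
| sym: "pres_eq R v w \<Longrightarrow> pres_eq R w v"
| trans: "pres_eq R u v \<Longrightarrow> pres_eq R v w \<Longrightarrow> pres_eq R u w"
| cancel: "pres_eq R (u @ [(a, b), (a, \<not> b)] @ v) (u @ v)"
| relation: "(l, r) \<in> R \<Longrightarrow> pres_eq R (u @ l @ v) (u @ r @ v)"

definition word_class :: "('g word \<times> 'g word) set \<Rightarrow> 'g word \<Rightarrow> 'g word set" where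
  "word_class R w = {v. pres_eq R w v}"

definition presentation :: "('g word \<times> 'g word) set \<Rightarrow> 'g word set monoid" where
  "presentation R = \<lparr>carrier = range (word_class R),
     monoid.mult = (\<lambda>A B. \<Union>u\<in>A. \<Union>v\<in>B. word_class R (u @ v)),
     one = word_class R []\<rparr>"

lemma word_class_eq_iff: "word_class R u = word_class R v \<longleftrightarrow> pres_eq R u v"
proof
  assume "word_class R u = word_class R v"
  then have "v \<in> word_class R u"
    by (simp add: word_class_def pres_eq.refl)
  then show "pres_eq R u v" by (simp add: word_class_def)
next
  assume "pres_eq R u v"
  then show "word_class R u = word_class R v"
    unfolding word_class_def using pres_eq.sym pres_eq.trans by blast
qed

lemma pres_eq_app1: "pres_eq R u v \<Longrightarrow> pres_eq R (p @ u @ q) (p @ v @ q)"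
proof (induction rule: pres_eq.induct)
  case (cancel u a b v)
  then show ?case using pres_eq.cancel[of R "p @ u" a b "v @ q"] by simp
next
  case (relation l r u v)
  then show ?case using pres_eq.relation[of l r R "p @ u" "v @ q"] by simp
qed (fact pres_eq.refl, erule pres_eq.sym, erule (1) pres_eq.trans)

lemma pres_eq_app: "pres_eq R u u' \<Longrightarrow> pres_eq R v v' \<Longrightarrow> pres_eq R (u @ v) (u' @ v')"
  using pres_eq_app1[of R u u' "[]" v] pres_eq_app1[of R v v' u' "[]"]
    pres_eq.trans[of R "u @ v" "u' @ v" "u' @ v'"] by simp

lemma word_class_mult:
  "word_class R u \<otimes>\<^bsub>presentation R\<^esub> word_class R v = word_class R (u @ v)"
proof -
  have "word_class R (a @ b) = word_class R (u @ v)"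
    if "a \<in> word_class R u" "b \<in> word_class R v" for a b
    using that unfolding word_class_eq_iff unfolding word_class_def mem_Collect_eq
    by (intro pres_eq.sym[OF pres_eq_app])
  moreover have "u \<in> word_class R u" "v \<in> word_class R v"
    by (simp_all add: word_class_def pres_eq.refl)
  ultimately have "(\<Union>a\<in>word_class R u. \<Union>b\<in>word_class R v. word_class R (a @ b))
    = word_class R (u @ v)" by blast
  then show ?thesis by (simp add: presentation_def)
qed

lemma pres_eq_winv: "pres_eq R (winv w @ w) []"
proof (induction w)
  case Nil
  then show ?case by (simp add: winv_def pres_eq.refl)
next
  case (Cons x w)
  obtain a b where x: "x = (a, b)" by fastforce
  have "pres_eq R (winv w @ [(a, \<not> b), (a, \<not> \<not> b)] @ w) (winv w @ w)"
    by (rule pres_eq.cancel)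
  then have "pres_eq R (winv (x # w) @ x # w) (winv w @ w)"
    by (simp add: x winv_def)
  then show ?case using Cons pres_eq.trans by blast
qed

lemma group_presentation: "group (presentation R)"
proof (rule groupI)
  show "\<one>\<^bsub>presentation R\<^esub> \<in> carrier (presentation R)"
    by (simp add: presentation_def)
next
  fix x y assume "x \<in> carrier (presentation R)" "y \<in> carrier (presentation R)"
  then obtain u v where "x = word_class R u" "y = word_class R v"
    by (auto simp: presentation_def)
  then show "x \<otimes>\<^bsub>presentation R\<^esub> y \<in> carrier (presentation R)"
    by (simp add: word_class_mult) (simp add: presentation_def)
next
  fix x y z assume "x \<in> carrier (presentation R)" "y \<in> carrier (presentation R)"
    "z \<in> carrier (presentation R)"
  then obtain u v w where "x = word_class R u" "y = word_class R v" "z = word_class R w"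
    by (auto simp: presentation_def)
  then show "x \<otimes>\<^bsub>presentation R\<^esub> y \<otimes>\<^bsub>presentation R\<^esub> z
      = x \<otimes>\<^bsub>presentation R\<^esub> (y \<otimes>\<^bsub>presentation R\<^esub> z)"
    by (simp add: word_class_mult)
next
  fix x assume "x \<in> carrier (presentation R)"
  then obtain u where x: "x = word_class R u" by (auto simp: presentation_def)
  have one: "\<one>\<^bsub>presentation R\<^esub> = word_class R []" by (simp add: presentation_def)
  show "\<one>\<^bsub>presentation R\<^esub> \<otimes>\<^bsub>presentation R\<^esub> x = x"
    by (simp add: x one word_class_mult)
  show "\<exists>y\<in>carrier (presentation R). y \<otimes>\<^bsub>presentation R\<^esub> x = \<one>\<^bsub>presentation R\<^esub>"
    by (rule bexI[of _ "word_class R (winv u)"])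
       (simp add: x one word_class_mult word_class_eq_iff pres_eq_winv, simp add: presentation_def)
qed

datatype gen = X | Y

definition letter :: "'g \<Rightarrow> 'g word" where
  "letter a = [(a, True)]"

definition group_xyy :: "gen word set monoid" where
  "group_xyy = presentation {(wcomm (wcomm (letter X) (letter Y)) (letter Y), [])}"

definition baumslag_solitar :: "int \<Rightarrow> int \<Rightarrow> gen word set monoid" where
  "baumslag_solitar m n =
     presentation {(letter Y @ wpow (letter X) m @ winv (letter Y), wpow (letter X) n)}"


section \<open>Malnormal subgroups and CSA-groups\<close>

definition malnormal :: "('a, 'b) monoid_scheme \<Rightarrow> 'a set \<Rightarrow> bool" where
  "malnormal G H \<longleftrightarrow> subgroup H G \<and>
     (\<forall>x \<in> carrier G - H. H \<inter> (\<lambda>h. inv\<^bsub>G\<^esub> x \<otimes>\<^bsub>G\<^esub> h \<otimes>\<^bsub>G\<^esub> x) ` H = {\<one>\<^bsub>G\<^esub>})"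

definition abelian_subgroup :: "('a, 'b) monoid_scheme \<Rightarrow> 'a set \<Rightarrow> bool" where
  "abelian_subgroup G H \<longleftrightarrow> subgroup H G \<and> (\<forall>x\<in>H. \<forall>y\<in>H. x \<otimes>\<^bsub>G\<^esub> y = y \<otimes>\<^bsub>G\<^esub> x)"

definition maximal_abelian_subgroup :: "('a, 'b) monoid_scheme \<Rightarrow> 'a set \<Rightarrow> bool" where
  "maximal_abelian_subgroup G H \<longleftrightarrow>
     abelian_subgroup G H \<and> (\<forall>K. abelian_subgroup G K \<longrightarrow> H \<subseteq> K \<longrightarrow> K = H)"

definition CSA_group :: "('a, 'b) monoid_scheme \<Rightarrow> bool" where
  "CSA_group G \<longleftrightarrow> (\<forall>H. maximal_abelian_subgroup G H \<longrightarrow> malnormal G H)"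


section \<open>Residual properties and the pro-p-completion\<close>

definition torsion_free :: "('a, 'b) monoid_scheme \<Rightarrow> bool" where
  "torsion_free G \<longleftrightarrow>
     (\<forall>x\<in>carrier G. \<forall>n::nat. n > 0 \<longrightarrow> x [^]\<^bsub>G\<^esub> n = \<one>\<^bsub>G\<^esub> \<longrightarrow> x = \<one>\<^bsub>G\<^esub>)"

primrec lower_central :: "('a, 'b) monoid_scheme \<Rightarrow> nat \<Rightarrow> 'a set" where
  "lower_central G 0 = carrier G"
| "lower_central G (Suc n) = generate G
     {inv\<^bsub>G\<^esub> a \<otimes>\<^bsub>G\<^esub> inv\<^bsub>G\<^esub> b \<otimes>\<^bsub>G\<^esub> a \<otimes>\<^bsub>G\<^esub> b | a b. a \<in> lower_central G n \<and> b \<in> carrier G}"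

definition nilpotent_group :: "('a, 'b) monoid_scheme \<Rightarrow> bool" where
  "nilpotent_group G \<longleftrightarrow> group G \<and> (\<exists>n. lower_central G n = {\<one>\<^bsub>G\<^esub>})"

text \<open>The target group ranges over groups on the type \<open>'a set\<close>, which carries all quotients of
  \<open>G\<close>; the lemma \<open>residually_torsion_free_nilpotentI\<close> below shows that homomorphisms to groups on
  arbitrary types yield the same notion.\<close>

definition residually_torsion_free_nilpotent :: "('a, 'b) monoid_scheme \<Rightarrow> bool" where
  "residually_torsion_free_nilpotent G \<longleftrightarrow>
     (\<forall>g\<in>carrier G. g \<noteq> \<one>\<^bsub>G\<^esub> \<longrightarrow>
        (\<exists>(H :: 'a set monoid) f. nilpotent_group H \<and> torsion_free H \<and>
           f \<in> hom G H \<and> f g \<noteq> \<one>\<^bsub>H\<^esub>))"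

definition p_power_index_normals :: "nat \<Rightarrow> ('a, 'b) monoid_scheme \<Rightarrow> 'a set set" where
  "p_power_index_normals p G =
     {N. N \<lhd> G \<and> finite (rcosets\<^bsub>G\<^esub> N) \<and> (\<exists>k. card (rcosets\<^bsub>G\<^esub> N) = p ^ k)}"

definition residually_p :: "nat \<Rightarrow> ('a, 'b) monoid_scheme \<Rightarrow> bool" where
  "residually_p p G \<longleftrightarrow>
     (\<forall>g\<in>carrier G. g \<noteq> \<one>\<^bsub>G\<^esub> \<longrightarrow> (\<exists>N \<in> p_power_index_normals p G. g \<notin> N))"

text \<open>The inverse limit of the quotients \<open>G Mod N\<close> along the natural projections: for \<open>M \<subseteq> N\<close>, the
  projection \<open>G Mod M \<rightarrow> G Mod N\<close> sends a coset of \<open>M\<close> to the coset of \<open>N\<close> containing it. Only the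
  underlying abstract group is recorded, not the profinite topology.\<close>

definition pro_p_completion ::
    "nat \<Rightarrow> ('a, 'b) monoid_scheme \<Rightarrow> ('a set \<Rightarrow> 'a set) monoid" where
  "pro_p_completion p G =
     (let I = p_power_index_normals p G; P = product_group I (\<lambda>N. G Mod N)
      in P\<lparr>carrier := {f \<in> carrier P. \<forall>M\<in>I. \<forall>N\<in>I. M \<subseteq> N \<longrightarrow> f M \<subseteq> f N}\<rparr>)"

lemma group_pro_p_completion:
  assumes G: "group G"
  shows "group (pro_p_completion p G)"
proof -
  interpret G: group G by fact
  define I where "I = p_power_index_normals p G"
  define P where "P = product_group I (\<lambda>N. G Mod N)"
  let ?C = "{f \<in> carrier P. \<forall>M\<in>I. \<forall>N\<in>I. M \<subseteq> N \<longrightarrow> f M \<subseteq> f N}"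
  have norm: "N \<lhd> G" if "N \<in> I" for N
    using that by (simp add: I_def p_power_index_normals_def)
  have grp: "group (G Mod N)" if "N \<in> I" for N
    using normal.factorgroup_is_group[OF norm[OF that]] .
  then interpret P: group P unfolding P_def by simp
  have "subgroup ?C P"
  proof (rule P.subgroupI)
    show "?C \<subseteq> carrier P" by auto
    have "\<one>\<^bsub>P\<^esub> \<in> ?C"
      using P.one_closed by (auto simp: P_def)
    then show "?C \<noteq> {}" by blast
  next
    fix f assume f: "f \<in> ?C"
    have "(inv\<^bsub>P\<^esub> f) M \<subseteq> (inv\<^bsub>P\<^esub> f) N" if MN: "M \<in> I" "N \<in> I" "M \<subseteq> N" for M N
    proof -
      have c: "f M \<in> carrier (G Mod M)" "f N \<in> carrier (G Mod N)"
        using f MN by (auto simp: P_def)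
      have "inv\<^bsub>P\<^esub> f = (\<lambda>i\<in>I. inv\<^bsub>G Mod i\<^esub> f i)"
        unfolding P_def using f grp by (intro inv_product_group) (auto simp: P_def)
      then have "(inv\<^bsub>P\<^esub> f) M = set_inv\<^bsub>G\<^esub> (f M)" "(inv\<^bsub>P\<^esub> f) N = set_inv\<^bsub>G\<^esub> (f N)"
        using MN c by (simp_all add: normal.inv_FactGroup norm)
      moreover have "f M \<subseteq> f N" using f MN by auto
      ultimately show ?thesis by (auto simp: SET_INV_def)
    qed
    then show "inv\<^bsub>P\<^esub> f \<in> ?C" using f P.inv_closed by blast
  next
    fix f g assume fg: "f \<in> ?C" "g \<in> ?C"
    have "(f \<otimes>\<^bsub>P\<^esub> g) M \<subseteq> (f \<otimes>\<^bsub>P\<^esub> g) N" if MN: "M \<in> I" "N \<in> I" "M \<subseteq> N" for M N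
    proof -
      have "f M \<subseteq> f N" "g M \<subseteq> g N" using fg MN by auto
      then show ?thesis using MN by (auto simp: P_def set_mult_def)
    qed
    moreover have "f \<otimes>\<^bsub>P\<^esub> g \<in> carrier P"
      using fg by (intro P.m_closed) auto
    ultimately show "f \<otimes>\<^bsub>P\<^esub> g \<in> ?C" unfolding mem_Collect_eq by blast
  qed
  then have "group (P\<lparr>carrier := ?C\<rparr>)" by (rule P.subgroup_imp_group)
  then show ?thesis by (simp add: pro_p_completion_def Let_def I_def P_def)
qed

lemma nilpotent_group_inj_hom:
  assumes K: "group K" and H: "nilpotent_group H" and h: "h \<in> hom K H"
    and inj: "inj_on h (carrier K)"
  shows "nilpotent_group K"
proof -
  interpret group_hom K H h
    using K H h by (simp add: group_hom_def group_hom_axioms_def nilpotent_group_def)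
  have sub: "lower_central K n \<subseteq> carrier K" for n
  proof (induction n)
    case (Suc n)
    let ?A = "{inv\<^bsub>K\<^esub> a \<otimes>\<^bsub>K\<^esub> inv\<^bsub>K\<^esub> b \<otimes>\<^bsub>K\<^esub> a \<otimes>\<^bsub>K\<^esub> b | a b. a \<in> lower_central K n \<and> b \<in> carrier K}"
    have "?A \<subseteq> carrier K" using Suc by auto
    then show ?case unfolding lower_central.simps by (rule G.generate_incl)
  qed simp
  have img: "h ` lower_central K n \<subseteq> lower_central H n" for n
  proof (induction n)
    case (Suc n)
    let ?A = "{inv\<^bsub>K\<^esub> a \<otimes>\<^bsub>K\<^esub> inv\<^bsub>K\<^esub> b \<otimes>\<^bsub>K\<^esub> a \<otimes>\<^bsub>K\<^esub> b | a b. a \<in> lower_central K n \<and> b \<in> carrier K}"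
    let ?B = "{inv\<^bsub>H\<^esub> a \<otimes>\<^bsub>H\<^esub> inv\<^bsub>H\<^esub> b \<otimes>\<^bsub>H\<^esub> a \<otimes>\<^bsub>H\<^esub> b | a b. a \<in> lower_central H n \<and> b \<in> carrier H}"
    have A: "?A \<subseteq> carrier K" using sub[of n] by auto
    have "h ` ?A \<subseteq> ?B"
    proof clarify
      fix a b assume ab: "a \<in> lower_central K n" "b \<in> carrier K"
      then have "a \<in> carrier K" using sub by blast
      then have "h (inv\<^bsub>K\<^esub> a \<otimes>\<^bsub>K\<^esub> inv\<^bsub>K\<^esub> b \<otimes>\<^bsub>K\<^esub> a \<otimes>\<^bsub>K\<^esub> b)
        = inv\<^bsub>H\<^esub> (h a) \<otimes>\<^bsub>H\<^esub> inv\<^bsub>H\<^esub> (h b) \<otimes>\<^bsub>H\<^esub> h a \<otimes>\<^bsub>H\<^esub> h b" using ab by simp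
      moreover have "h a \<in> lower_central H n" using Suc ab by blast
      ultimately show "\<exists>a' b'. h (inv\<^bsub>K\<^esub> a \<otimes>\<^bsub>K\<^esub> inv\<^bsub>K\<^esub> b \<otimes>\<^bsub>K\<^esub> a \<otimes>\<^bsub>K\<^esub> b)
          = inv\<^bsub>H\<^esub> a' \<otimes>\<^bsub>H\<^esub> inv\<^bsub>H\<^esub> b' \<otimes>\<^bsub>H\<^esub> a' \<otimes>\<^bsub>H\<^esub> b' \<and> a' \<in> lower_central H n \<and> b' \<in> carrier H"
        using ab hom_closed by blast
    qed
    then have "generate H (h ` ?A) \<subseteq> generate H ?B" by (rule H.mono_generate)
    then show ?case using generate_img[OF A] by simp
  qed (use hom_closed in auto)
  obtain n where n: "lower_central H n = {\<one>\<^bsub>H\<^esub>}"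
    using H by (auto simp: nilpotent_group_def)
  have "lower_central K n = {\<one>\<^bsub>K\<^esub>}"
  proof
    show "lower_central K n \<subseteq> {\<one>\<^bsub>K\<^esub>}"
    proof
      fix x assume x: "x \<in> lower_central K n"
      then have "h x = h \<one>\<^bsub>K\<^esub>" using img[of n] n by auto
      then show "x \<in> {\<one>\<^bsub>K\<^esub>}" using inj_onD[OF inj, of x "\<one>\<^bsub>K\<^esub>"] sub x by blast
    qed
    show "{\<one>\<^bsub>K\<^esub>} \<subseteq> lower_central K n" by (cases n) (auto intro: generate.one)
  qed
  then show ?thesis using K by (auto simp: nilpotent_group_def)
qed

lemma torsion_free_inj_hom:
  assumes K: "group K" and H: "group H" "torsion_free H" and h: "h \<in> hom K H"
    and inj: "inj_on h (carrier K)"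
  shows "torsion_free K"
proof -
  interpret group_hom K H h
    using K H h by (simp add: group_hom_def group_hom_axioms_def)
  show ?thesis unfolding torsion_free_def
  proof (intro ballI allI impI)
    fix x and n :: nat
    assume x: "x \<in> carrier K" and n: "n > 0" "x [^]\<^bsub>K\<^esub> n = \<one>\<^bsub>K\<^esub>"
    have "h x [^]\<^bsub>H\<^esub> n = \<one>\<^bsub>H\<^esub>" using x n hom_nat_pow by (metis hom_one)
    then have "h x = h \<one>\<^bsub>K\<^esub>" using H(2) x n by (auto simp: torsion_free_def)
    then show "x = \<one>\<^bsub>K\<^esub>" using inj_onD[OF inj _ x G.one_closed] by blast
  qed
qed

lemma residually_torsion_free_nilpotentI:
  fixes G :: "('a, 'b) monoid_scheme"
  assumes G: "group G"
    and ex: "\<And>g. g \<in> carrier G \<Longrightarrow> g \<noteq> \<one>\<^bsub>G\<^esub> \<Longrightarrow>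
      \<exists>(H :: ('h, 'c) monoid_scheme) f. nilpotent_group H \<and> torsion_free H \<and> f \<in> hom G H \<and> f g \<noteq> \<one>\<^bsub>H\<^esub>"
  shows "residually_torsion_free_nilpotent G"
  unfolding residually_torsion_free_nilpotent_def
proof (intro ballI impI)
  fix g assume g: "g \<in> carrier G" "g \<noteq> \<one>\<^bsub>G\<^esub>"
  obtain H :: "('h, 'c) monoid_scheme" and f where
    H: "nilpotent_group H" "torsion_free H" "f \<in> hom G H" "f g \<noteq> \<one>\<^bsub>H\<^esub>"
    using ex[OF g] by blast
  have grpH: "group H" using H by (simp add: nilpotent_group_def)
  interpret group_hom G H f
    using G grpH H by (simp add: group_hom_def group_hom_axioms_def)
  let ?N = "kernel G H f"
  have N: "?N \<lhd> G" by (rule normal_kernel)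
  have Q: "group (G Mod ?N)" by (rule normal.factorgroup_is_group[OF N])
  have 1: "(\<lambda>X. the_elem (f ` X)) \<in> hom (G Mod ?N) H" by (rule FactGroup_hom)
  have 2: "inj_on (\<lambda>X. the_elem (f ` X)) (carrier (G Mod ?N))" by (rule FactGroup_inj_on)
  have "(\<lambda>a. ?N #>\<^bsub>G\<^esub> a) \<in> hom G (G Mod ?N)" by (rule normal.r_coset_hom_Mod[OF N])
  moreover have "?N #>\<^bsub>G\<^esub> g \<noteq> \<one>\<^bsub>G Mod ?N\<^esub>"
  proof
    assume "?N #>\<^bsub>G\<^esub> g = \<one>\<^bsub>G Mod ?N\<^esub>"
    then have "g \<in> ?N" using g N G.rcos_self[OF g(1)] normal_imp_subgroup by force
    then show False using H by (simp add: kernel_def)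
  qed
  ultimately show "\<exists>(H :: 'a set monoid) f. nilpotent_group H \<and> torsion_free H \<and>
           f \<in> hom G H \<and> f g \<noteq> \<one>\<^bsub>H\<^esub>"
    using nilpotent_group_inj_hom[OF Q H(1) 1 2] torsion_free_inj_hom[OF Q grpH H(2) 1 2] by blast
qed


section \<open>Q-groups and the tensor completion\<close>

record 'a qgroup = "'a monoid" +
  qpow :: "'a \<Rightarrow> rat \<Rightarrow> 'a"

locale Q_group = group H for H :: "'a qgroup" (structure) +
  assumes qpow_closed: "h \<in> carrier H \<Longrightarrow> qpow H h \<alpha> \<in> carrier H"
    and qpow_1: "h \<in> carrier H \<Longrightarrow> qpow H h 1 = h"
    and qpow_0: "h \<in> carrier H \<Longrightarrow> qpow H h 0 = \<one>"
    and one_qpow: "qpow H \<one> \<alpha> = \<one>"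
    and qpow_add: "h \<in> carrier H \<Longrightarrow> qpow H h (\<alpha> + \<beta>) = qpow H h \<alpha> \<otimes> qpow H h \<beta>"
    and qpow_mult: "h \<in> carrier H \<Longrightarrow> qpow H h (\<alpha> * \<beta>) = qpow H (qpow H h \<alpha>) \<beta>"
    and qpow_conj: "g \<in> carrier H \<Longrightarrow> h \<in> carrier H \<Longrightarrow>
      qpow H (inv g \<otimes> h \<otimes> g) \<alpha> = inv g \<otimes> qpow H h \<alpha> \<otimes> g"
    and qpow_commute: "g \<in> carrier H \<Longrightarrow> h \<in> carrier H \<Longrightarrow> g \<otimes> h = h \<otimes> g \<Longrightarrow>
      qpow H (g \<otimes> h) \<alpha> = qpow H g \<alpha> \<otimes> qpow H h \<alpha>"

definition qhom :: "'a qgroup \<Rightarrow> 'b qgroup \<Rightarrow> ('a \<Rightarrow> 'b) set" where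
  "qhom H K = {\<phi> \<in> hom H K. \<forall>h\<in>carrier H. \<forall>\<alpha>. \<phi> (qpow H h \<alpha>) = qpow K (\<phi> h) \<alpha>}"

text \<open>The universal property, tested against all Q-groups on the type \<open>'h\<close>. Homomorphisms are
  unique as functions on the carrier, hence the extensionality.\<close>

definition is_tensor_completion ::
    "'h itself \<Rightarrow> ('a, 'b) monoid_scheme \<Rightarrow> 't qgroup \<Rightarrow> ('a \<Rightarrow> 't) \<Rightarrow> bool" where
  "is_tensor_completion ty G T lam \<longleftrightarrow> Q_group T \<and> lam \<in> hom G T \<and>
     (\<forall>(K :: 'h qgroup) f. Q_group K \<longrightarrow> f \<in> hom G K \<longrightarrow>
        (\<exists>!\<phi>. \<phi> \<in> qhom T K \<and> \<phi> \<in> extensional (carrier T) \<and> (\<forall>g\<in>carrier G. \<phi> (lam g) = f g)))"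

text \<open>The tensor completion is realised by formal Q-group expressions over \<open>G\<close>, modulo the least
  congruence enforcing the multiplication of \<open>G\<close> and the laws of Q-groups. Elements of the type
  outside the carrier of \<open>G\<close> are identified with the identity.\<close>

datatype 'a qterm = Emb 'a | One | Mul "'a qterm" "'a qterm" | Inv "'a qterm" | Pow "'a qterm" rat

inductive qeq :: "('a, 'b) monoid_scheme \<Rightarrow> 'a qterm \<Rightarrow> 'a qterm \<Rightarrow> bool" for G where
  refl: "qeq G s s"
| sym: "qeq G s t \<Longrightarrow> qeq G t s"
| trans: "qeq G s t \<Longrightarrow> qeq G t u \<Longrightarrow> qeq G s u"
| cong_mul: "qeq G s s' \<Longrightarrow> qeq G t t' \<Longrightarrow> qeq G (Mul s t) (Mul s' t')"
| cong_inv: "qeq G s s' \<Longrightarrow> qeq G (Inv s) (Inv s')"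
| cong_pow: "qeq G s s' \<Longrightarrow> qeq G (Pow s \<alpha>) (Pow s' \<alpha>)"
| emb: "g \<in> carrier G \<Longrightarrow> h \<in> carrier G \<Longrightarrow> qeq G (Emb (g \<otimes>\<^bsub>G\<^esub> h)) (Mul (Emb g) (Emb h))"
| outside: "g \<notin> carrier G \<Longrightarrow> qeq G (Emb g) One"
| assoc: "qeq G (Mul (Mul s t) u) (Mul s (Mul t u))"
| l_one: "qeq G (Mul One s) s"
| l_inv: "qeq G (Mul (Inv s) s) One"
| pow_1: "qeq G (Pow s 1) s"
| pow_0: "qeq G (Pow s 0) One"
| one_pow: "qeq G (Pow One \<alpha>) One"
| pow_add: "qeq G (Pow s (\<alpha> + \<beta>)) (Mul (Pow s \<alpha>) (Pow s \<beta>))"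
| pow_mult: "qeq G (Pow s (\<alpha> * \<beta>)) (Pow (Pow s \<alpha>) \<beta>)"
| pow_conj: "qeq G (Pow (Mul (Mul (Inv s) t) s) \<alpha>) (Mul (Mul (Inv s) (Pow t \<alpha>)) s)"
| pow_commute: "qeq G (Mul s t) (Mul t s) \<Longrightarrow> qeq G (Pow (Mul s t) \<alpha>) (Mul (Pow s \<alpha>) (Pow t \<alpha>))"

definition qclass :: "('a, 'b) monoid_scheme \<Rightarrow> 'a qterm \<Rightarrow> 'a qterm set" where
  "qclass G s = {t. qeq G s t}"

definition tensor_completion :: "('a, 'b) monoid_scheme \<Rightarrow> 'a qterm set qgroup" where
  "tensor_completion G = \<lparr>carrier = range (qclass G),
     monoid.mult = (\<lambda>A B. \<Union>s\<in>A. \<Union>t\<in>B. qclass G (Mul s t)),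
     one = qclass G One,
     qpow = (\<lambda>A \<alpha>. \<Union>s\<in>A. qclass G (Pow s \<alpha>))\<rparr>"

definition tensor_map :: "('a, 'b) monoid_scheme \<Rightarrow> 'a \<Rightarrow> 'a qterm set" where
  "tensor_map G g = qclass G (Emb g)"

text \<open>The type \<open>'a qterm set\<close> carries a Q-group with the universal property with respect to Q-groups
  on every type (\<open>tensor_completion_universal\<close> below), so it suffices to test universality on this
  type, and \<open>Q_faithful\<close> does not depend on the choice of the tensor completion
  (\<open>Q_faithful_iff\<close>).\<close>

definition Q_faithful :: "('a, 'b) monoid_scheme \<Rightarrow> bool" where
  "Q_faithful G \<longleftrightarrow> (\<exists>(T :: 'a qterm set qgroup) lam.
     is_tensor_completion TYPE('a qterm set) G T lam \<and> inj_on lam (carrier G))"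

lemma qclass_eq_iff: "qclass G s = qclass G t \<longleftrightarrow> qeq G s t"
proof
  assume "qclass G s = qclass G t"
  then have "t \<in> qclass G s"
    by (simp add: qclass_def qeq.refl)
  then show "qeq G s t" by (simp add: qclass_def)
next
  assume "qeq G s t"
  then show "qclass G s = qclass G t"
    unfolding qclass_def using qeq.sym qeq.trans by blast
qed

lemma qclass_mult:
  "qclass G s \<otimes>\<^bsub>tensor_completion G\<^esub> qclass G t = qclass G (Mul s t)"
proof -
  have "qclass G (Mul a b) = qclass G (Mul s t)"
    if "a \<in> qclass G s" "b \<in> qclass G t" for a b
    using that unfolding qclass_eq_iff unfolding qclass_def mem_Collect_eq
    by (intro qeq.sym[OF qeq.cong_mul])
  moreover have "s \<in> qclass G s" "t \<in> qclass G t"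
    by (simp_all add: qclass_def qeq.refl)
  ultimately have "(\<Union>a\<in>qclass G s. \<Union>b\<in>qclass G t. qclass G (Mul a b)) = qclass G (Mul s t)"
    by blast
  then show ?thesis by (simp add: tensor_completion_def)
qed

lemma qclass_qpow: "qpow (tensor_completion G) (qclass G s) \<alpha> = qclass G (Pow s \<alpha>)"
proof -
  have "qclass G (Pow a \<alpha>) = qclass G (Pow s \<alpha>)" if "a \<in> qclass G s" for a
    using that unfolding qclass_eq_iff unfolding qclass_def mem_Collect_eq
    by (intro qeq.sym[OF qeq.cong_pow])
  moreover have "s \<in> qclass G s"
    by (simp add: qclass_def qeq.refl)
  ultimately have "(\<Union>a\<in>qclass G s. qclass G (Pow a \<alpha>)) = qclass G (Pow s \<alpha>)"
    by blast
  then show ?thesis by (simp add: tensor_completion_def)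
qed

lemma qclass_one: "\<one>\<^bsub>tensor_completion G\<^esub> = qclass G One"
  by (simp add: tensor_completion_def)

lemma carrier_tensor_completion: "carrier (tensor_completion G) = range (qclass G)"
  by (simp add: tensor_completion_def)

lemmas qclass_simps = qclass_mult qclass_qpow qclass_one carrier_tensor_completion

lemma group_tensor_completion: "group (tensor_completion G)"
proof (rule groupI)
  fix x assume "x \<in> carrier (tensor_completion G)"
  then obtain s where x: "x = qclass G s" by (auto simp: qclass_simps)
  show "\<one>\<^bsub>tensor_completion G\<^esub> \<otimes>\<^bsub>tensor_completion G\<^esub> x = x"
    by (simp add: x qclass_simps qclass_eq_iff qeq.l_one)
  show "\<exists>y\<in>carrier (tensor_completion G).
      y \<otimes>\<^bsub>tensor_completion G\<^esub> x = \<one>\<^bsub>tensor_completion G\<^esub>"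
    by (rule bexI[of _ "qclass G (Inv s)"]) (auto simp: x qclass_simps qclass_eq_iff qeq.l_inv)
qed (clarsimp simp: qclass_simps qclass_eq_iff qeq.assoc; (rule rangeI)?)+

lemma qclass_inv: "inv\<^bsub>tensor_completion G\<^esub> qclass G s = qclass G (Inv s)"
  by (rule group.inv_equality[OF group_tensor_completion])
     (auto simp: qclass_simps qclass_eq_iff qeq.l_inv)

lemma Q_group_tensor_completion: "Q_group (tensor_completion G)"
proof (intro Q_group.intro Q_group_axioms.intro group_tensor_completion)
  fix x y \<alpha>
  let ?T = "tensor_completion G"
  assume xy: "x \<in> carrier ?T" "y \<in> carrier ?T" and comm: "x \<otimes>\<^bsub>?T\<^esub> y = y \<otimes>\<^bsub>?T\<^esub> x"
  obtain s t where st: "x = qclass G s" "y = qclass G t"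
    using xy by (auto simp: carrier_tensor_completion)
  have "qeq G (Mul s t) (Mul t s)"
    using comm unfolding st qclass_mult qclass_eq_iff .
  then show "qpow ?T (x \<otimes>\<^bsub>?T\<^esub> y) \<alpha> = qpow ?T x \<alpha> \<otimes>\<^bsub>?T\<^esub> qpow ?T y \<alpha>"
    unfolding st qclass_mult qclass_qpow qclass_eq_iff by (rule qeq.pow_commute)
qed (clarsimp simp: qclass_simps qclass_inv qclass_eq_iff qeq.pow_1 qeq.pow_0 qeq.one_pow
    qeq.pow_add qeq.pow_mult qeq.pow_conj; (rule rangeI)?)+

lemma tensor_map_hom: "tensor_map G \<in> hom G (tensor_completion G)"
  by (auto simp: hom_def tensor_map_def qclass_simps qclass_eq_iff qeq.emb)

primrec qeval :: "('a, 'b) monoid_scheme \<Rightarrow> 'h qgroup \<Rightarrow> ('a \<Rightarrow> 'h) \<Rightarrow> 'a qterm \<Rightarrow> 'h" where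
  "qeval G K f (Emb g) = (if g \<in> carrier G then f g else \<one>\<^bsub>K\<^esub>)"
| "qeval G K f One = \<one>\<^bsub>K\<^esub>"
| "qeval G K f (Mul s t) = qeval G K f s \<otimes>\<^bsub>K\<^esub> qeval G K f t"
| "qeval G K f (Inv s) = inv\<^bsub>K\<^esub> qeval G K f s"
| "qeval G K f (Pow s \<alpha>) = qpow K (qeval G K f s) \<alpha>"

lemma qeval_closed:
  assumes "Q_group K" "f \<in> hom G K"
  shows "qeval G K f s \<in> carrier K"
proof -
  interpret Q_group K by fact
  show ?thesis
    by (induction s) (use assms(2) in \<open>auto simp: hom_def qpow_closed\<close>)
qed

lemma qeval_cong:
  assumes G: "group G" and K: "Q_group K" and f: "f \<in> hom G K" and eq: "qeq G s t"
  shows "qeval G K f s = qeval G K f t"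
proof -
  interpret Q_group K by fact
  note c = qeval_closed[OF K f]
  show ?thesis using eq
  proof (induction rule: qeq.induct)
    case (emb g h)
    then show ?case using f group.is_monoid[OF G] by (auto simp: hom_def monoid.m_closed)
  next
    case (assoc s t u)
    then show ?case by (simp add: c m_assoc)
  next
    case (pow_commute s t \<alpha>)
    then show ?case using qpow_commute[OF c c, of s t \<alpha>] by simp
  qed (simp_all add: c qpow_1 qpow_0 one_qpow qpow_add qpow_mult qpow_conj)
qed

theorem tensor_completion_universal:
  assumes G: "group G"
  shows "is_tensor_completion TYPE('h) G (tensor_completion G) (tensor_map G)"
  unfolding is_tensor_completion_def
proof (intro conjI allI impI Q_group_tensor_completion tensor_map_hom)
  fix K :: "'h qgroup" and f assume K: "Q_group K" and f: "f \<in> hom G K"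
  interpret K: Q_group K by fact
  interpret T: group "tensor_completion G" by (rule group_tensor_completion)
  let ?T = "tensor_completion G"
  let ?P = "\<lambda>\<phi>. \<phi> \<in> qhom ?T K \<and> \<phi> \<in> extensional (carrier ?T) \<and>
    (\<forall>g\<in>carrier G. \<phi> (tensor_map G g) = f g)"
  define \<phi> where "\<phi> = (\<lambda>A\<in>carrier ?T. qeval G K f (SOME s. qclass G s = A))"
  have \<phi>: "\<phi> (qclass G s) = qeval G K f s" for s
  proof -
    have "qclass G (SOME s'. qclass G s' = qclass G s) = qclass G s"
      by (rule someI) (rule HOL.refl)
    then have "qeval G K f (SOME s'. qclass G s' = qclass G s) = qeval G K f s"
      unfolding qclass_eq_iff by (rule qeval_cong[OF G K f])
    then show ?thesis by (simp add: \<phi>_def carrier_tensor_completion)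
  qed
  show "\<exists>!\<phi>. ?P \<phi>"
  proof (rule ex1I[of _ \<phi>])
    show "?P \<phi>"
      by (auto simp: qhom_def hom_def qclass_simps \<phi> tensor_map_def qeval_closed[OF K f])
         (auto simp: \<phi>_def carrier_tensor_completion)
  next
    fix \<psi> assume \<psi>: "?P \<psi>"
    then interpret \<psi>: group_hom ?T K \<psi>
      by (simp add: group_hom_def group_hom_axioms_def qhom_def T.is_group K.is_group)
    have "\<psi> (qclass G s) = qeval G K f s" for s
    proof (induction s)
      case (Emb g)
      show ?case
      proof (cases "g \<in> carrier G")
        case True
        then show ?thesis using \<psi> by (simp add: tensor_map_def)
      next
        case False
        then have "qclass G (Emb g) = \<one>\<^bsub>?T\<^esub>"
          by (simp add: qclass_one qclass_eq_iff qeq.outside)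
        then show ?thesis using False by simp
      qed
    next
      case One
      then show ?case using \<psi>.hom_one by (simp add: qclass_one)
    next
      case (Mul s t)
      then show ?case using \<psi>.hom_mult[of "qclass G s" "qclass G t"] by (simp add: qclass_simps)
    next
      case (Inv s)
      then show ?case using \<psi>.hom_inv[of "qclass G s"] by (simp add: qclass_simps qclass_inv)
    next
      case (Pow s \<alpha>)
      have "\<psi> (qpow ?T (qclass G s) \<alpha>) = qpow K (\<psi> (qclass G s)) \<alpha>"
        using \<psi> by (simp add: qhom_def carrier_tensor_completion)
      then show ?case using Pow by (simp add: qclass_simps)
    qed
    then have "\<psi> A = \<phi> A" if "A \<in> carrier ?T" for A
      using that \<phi> by (auto simp: carrier_tensor_completion)
    moreover have "\<phi> \<in> extensional (carrier ?T)" by (simp add: \<phi>_def)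
    ultimately show "\<psi> = \<phi>" using \<psi> by (meson extensionalityI)
  qed
qed

lemma is_tensor_completion_inj:
  fixes S :: "'s qgroup"
  assumes "is_tensor_completion TYPE('s) G T l" "is_tensor_completion ty G S k"
    "inj_on k (carrier G)"
  shows "inj_on l (carrier G)"
proof -
  obtain \<phi> where "\<forall>g\<in>carrier G. \<phi> (l g) = k g"
    using assms(1,2) unfolding is_tensor_completion_def by blast
  then show ?thesis using assms(3) unfolding inj_on_def by metis
qed

lemma Q_faithful_iff:
  fixes G :: "('a, 'b) monoid_scheme" and T :: "'t qgroup"
  assumes G: "group G" and T: "is_tensor_completion TYPE('a qterm set) G T l"
  shows "Q_faithful G \<longleftrightarrow> inj_on l (carrier G)"
proof
  assume "Q_faithful G"
  then show "inj_on l (carrier G)"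
    unfolding Q_faithful_def using is_tensor_completion_inj[OF T] by blast
next
  assume "inj_on l (carrier G)"
  then have "inj_on (tensor_map G) (carrier G)"
    by (rule is_tensor_completion_inj[OF tensor_completion_universal[OF G] T])
  then show "Q_faithful G"
    unfolding Q_faithful_def using tensor_completion_universal[OF G] by blast
qed

end

theory Submission
  imports Defs "HOL-Library.Function_Algebras" "HOL-Computational_Algebra.Formal_Power_Series"
    "HOL-Algebra.Sylow" "HOL-Algebra.Multiplicative_Group" "HOL-Algebra.Group_Action"
begin

text \<open>Put \<open>a = x\<^sup>-\<^sup>1 y x y\<^sup>-\<^sup>1\<close>. The defining relation of \<open>G\<close> says exactly that \<open>a\<close> commutes with \<open>y\<close>, and
\<open>y x = x a y\<close> holds by the choice of \<open>a\<close>. Conjugation by \<open>y\<close> therefore preserves the subgroup \<open>F\<close>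
generated by \<open>x\<close> and \<open>a\<close>, and every element of \<open>G\<close> has the form \<open>f y\<^sup>k\<close> with \<open>f \<in> F\<close>
(\<open>normal_form\<close>). In fact \<open>F\<close> is free on \<open>x\<close> and \<open>a\<close>, and \<open>G\<close> is the semidirect product of \<open>F\<close>
with the infinite cyclic group generated by \<open>y\<close>.

All claims are read off from one faithful representation \<open>\<rho>\<close>. It acts on the formal power series
in two noncommuting variables \<open>\<xi>\<close>, \<open>\<alpha>\<close> over a commutative ring: \<open>x\<close> and \<open>a\<close> act by left
multiplication with \<open>1 + \<xi>\<close> and \<open>1 + \<alpha>\<close>, as in the Magnus embedding of a free group, and \<open>y\<close> acts by
the algebra automorphism that fixes \<open>\<alpha>\<close> and sends \<open>1 + \<xi>\<close> to \<open>(1 + \<xi>)(1 + \<alpha>)\<close>. With \<open>\<xi>\<close> of weight \<open>1\<close>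
and \<open>\<alpha>\<close> of weight \<open>2\<close> every group element acts by an operator \<open>T\<close> for which \<open>T - 1\<close> strictly raises
weights. Such unipotent operators form a group that behaves like an infinite group of unitriangular
matrices. Over the integers and the rationals \<open>\<rho>\<close> is faithful (\<open>rho_faithful\<close>): an alternating
product of powers of \<open>x\<close> and \<open>a\<close> with exponents \<open>n\<^sub>1, \<dots>, n\<^sub>r\<close> has a coefficient equal to \<open>n\<^sub>1 \<cdots> n\<^sub>r\<close>,
and the exponent of \<open>y\<close> is a coefficient as well.

The consequences are as follows.

\<^item> A maximal abelian subgroup containing \<open>y\<close> and \<open>x\<^sup>-\<^sup>1 y x\<close>, which commute, meets its conjugate
by \<open>x\<close> nontrivially, but does not contain \<open>x\<close>. Hence \<open>G\<close> is not a CSA-group.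

\<^item> Over the rationals a unipotent operator has the powers given by the binomial series, and its
roots are unique because \<open>S\<^sup>n - T\<^sup>n\<close> has leading term \<open>n (S - T)\<close>. So the unipotent operators form a
Q-group that contains \<open>G\<close>.

\<^item> Comparing leading terms in \<open>g h\<^sup>m g\<^sup>-\<^sup>1 = h\<^sup>n\<close> gives \<open>h = 1\<close> or \<open>m = n\<close>, and in the latter case
\<open>g h g\<^sup>-\<^sup>1 = h\<close> by uniqueness of roots. So the image of a Baumslag-Solitar group in \<open>G\<close> is abelian.

\<^item> The elements of \<open>G\<close> acting trivially modulo weight \<open>L\<close> form a normal subgroup with torsion-free
nilpotent quotient; those acting trivially modulo weight \<open>L\<close> and modulo \<open>p\<^sup>k\<close> form a normal
subgroup of finite \<open>p\<close>-power index. These subgroups have trivial intersection.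

\<^item> For the pro-\<open>p\<close>-completion it suffices to find, for each normal \<open>N\<close> of \<open>p\<close>-power index, another
such \<open>M\<close> for which \<open>g\<^sup>p \<in> M\<close> implies \<open>g \<in> N\<close> (\<open>p_th_roots_of_deep_elements\<close>). For elements of \<open>F\<close>
this rests on two facts. Modulo \<open>p\<close> one has \<open>(1 + u)\<^sup>p = 1 + u\<^sup>p\<close>, and the lowest term of \<open>u\<^sup>p\<close> is
the \<open>p\<close>-th power of that of \<open>u\<close>, so that \<open>f\<^sup>p\<close> is close to \<open>1\<close> only if \<open>f\<close> is
(\<open>basegroup_prime_root\<close>). And every \<open>N\<close> contains all elements of \<open>F\<close> that are close enough to \<open>1\<close>,
because the augmentation ideal of the group ring of a finite \<open>p\<close>-group over the field with \<open>p\<close>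
elements is nilpotent (\<open>fixed_level_exhausts\<close>, \<open>basegroup_congruence_kernel_cofinal\<close>).\<close>

section \<open>Unipotent operators on noncommutative power series\<close>

text \<open>The variables \<open>\<xi>\<close> and \<open>\<alpha>\<close>. A word stands for a monomial, read from left to right, and a series
is the function of its coefficients.\<close>

datatype var = Xi | Al

type_synonym 'r series = "var list \<Rightarrow> 'r"
type_synonym 'r operator = "'r series \<Rightarrow> 'r series"

text \<open>The variable \<open>\<alpha>\<close> has weight \<open>2\<close> because the automorphism by which \<open>y\<close> acts sends \<open>\<xi>\<close> to
\<open>\<xi> + \<alpha> + \<xi>\<alpha>\<close>: this choice makes the correction terms heavier than \<open>\<xi>\<close>.\<close>

fun wt :: "var list \<Rightarrow> nat" where
  "wt [] = 0"
| "wt (Xi # w) = wt w + 1"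
| "wt (Al # w) = wt w + 2"

lemma wt_append: "wt (u @ v) = wt u + wt v"
  by (induction u rule: wt.induct) auto

lemma length_le_wt: "length w \<le> wt w"
  by (induction w rule: wt.induct) auto

lemma wt_le_length: "wt w \<le> 2 * length w"
  by (induction w rule: wt.induct) auto

lemma finite_wt_less: "finite {w. wt w < n}"
proof (rule finite_subset)
  have "finite (UNIV :: var set)"
    by (rule finite_subset[of _ "{Xi, Al}"]) (use var.exhaust in auto)
  then show "finite {w :: var list. set w \<subseteq> UNIV \<and> length w \<le> n}"
    by (rule finite_lists_length_le)
  show "{w. wt w < n} \<subseteq> {w. set w \<subseteq> UNIV \<and> length w \<le> n}"
  proof (intro subsetI CollectI conjI)
    fix w assume "w \<in> {w. wt w < n}"
    then show "length w \<le> n" using length_le_wt[of w] by simp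
  qed simp
qed

definition lin :: "'r::comm_ring_1 operator \<Rightarrow> bool" where
  "lin D \<longleftrightarrow> (\<forall>u v. D (u + v) = D u + D v) \<and> (\<forall>c v. D (\<lambda>w. c * v w) = (\<lambda>w. c * D v w))"

definition deep :: "nat \<Rightarrow> 'r::comm_ring_1 series set" where
  "deep k = {v. \<forall>w. wt w < k \<longrightarrow> v w = 0}"

definition raises :: "nat \<Rightarrow> 'r::comm_ring_1 operator \<Rightarrow> bool" where
  "raises d D \<longleftrightarrow> lin D \<and> (\<forall>k. \<forall>v\<in>deep k. D v \<in> deep (k + d))"

lemma lin_add: "lin D \<Longrightarrow> D (u + v) = D u + D v"
  by (simp add: lin_def)

lemma lin_scale: "lin D \<Longrightarrow> D (\<lambda>w. c * v w) = (\<lambda>w. c * D v w)"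
  by (simp add: lin_def)

lemma lin_zero: "lin D \<Longrightarrow> D 0 = 0"
  by (metis add_cancel_right_right lin_add)

lemma lin_diff: "lin D \<Longrightarrow> D (u - v) = D u - D v"
  by (metis diff_add_cancel eq_diff_eq lin_add)

lemma lin_sum: "lin D \<Longrightarrow> D (\<lambda>w. \<Sum>i\<in>A. c i * f i w) = (\<lambda>w. \<Sum>i\<in>A. c i * D (f i) w)"
proof (induction A rule: infinite_finite_induct)
  case (insert a A)
  note l = insert.prems
  have "(\<lambda>w. \<Sum>i\<in>insert a A. c i * f i w) = (\<lambda>w. c a * f a w) + (\<lambda>w. \<Sum>i\<in>A. c i * f i w)"
    using insert by (auto simp: fun_eq_iff)
  then have "D (\<lambda>w. \<Sum>i\<in>insert a A. c i * f i w)
    = D (\<lambda>w. c a * f a w) + D (\<lambda>w. \<Sum>i\<in>A. c i * f i w)"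
    by (simp only: lin_add[OF l])
  also have "D (\<lambda>w. c a * f a w) = (\<lambda>w. c a * D (f a) w)" by (rule lin_scale[OF l])
  also have "D (\<lambda>w. \<Sum>i\<in>A. c i * f i w) = (\<lambda>w. \<Sum>i\<in>A. c i * D (f i) w)"
    by (rule insert.IH[OF l])
  finally show ?case using insert.hyps by (simp add: fun_eq_iff)
qed (use lin_zero[of D] in \<open>simp_all add: zero_fun_def\<close>)

lemma lin_comp: "lin S \<Longrightarrow> lin T \<Longrightarrow> lin (S \<circ> T)"
  by (simp add: lin_def)

lemma deep_add: "u \<in> deep k \<Longrightarrow> v \<in> deep k \<Longrightarrow> u + v \<in> deep k"
  and deep_diff: "u \<in> deep k \<Longrightarrow> v \<in> deep k \<Longrightarrow> u - v \<in> deep k"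
  and deep_uminus: "u \<in> deep k \<Longrightarrow> - u \<in> deep k"
  by (auto simp: deep_def)

lemma deep_0: "v \<in> deep 0"
  by (simp add: deep_def)

lemma deep_mono: "v \<in> deep k \<Longrightarrow> l \<le> k \<Longrightarrow> v \<in> deep l"
  by (auto simp: deep_def)

lemma deep_all: "(\<And>k. v \<in> deep k) \<Longrightarrow> v = 0"
  by (auto simp: deep_def fun_eq_iff)

lemma raises_lin: "raises d D \<Longrightarrow> lin D"
  by (simp add: raises_def)

lemma raises_deep: "raises d D \<Longrightarrow> v \<in> deep k \<Longrightarrow> D v \<in> deep (k + d)"
  by (simp add: raises_def)

lemma raises_mono: "raises d D \<Longrightarrow> e \<le> d \<Longrightarrow> raises e D"
  unfolding raises_def by (meson add_left_mono deep_mono)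

lemma raises_add: "raises d S \<Longrightarrow> raises d T \<Longrightarrow> raises d (S + T)"
  by (auto simp: raises_def lin_def deep_add algebra_simps fun_eq_iff)

lemma raises_diff: "raises d S \<Longrightarrow> raises d T \<Longrightarrow> raises d (S - T)"
  by (auto simp: raises_def lin_def deep_diff algebra_simps fun_eq_iff)

lemma raises_comp: "raises d S \<Longrightarrow> raises e T \<Longrightarrow> raises (d + e) (S \<circ> T)"
  unfolding raises_def by (auto intro: lin_comp simp: add.assoc) (metis add.assoc add.commute)

lemma raises_comp_left: "raises d S \<Longrightarrow> raises 0 T \<Longrightarrow> raises d (S \<circ> T)"
  using raises_comp[of d S 0 T] by simp

lemma raises_id: "raises 0 id"
  by (simp add: raises_def lin_def)

lemma raises_pow: "raises 1 D \<Longrightarrow> raises k (D ^^ k)"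
proof (induction k)
  case (Suc k)
  then show ?case using raises_comp[of 1 D k "D ^^ k"] by (simp add: comp_def)
qed (simp add: raises_id)

text \<open>A linear operator that does not lower weights computes the coefficient at \<open>w\<close> from the
coefficients up to the weight of \<open>w\<close>. This is what makes infinite sums of operators manageable.\<close>

lemma lin_locally_determined:
  assumes "raises 0 D" "\<And>w'. wt w' \<le> wt w \<Longrightarrow> u w' = v w'"
  shows "D u w = D v w"
proof -
  have "u - v \<in> deep (Suc (wt w))" using assms(2) by (auto simp: deep_def)
  then have "D (u - v) \<in> deep (Suc (wt w))" using raises_deep[OF assms(1)] by fastforce
  then show ?thesis by (simp add: deep_def lin_diff[OF raises_lin[OF assms(1)]])
qed

text \<open>The operator \<open>\<Sum>k. c\<^sub>k D\<^sup>k\<close>. If \<open>D\<close> raises weights, the terms beyond the weight of \<open>w\<close> do not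
contribute to the coefficient at \<open>w\<close>, which is why the sum stops there.\<close>

definition opseries :: "(nat \<Rightarrow> 'r) \<Rightarrow> 'r::comm_ring_1 operator \<Rightarrow> 'r operator" where
  "opseries c D v w = (\<Sum>k\<le>wt w. c k * (D ^^ k) v w)"

lemma opseries_truncate:
  assumes D: "raises 1 D" and n: "wt w \<le> n"
  shows "opseries c D v w = (\<Sum>k\<le>n. c k * (D ^^ k) v w)"
proof -
  have "(D ^^ k) v w = 0" if "wt w < k" for k
    using raises_deep[OF raises_pow[OF D] deep_0, of k v] that by (simp add: deep_def)
  then show ?thesis unfolding opseries_def using n
    by (intro sum.mono_neutral_left) auto
qed

text \<open>Operator series in the same \<open>D\<close> multiply like power series in one variable. Inverses, natural
powers and rational powers of \<open>1 + D\<close> are all obtained from this rule.\<close>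

lemma opseries_comp:
  assumes D: "raises 1 D"
  shows "opseries c D (opseries d D v) = opseries (\<lambda>n. \<Sum>i\<le>n. c i * d (n - i)) D v"
proof
  fix w
  define n where "n = wt w"
  define M where "M k = (D ^^ k) v w" for k
  have triangle: "{(i, j). i + j \<le> n} = Sigma {..n} (\<lambda>i. {..n - i})" by auto
  have M0: "M k = 0" if "n < k" for k
    using raises_deep[OF raises_pow[OF D] deep_0, of k v] that by (simp add: deep_def M_def n_def)
  have "opseries c D (opseries d D v) w = (\<Sum>i\<le>n. c i * (D ^^ i) (opseries d D v) w)"
    by (simp add: opseries_def n_def)
  also have "\<dots> = (\<Sum>i\<le>n. c i * (\<Sum>j\<le>n. d j * M (i + j)))"
  proof (intro sum.cong HOL.refl arg_cong2[where f = "(*)"])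
    fix i
    \<comment> \<open>up to the weight of \<open>w\<close> the inner series can be cut off uniformly at \<open>n\<close>\<close>
    have "(D ^^ i) (opseries d D v) w = (D ^^ i) (\<lambda>w. \<Sum>j\<le>n. d j * (D ^^ j) v w) w"
      by (rule lin_locally_determined[OF raises_mono[OF raises_pow[OF D]]])
        (auto simp: opseries_truncate[OF D] n_def)
    also have "\<dots> = (\<Sum>j\<le>n. d j * M (i + j))"
      by (simp add: lin_sum[OF raises_lin[OF raises_pow[OF D]]] M_def funpow_add)
    finally show "(D ^^ i) (opseries d D v) w = (\<Sum>j\<le>n. d j * M (i + j))" .
  qed
  also have "\<dots> = (\<Sum>i\<le>n. \<Sum>j\<le>n - i. c i * d j * M (i + j))"
  proof (rule sum.cong[OF HOL.refl])
    fix i assume "i \<in> {..n}"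
    have "(\<Sum>j\<le>n. d j * M (i + j)) = (\<Sum>j\<le>n - i. d j * M (i + j))"
    proof (rule sum.mono_neutral_right)
      show "\<forall>j\<in>{..n} - {..n - i}. d j * M (i + j) = 0"
      proof
        fix j assume "j \<in> {..n} - {..n - i}"
        then have "n < i + j" by auto
        then show "d j * M (i + j) = 0" by (simp only: M0 mult_zero_right)
      qed
    qed auto
    then show "c i * (\<Sum>j\<le>n. d j * M (i + j)) = (\<Sum>j\<le>n - i. c i * d j * M (i + j))"
      by (simp only: sum_distrib_left mult.assoc)
  qed
  also have "\<dots> = (\<Sum>k\<le>n. \<Sum>i\<le>k. c i * d (k - i) * M (i + (k - i)))"
    using sum.triangle_reindex_eq[of "\<lambda>i j. c i * d j * M (i + j)" n, symmetric]
    by (simp only: triangle sum.Sigma[OF finite_atMost ballI[OF finite_atMost]])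
  also have "\<dots> = opseries (\<lambda>n. \<Sum>i\<le>n. c i * d (n - i)) D v w"
    by (auto simp: opseries_def n_def M_def sum_distrib_right intro!: sum.cong)
  finally show "opseries c D (opseries d D v) w = opseries (\<lambda>n. \<Sum>i\<le>n. c i * d (n - i)) D v w" .
qed

lemma raises_opseries:
  assumes D: "raises 1 D" and c: "c 0 = 1"
  shows "raises 1 (opseries c D - id)"
proof -
  note l = raises_lin[OF raises_pow[OF D]]
  have "lin (opseries c D - id)"
    unfolding lin_def
    by (auto simp: opseries_def fun_eq_iff lin_add[OF l] lin_scale[OF l] sum.distrib
        algebra_simps sum_distrib_left)
  moreover have "(opseries c D - id) v \<in> deep (k + 1)" if v: "v \<in> deep k" for k v
  proof -
    have "opseries c D v w = v w" if "wt w < k + 1" for w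
    proof -
      have "(D ^^ i) v w = 0" if "i > 0" for i
        using raises_deep[OF raises_pow[OF D] v, of i] that \<open>wt w < k + 1\<close>
        by (auto simp: deep_def)
      then have "opseries c D v w = (\<Sum>i\<in>{0}. c i * (D ^^ i) v w)"
        unfolding opseries_def by (intro sum.mono_neutral_right) auto
      then show ?thesis by (simp add: c)
    qed
    then show ?thesis by (simp add: deep_def)
  qed
  ultimately show ?thesis by (simp add: raises_def)
qed

lemma opseries_linear:
  assumes D: "raises 1 (T - id)"
  shows "opseries (\<lambda>k. if k \<le> 1 then 1 else 0) (T - id) = (T :: 'r::comm_ring_1 operator)"
proof (intro ext)
  fix v w
  have "opseries (\<lambda>k. if k \<le> 1 then 1 else 0) (T - id) v w
    = (\<Sum>k\<le>Suc (wt w). (if k \<le> 1 then 1 else 0) * ((T - id) ^^ k) v w)"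
    by (rule opseries_truncate[OF D]) simp
  also have "\<dots> = (\<Sum>k\<in>{0,1}. (if k \<le> 1 then 1 else 0) * ((T - id) ^^ k) v w)"
    by (intro sum.mono_neutral_right) auto
  finally show "opseries (\<lambda>k. if k \<le> 1 then 1 else 0) (T - id) v w = T v w" by simp
qed

lemma opseries_id:
  "opseries (\<lambda>k. if k = 0 then 1 else 0) D = (id :: 'r::comm_ring_1 operator)"
proof (intro ext)
  fix v w
  have "opseries (\<lambda>k. if k = 0 then 1 else 0) D v w
    = (\<Sum>k\<in>{0}. (if k = 0 then 1 else 0) * (D ^^ k) v w)"
    unfolding opseries_def by (intro sum.mono_neutral_right) auto
  then show "opseries (\<lambda>k. if k = 0 then 1 else 0) D v w = id v w" by simp
qed

text \<open>The analogue of the group of upper unitriangular matrices.\<close>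

definition unipotents :: "'r::comm_ring_1 operator monoid" where
  "unipotents = \<lparr>carrier = {T. raises 1 (T - id)}, monoid.mult = (\<circ>), one = id\<rparr>"

lemma unipotents_simps [simp]:
  "T \<in> carrier unipotents \<longleftrightarrow> raises 1 (T - id)"
  "S \<otimes>\<^bsub>unipotents\<^esub> T = S \<circ> T" "\<one>\<^bsub>unipotents\<^esub> = id"
  by (simp_all add: unipotents_def)

lemma raises_0_unipotent: "raises 1 (T - id) \<Longrightarrow> raises 0 T"
  using raises_add[OF raises_mono[of 1 "T - id" 0] raises_id] by simp

text \<open>Only inverses need an argument: the geometric series in \<open>1 - T\<close> converges because \<open>1 - T\<close>
raises weights.\<close>

lemma group_unipotents: "group (unipotents :: 'r::comm_ring_1 operator monoid)"
proof (rule groupI)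
  fix S T :: "'r operator"
  assume ST: "S \<in> carrier unipotents" "T \<in> carrier unipotents"
  then have r: "raises 1 (S - id)" "raises 1 (T - id)" by simp_all
  have eq: "(S \<circ> T) - id = ((S - id) \<circ> T) + (T - id)" by (rule ext) simp
  show "S \<otimes>\<^bsub>unipotents\<^esub> T \<in> carrier unipotents"
    using raises_add[OF raises_comp_left[OF r(1) raises_0_unipotent[OF r(2)]] r(2)]
    unfolding unipotents_simps eq .
next
  fix T :: "'r operator"
  assume "T \<in> carrier unipotents"
  then have r: "raises 1 (T - id)" by simp
  \<comment> \<open>multiplying the geometric series by \<open>1 + (T - 1)\<close> telescopes\<close>
  define S where "S = opseries (\<lambda>k. (- 1) ^ k) (T - id)"
  have conv: "(\<lambda>n. \<Sum>i\<le>n. (- 1) ^ i * (if n - i \<le> 1 then 1 else 0 :: 'r))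
    = (\<lambda>n. if n = 0 then 1 else 0)"
  proof
    fix n :: nat
    show "(\<Sum>i\<le>n. (- 1) ^ i * (if n - i \<le> 1 then 1 else 0 :: 'r)) = (if n = 0 then 1 else 0)"
    proof (cases n)
      case (Suc m)
      have "(\<Sum>i\<le>n. (- 1) ^ i * (if n - i \<le> 1 then 1 else 0 :: 'r))
        = (\<Sum>i\<in>{m, n}. (- 1) ^ i * (if n - i \<le> 1 then 1 else 0 :: 'r))"
        using Suc by (intro sum.mono_neutral_right) auto
      then show ?thesis using Suc by simp
    qed simp
  qed
  have "S (T v) = v" for v
    using opseries_comp[OF r, of "\<lambda>k. (- 1) ^ k" "\<lambda>k. if k \<le> 1 then 1 else 0" v]
    unfolding opseries_linear[OF r] conv opseries_id by (simp add: S_def)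
  moreover have "S \<in> carrier unipotents"
    using raises_opseries[OF r, of "\<lambda>k. (- 1) ^ k"] by (simp add: S_def)
  ultimately show "\<exists>S\<in>carrier unipotents. S \<otimes>\<^bsub>unipotents\<^esub> T = \<one>\<^bsub>unipotents\<^esub>"
    by (intro bexI[of _ S]) (auto simp: fun_eq_iff)
qed (auto simp: o_assoc raises_def lin_def deep_def fun_eq_iff)

interpretation U: group "unipotents :: 'r::comm_ring_1 operator monoid"
  by (rule group_unipotents)

lemma unipotents_pow: "T [^]\<^bsub>unipotents\<^esub> (n::nat) = T ^^ n"
  by (induction n) (simp_all add: nat_pow_def funpow_swap1 fun_eq_iff)

lemma unipotents_inv:
  assumes "T \<in> carrier unipotents"
  shows "(inv\<^bsub>unipotents\<^esub> T) (T v) = v" "T ((inv\<^bsub>unipotents\<^esub> T) v) = v"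
  using U.l_inv[OF assms] U.r_inv[OF assms] by (simp_all add: fun_eq_iff del: unipotents_simps(1))

section \<open>Homomorphisms from a presented group\<close>

primrec weval :: "('a, 'b) monoid_scheme \<Rightarrow> ('g \<Rightarrow> 'a) \<Rightarrow> 'g word \<Rightarrow> 'a" where
  "weval H \<phi> [] = \<one>\<^bsub>H\<^esub>"
| "weval H \<phi> (l # w) = (if snd l then \<phi> (fst l) else inv\<^bsub>H\<^esub> \<phi> (fst l)) \<otimes>\<^bsub>H\<^esub> weval H \<phi> w"

context group
begin

lemma weval_closed: "range \<phi> \<subseteq> carrier G \<Longrightarrow> weval G \<phi> w \<in> carrier G"
  by (induction w) (auto simp: range_subsetD)

lemma weval_append:
  "range \<phi> \<subseteq> carrier G \<Longrightarrow> weval G \<phi> (u @ v) = weval G \<phi> u \<otimes> weval G \<phi> v"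
  by (induction u) (auto simp: range_subsetD weval_closed m_assoc)

lemma weval_winv:
  assumes \<phi>: "range \<phi> \<subseteq> carrier G"
  shows "weval G \<phi> (winv w) = inv (weval G \<phi> w)"
proof (induction w)
  case (Cons l w)
  obtain a b where l: "l = (a, b)" by fastforce
  have "winv (l # w) = winv w @ [(a, \<not> b)]" by (simp add: winv_def l)
  then show ?case using Cons \<phi>
    by (auto simp: l weval_append weval_closed inv_mult_group range_subsetD)
qed (simp add: winv_def)

lemma weval_wcomm:
  "range \<phi> \<subseteq> carrier G \<Longrightarrow> weval G \<phi> (wcomm u v)
    = inv (weval G \<phi> u) \<otimes> inv (weval G \<phi> v) \<otimes> weval G \<phi> u \<otimes> weval G \<phi> v"
  by (simp add: wcomm_def weval_append weval_winv weval_closed m_assoc)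

lemma weval_letter: "range \<phi> \<subseteq> carrier G \<Longrightarrow> weval G \<phi> (letter a) = \<phi> a"
  by (simp add: letter_def range_subsetD)

lemma weval_wpow:
  assumes \<phi>: "range \<phi> \<subseteq> carrier G"
  shows "weval G \<phi> (wpow w k) = weval G \<phi> w [^] k"
proof -
  have rep: "weval G \<phi> (concat (replicate n u)) = weval G \<phi> u [^] n" for n u
  proof (induction n)
    case (Suc n)
    then show ?case
      by (simp only: replicate_Suc concat.simps weval_append[OF \<phi>] nat_pow_Suc2[OF weval_closed[OF \<phi>]])
  qed simp
  show ?thesis
  proof (cases "k \<ge> 0")
    case True
    then have "weval G \<phi> (wpow w k) = weval G \<phi> w [^] nat k" by (simp only: wpow_def rep if_True)
    also have "\<dots> = weval G \<phi> w [^] k" by (rule pow_nat[OF True])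
    finally show ?thesis .
  next
    case False
    then have "weval G \<phi> (wpow w k) = inv (weval G \<phi> w) [^] nat (- k)"
      by (simp only: wpow_def rep weval_winv[OF \<phi>] if_False)
    also have "\<dots> = inv (weval G \<phi> w [^] nat (- k))" by (rule nat_pow_inv[OF weval_closed[OF \<phi>]])
    also have "\<dots> = weval G \<phi> w [^] k" using False by (subst int_pow_def2) simp
    finally show ?thesis .
  qed
qed

lemma weval_pres_eq:
  assumes \<phi>: "range \<phi> \<subseteq> carrier G" and R: "\<And>l r. (l, r) \<in> R \<Longrightarrow> weval G \<phi> l = weval G \<phi> r"
    and "pres_eq R u v"
  shows "weval G \<phi> u = weval G \<phi> v"
  using assms(3)
proof (induction rule: pres_eq.induct)
  case (cancel u a b v)
  have "\<phi> a \<in> carrier G" using \<phi> by blast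
  then have "weval G \<phi> [(a, b), (a, \<not> b)] = \<one>" by simp
  then show ?case by (simp only: weval_append[OF \<phi>] l_one weval_closed[OF \<phi>])
next
  case (relation l r u v)
  then show ?case by (simp add: weval_append[OF \<phi>] R)
qed auto

end

definition pres_lift ::
    "('a, 'b) monoid_scheme \<Rightarrow> ('g \<Rightarrow> 'a) \<Rightarrow> 'g word set \<Rightarrow> 'a" where
  "pres_lift H \<phi> A = weval H \<phi> (SOME w. w \<in> A)"

lemma pres_lift_word_class:
  assumes H: "group H" and \<phi>: "range \<phi> \<subseteq> carrier H"
    and R: "\<And>l r. (l, r) \<in> R \<Longrightarrow> weval H \<phi> l = weval H \<phi> r"
  shows "pres_lift H \<phi> (word_class R w) = weval H \<phi> w"
proof -
  have "w \<in> word_class R w" by (simp add: word_class_def pres_eq.refl)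
  then have "(SOME u. u \<in> word_class R w) \<in> word_class R w" by (rule someI)
  then have "pres_eq R w (SOME u. u \<in> word_class R w)" by (simp add: word_class_def)
  then show ?thesis
    unfolding pres_lift_def using group.weval_pres_eq[OF H \<phi> R] by metis
qed

lemma carrier_presentation: "carrier (presentation R) = range (word_class R)"
  by (simp add: presentation_def)

lemma one_presentation: "\<one>\<^bsub>presentation R\<^esub> = word_class R []"
  by (simp add: presentation_def)

lemma pres_lift_hom:
  assumes H: "group H" and \<phi>: "range \<phi> \<subseteq> carrier H"
    and R: "\<And>l r. (l, r) \<in> R \<Longrightarrow> weval H \<phi> l = weval H \<phi> r"
  shows "pres_lift H \<phi> \<in> hom (presentation R) H"
proof (rule homI)
  note [simp] = pres_lift_word_class[OF assms]
  fix A assume "A \<in> carrier (presentation R)"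
  then obtain u where A: "A = word_class R u" by (auto simp: carrier_presentation)
  show "pres_lift H \<phi> A \<in> carrier H" by (simp add: A group.weval_closed[OF H \<phi>])
  fix B assume "B \<in> carrier (presentation R)"
  then obtain v where B: "B = word_class R v" by (auto simp: carrier_presentation)
  show "pres_lift H \<phi> (A \<otimes>\<^bsub>presentation R\<^esub> B) = pres_lift H \<phi> A \<otimes>\<^bsub>H\<^esub> pres_lift H \<phi> B"
    by (simp add: A B word_class_mult group.weval_append[OF H \<phi>])
qed

lemma word_class_in_carrier: "word_class R w \<in> carrier (presentation R)"
  by (simp add: carrier_presentation)

lemma weval_word_class:
  "weval (presentation R) (\<lambda>a. word_class R (letter a)) w = word_class R w"
proof (induction w)
  case (Cons l w)
  interpret group "presentation R" by (rule group_presentation)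
  obtain a b where l: "l = (a, b)" by fastforce
  have "inv\<^bsub>presentation R\<^esub> word_class R (letter a) = word_class R [(a, False)]"
    by (rule inv_equality) (use pres_eq.cancel[of R "[]" a False "[]"] in
      \<open>auto simp: word_class_mult letter_def one_presentation word_class_eq_iff carrier_presentation\<close>)
  then have "(if b then word_class R (letter a) else inv\<^bsub>presentation R\<^esub> word_class R (letter a))
    = word_class R [(a, b)]" by (simp add: letter_def)
  then show ?case
    by (simp only: weval.simps l fst_conv snd_conv Cons.IH word_class_mult append.simps)
qed (simp add: one_presentation)

lemma range_letter_classes: "range (\<lambda>a. word_class R (letter a)) \<subseteq> carrier (presentation R)"
  by (auto simp: carrier_presentation)

lemma presentation_relation:
  assumes "(l, r) \<in> R"
  shows "weval (presentation R) (\<lambda>a. word_class R (letter a)) l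
    = weval (presentation R) (\<lambda>a. word_class R (letter a)) r"
  using pres_eq.relation[OF assms, of "[]" "[]"] by (simp add: weval_word_class word_class_eq_iff)

lemma (in group) commutes_inv:
  assumes "a \<in> carrier G" "b \<in> carrier G" "a \<otimes> b = b \<otimes> a"
  shows "inv a \<otimes> b = b \<otimes> inv a"
proof -
  have "a \<otimes> (b \<otimes> inv a) = b \<otimes> a \<otimes> inv a" using assms by (simp flip: m_assoc)
  also have "\<dots> = b" using assms by (simp add: m_assoc)
  finally show ?thesis using assms by (simp add: inv_solve_left')
qed

lemma (in group) commutes_mult:
  assumes "a \<in> carrier G" "b \<in> carrier G" "c \<in> carrier G" "a \<otimes> c = c \<otimes> a" "b \<otimes> c = c \<otimes> b"
  shows "a \<otimes> b \<otimes> c = c \<otimes> (a \<otimes> b)"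
proof -
  have "a \<otimes> b \<otimes> c = a \<otimes> (c \<otimes> b)" using assms by (simp add: m_assoc)
  also have "\<dots> = c \<otimes> a \<otimes> b" using assms by (simp flip: m_assoc)
  finally show ?thesis using assms by (simp add: m_assoc)
qed

text \<open>With \<open>z = x\<^sup>-\<^sup>1 y x\<close> one has \<open>[x, y] = z\<^sup>-\<^sup>1 y\<close> and \<open>a = z y\<^sup>-\<^sup>1\<close>, so each of \<open>[x, y]\<close>, \<open>z\<close>,
\<open>a\<close> commutes with \<open>y\<close> if one of them does.\<close>

lemma (in group) commutator_relation_iff:
  assumes xy: "x \<in> carrier G" "y \<in> carrier G"
  defines "c \<equiv> inv x \<otimes> inv y \<otimes> x \<otimes> y" and "a \<equiv> inv x \<otimes> y \<otimes> x \<otimes> inv y"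
  shows "inv c \<otimes> inv y \<otimes> c \<otimes> y = \<one> \<longleftrightarrow> a \<otimes> y = y \<otimes> a"
proof -
  define z where "z = inv x \<otimes> y \<otimes> x"
  have z: "z \<in> carrier G" using xy by (simp add: z_def)
  have c: "c = inv z \<otimes> y" and a: "a = z \<otimes> inv y"
    using xy by (simp_all add: c_def a_def z_def inv_mult_group m_assoc)
  have yy: "inv y \<otimes> y = y \<otimes> inv y" using xy by simp
  have cc: "c \<in> carrier G" using xy by (simp add: c_def)
  have "inv c \<otimes> inv y \<otimes> c \<otimes> y = inv (y \<otimes> c) \<otimes> (c \<otimes> y)"
    using xy cc by (simp add: inv_mult_group m_assoc)
  then have "inv c \<otimes> inv y \<otimes> c \<otimes> y = \<one> \<longleftrightarrow> c \<otimes> y = y \<otimes> c"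
    using xy cc by (simp add: inv_solve_left')
  also have "\<dots> \<longleftrightarrow> z \<otimes> y = y \<otimes> z"
  proof
    assume cy: "c \<otimes> y = y \<otimes> c"
    have "inv z = c \<otimes> inv y" using xy z c by (simp add: m_assoc)
    then have "inv z \<otimes> y = y \<otimes> inv z"
      using commutes_mult[OF cc _ xy(2) cy yy] xy by simp
    from commutes_inv[OF _ xy(2) this] show "z \<otimes> y = y \<otimes> z" using z by simp
  next
    assume "z \<otimes> y = y \<otimes> z"
    from commutes_inv[OF z xy(2) this] show "c \<otimes> y = y \<otimes> c"
      unfolding c using z by (intro commutes_mult xy inv_closed HOL.refl)
  qed
  also have "\<dots> \<longleftrightarrow> a \<otimes> y = y \<otimes> a"
  proof
    assume "z \<otimes> y = y \<otimes> z"
    then show "a \<otimes> y = y \<otimes> a"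
      unfolding a using z yy by (intro commutes_mult xy inv_closed)
  next
    assume ay: "a \<otimes> y = y \<otimes> a"
    have "a \<in> carrier G" "z = a \<otimes> y" using xy z a by (simp_all add: m_assoc)
    then show "z \<otimes> y = y \<otimes> z"
      using commutes_mult[OF _ xy(2) xy(2) ay HOL.refl] by simp
  qed
  finally show ?thesis .
qed

section \<open>Multiplication by a variable and the twisting automorphism\<close>

fun mul :: "var \<Rightarrow> 'r::comm_ring_1 operator" where
  "mul c v [] = 0"
| "mul c v (d # w) = (if d = c then v w else 0)"

definition one_plus :: "var \<Rightarrow> 'r::comm_ring_1 operator" where
  "one_plus c v = v + mul c v"

text \<open>The algebra automorphism with \<open>\<alpha> \<mapsto> \<alpha>\<close> and \<open>\<xi> \<mapsto> \<xi> + \<alpha> + \<xi>\<alpha>\<close>, in coefficients. Writing a series as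
\<open>c + \<xi> v\<^sub>0 + \<alpha> v\<^sub>1\<close> with \<open>v\<^sub>0\<close>, \<open>v\<^sub>1\<close> obtained by stripping the first letter, its image is
\<open>c + (\<xi> + \<alpha> + \<xi>\<alpha>) v\<^sub>0' + \<alpha> v\<^sub>1'\<close>, where the prime denotes the images of the shorter series.\<close>

fun twist :: "'r::comm_ring_1 operator" where
  "twist v [] = v []"
| "twist v [Xi] = twist (\<lambda>u. v (Xi # u)) []"
| "twist v (Xi # Xi # w) = twist (\<lambda>u. v (Xi # u)) (Xi # w)"
| "twist v (Xi # Al # w) = twist (\<lambda>u. v (Xi # u)) (Al # w) + twist (\<lambda>u. v (Xi # u)) w"
| "twist v (Al # w) = twist (\<lambda>u. v (Xi # u)) w + twist (\<lambda>u. v (Al # u)) w"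

lemma twist_Xi: "twist v (Xi # w) = twist (\<lambda>u. v (Xi # u)) w + mul Al (twist (\<lambda>u. v (Xi # u))) w"
proof (cases w)
  case (Cons d w')
  then show ?thesis by (cases d) auto
qed simp

lemma lin_mul: "lin (mul c)"
proof -
  have "mul c (u + v) w = mul c u w + mul c v w" for u v :: "'a series" and w by (cases w) auto
  moreover have "mul c (\<lambda>w. k * v w) w = k * mul c v w" for k and v :: "'a series" and w
    by (cases w) auto
  ultimately show ?thesis by (auto simp: lin_def fun_eq_iff)
qed

lemma raises_mul: "raises (wt [c]) (mul c)"
proof -
  have "mul c v w = 0" if v: "v \<in> deep k" and w: "wt w < k + wt [c]" for v :: "'a series" and k w
  proof (cases w)
    case (Cons d u)
    have "wt w = wt [d] + wt u" using wt_append[of "[d]" u] by (simp add: Cons)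
    then show ?thesis using v w by (auto simp: Cons deep_def)
  qed simp
  then show ?thesis by (auto simp: raises_def lin_mul deep_def)
qed

lemma one_plus_unipotent: "one_plus c \<in> carrier unipotents"
proof -
  have eq: "one_plus c - id = (mul c :: 'a operator)" by (rule ext) (simp add: one_plus_def)
  have "1 \<le> wt [c]" by (cases c) auto
  then show ?thesis unfolding unipotents_simps eq using raises_mul raises_mono by blast
qed

lemma twist_zero: "twist (\<lambda>_. 0) w = 0"
  by (induction "\<lambda>_ :: var list. 0 :: 'a" w rule: twist.induct) auto

text \<open>A monomial is changed only by monomials of larger weight, since replacing an occurrence of \<open>\<xi>\<close>
by \<open>\<alpha>\<close> or \<open>\<xi>\<alpha>\<close> increases the weight.\<close>

lemma twist_shape:
  assumes "v \<in> deep k" "wt w \<le> k"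
  shows "twist v w = v w"
  using assms
proof (induction v w arbitrary: k rule: twist.induct)
  case (2 v)
  then show ?case by simp
next
  case (3 v w)
  have "(\<lambda>u. v (Xi # u)) \<in> deep (k - 1)" using 3 by (auto simp: deep_def)
  then show ?case using 3 by fastforce
next
  case (4 v w)
  have d: "(\<lambda>u. v (Xi # u)) \<in> deep (k - 1)" using 4 by (auto simp: deep_def)
  then have "twist (\<lambda>u. v (Xi # u)) w = v (Xi # w)" using 4 by fastforce
  also have "\<dots> = 0" using 4 by (auto simp: deep_def)
  finally show ?case using 4 d by fastforce
next
  case (5 v w)
  have d: "(\<lambda>u. v (Xi # u)) \<in> deep (k - 1)" "(\<lambda>u. v (Al # u)) \<in> deep (k - 2)"
    using 5 by (auto simp: deep_def)
  have "twist (\<lambda>u. v (Xi # u)) w = v (Xi # w)" using 5 d by fastforce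
  also have "\<dots> = 0" using 5 by (auto simp: deep_def)
  finally show ?case using 5 d by fastforce
qed simp

lemma lin_twist: "lin twist"
proof -
  have "twist (u + v) w = twist u w + twist v w" for u v :: "'a series" and w
  proof (induction u w arbitrary: v rule: twist.induct)
    case (4 u w)
    have eq: "(\<lambda>z. (u + v) (Xi # z)) = (\<lambda>z. u (Xi # z)) + (\<lambda>z. v (Xi # z))" by auto
    show ?case unfolding twist.simps(4) eq 4 by simp
  next
    case (5 u w)
    have eq: "(\<lambda>z. (u + v) (d # z)) = (\<lambda>z. u (d # z)) + (\<lambda>z. v (d # z))" for d by auto
    show ?case unfolding twist.simps(5) eq 5 by simp
  next
    case (3 u w)
    have eq: "(\<lambda>z. (u + v) (Xi # z)) = (\<lambda>z. u (Xi # z)) + (\<lambda>z. v (Xi # z))" by auto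
    show ?case unfolding twist.simps(3) eq 3 by simp
  next
    case (2 u)
    have eq: "(\<lambda>z. (u + v) (Xi # z)) = (\<lambda>z. u (Xi # z)) + (\<lambda>z. v (Xi # z))" by auto
    show ?case unfolding twist.simps(2) eq 2 by simp
  qed simp
  moreover have "twist (\<lambda>w. k * v w) w = k * twist v w" for k and v :: "'a series" and w
    by (induction v w rule: twist.induct) (auto simp: algebra_simps)
  ultimately show ?thesis by (auto simp: lin_def fun_eq_iff)
qed

lemma twist_unipotent: "twist \<in> carrier unipotents"
proof -
  have "lin (twist - id)" using lin_twist by (auto simp: lin_def fun_eq_iff algebra_simps)
  moreover have "(twist - id) v \<in> deep (k + 1)" if "v \<in> deep k" for k and v :: "'a series"
    using twist_shape[OF that] by (simp add: deep_def)
  ultimately show ?thesis by (simp add: raises_def)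
qed

lemma twist_mul_Al: "twist (mul Al v) = mul Al (twist v)"
proof
  fix w show "twist (mul Al v) w = mul Al (twist v) w"
  proof (cases w)
    case (Cons d u)
    have "(\<lambda>u. mul Al v (Xi # u)) = (\<lambda>_. 0)" "(\<lambda>u. mul Al v (Al # u)) = v" by auto
    moreover have "mul Al (\<lambda>_. 0) u = (0 :: 'a)" by (cases u) auto
    moreover have "twist (\<lambda>_. 0) = (\<lambda>_. 0 :: 'a)" by (rule ext) (rule twist_zero)
    ultimately show ?thesis by (cases d) (simp_all add: Cons twist_Xi)
  qed simp
qed

lemma twist_mul_Xi: "twist (mul Xi v) = mul Xi (twist v) + mul Al (twist v) + mul Xi (mul Al (twist v))"
proof
  fix w
  show "twist (mul Xi v) w = (mul Xi (twist v) + mul Al (twist v) + mul Xi (mul Al (twist v))) w"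
  proof (cases w)
    case (Cons d u)
    have "(\<lambda>u. mul Xi v (Al # u)) = (\<lambda>_. 0)" "(\<lambda>u. mul Xi v (Xi # u)) = v" by auto
    then show ?thesis by (cases d) (simp_all add: Cons twist_Xi twist_zero)
  qed simp
qed

lemma twist_one_plus_Al: "twist (one_plus Al v) = one_plus Al (twist v)"
  by (simp add: one_plus_def lin_add[OF lin_twist] twist_mul_Al)

lemma twist_one_plus_Xi: "twist (one_plus Xi v) = one_plus Xi (one_plus Al (twist v))"
  by (simp add: one_plus_def lin_add[OF lin_twist] lin_add[OF lin_mul] twist_mul_Xi)

interpretation G: group group_xyy
  unfolding group_xyy_def by (rule group_presentation)

abbreviation G_mult (infixl "\<odot>" 70) where "g \<odot> h \<equiv> g \<otimes>\<^bsub>group_xyy\<^esub> h"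
abbreviation G_pow (infixr "\<up>" 75) where "g \<up> k \<equiv> g [^]\<^bsub>group_xyy\<^esub> k"
abbreviation G_inv ("\<iota>") where "\<iota> g \<equiv> inv\<^bsub>group_xyy\<^esub> g"

section \<open>The group and its representation\<close>

definition gword :: "gen word \<Rightarrow> gen word set" where
  "gword = word_class {(wcomm (wcomm (letter X) (letter Y)) (letter Y), [])}"

definition gx :: "gen word set" where "gx = gword (letter X)"
definition gy :: "gen word set" where "gy = gword (letter Y)"
definition ga :: "gen word set" where "ga = \<iota> gx \<odot> gy \<odot> gx \<odot> \<iota> gy"

lemma gxya [simp]: "gx \<in> carrier group_xyy" "gy \<in> carrier group_xyy" "ga \<in> carrier group_xyy"
proof -
  show "gx \<in> carrier group_xyy" "gy \<in> carrier group_xyy"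
    by (simp_all add: gx_def gy_def gword_def group_xyy_def word_class_in_carrier)
  then show "ga \<in> carrier group_xyy" by (simp add: ga_def)
qed

lemma case_gen_gx_gy: "case_gen gx gy = (\<lambda>a. gword (letter a))"
  by (rule ext) (simp add: gx_def gy_def split: gen.split)

lemma weval_gword: "weval group_xyy (case_gen gx gy) w = gword w"
  unfolding case_gen_gx_gy group_xyy_def gword_def by (rule weval_word_class)

lemma case_gen_range: "p \<in> C \<Longrightarrow> q \<in> C \<Longrightarrow> range (case_gen p q) \<subseteq> C"
  by (auto split: gen.split)

text \<open>The first equation is the defining relation, the second holds by the choice of \<open>a\<close>. Together
they describe the action of \<open>y\<close> on the subgroup generated by \<open>x\<close> and \<open>a\<close>.\<close>

lemma gx_gy_relation: "ga \<odot> gy = gy \<odot> ga" "gy \<odot> gx = gx \<odot> ga \<odot> gy"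
proof -
  have r: "range (case_gen gx gy) \<subseteq> carrier group_xyy" by (rule case_gen_range) simp_all
  have "weval group_xyy (case_gen gx gy) (wcomm (wcomm (letter X) (letter Y)) (letter Y)) = \<one>\<^bsub>group_xyy\<^esub>"
    unfolding case_gen_gx_gy group_xyy_def gword_def
    using presentation_relation[of "wcomm (wcomm (letter X) (letter Y)) (letter Y)" "[]"] by simp
  then show "ga \<odot> gy = gy \<odot> ga"
    using G.commutator_relation_iff[of gx gy]
    by (simp add: G.weval_wcomm[OF r] G.weval_letter[OF r] ga_def)
  show "gy \<odot> gx = gx \<odot> ga \<odot> gy"
    unfolding ga_def by (simp add: G.m_assoc) (simp flip: G.m_assoc)
qed

lemma carrier_induct [consumes 1, case_names one mult]:
  assumes "g \<in> carrier group_xyy" and one: "P \<one>\<^bsub>group_xyy\<^esub>"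
    and step: "\<And>g s. g \<in> carrier group_xyy \<Longrightarrow> P g \<Longrightarrow> s \<in> {gx, \<iota> gx, gy, \<iota> gy} \<Longrightarrow> P (g \<odot> s)"
  shows "P g"
proof -
  have r: "range (case_gen gx gy) \<subseteq> carrier group_xyy" by (rule case_gen_range) simp_all
  have "P (gword w)" for w
  proof (induction w rule: rev_induct)
    case Nil
    then show ?case using one by (simp flip: weval_gword)
  next
    case (snoc l w)
    obtain c b where l: "l = (c, b)" by fastforce
    have "weval group_xyy (case_gen gx gy) [l] \<in> {gx, \<iota> gx, gy, \<iota> gy}"
      by (cases c) (auto simp: l)
    moreover have "gword (w @ [l]) = gword w \<odot> weval group_xyy (case_gen gx gy) [l]"
      by (simp only: G.weval_append[OF r] flip: weval_gword)
    moreover have "gword w \<in> carrier group_xyy"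
      by (simp add: gword_def group_xyy_def word_class_in_carrier)
    ultimately show ?case using step snoc by metis
  qed
  then show ?thesis using assms(1) by (auto simp: group_xyy_def carrier_presentation gword_def)
qed

lemma (in group) commutes_int_pow:
  assumes a: "a \<in> carrier G" and b: "b \<in> carrier G" and ab: "a \<otimes> b = b \<otimes> a"
  shows "a [^] (k :: int) \<otimes> b = b \<otimes> a [^] k"
proof (cases k)
  case (nonneg n)
  then show ?thesis using group_commutes_pow[OF ab a b] by (simp add: int_pow_int)
next
  case (neg n)
  have "inv (a [^] Suc n) \<otimes> b = b \<otimes> inv (a [^] Suc n)"
    by (rule commutes_inv[OF nat_pow_closed[OF a] b group_commutes_pow[OF ab a b]])
  then show ?thesis using neg by (simp only: int_pow_neg_int[OF a])
qed

definition rho :: "gen word set \<Rightarrow> 'r::comm_ring_1 operator" where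
  "rho = pres_lift unipotents (case_gen (one_plus Xi) twist)"

text \<open>The operators chosen for \<open>x\<close> and \<open>y\<close> satisfy the defining relation, because the operator that
corresponds to \<open>a\<close> turns out to be multiplication by \<open>1 + \<alpha>\<close>, which commutes with the twisting
automorphism.\<close>

lemma rho_images:
  fixes \<phi> defines "\<phi> \<equiv> case_gen (one_plus Xi) (twist :: 'r::comm_ring_1 operator)"
  shows "range \<phi> \<subseteq> carrier unipotents"
    and "\<And>l r. (l, r) \<in> {(wcomm (wcomm (letter X) (letter Y)) (letter Y), [])} \<Longrightarrow>
      weval unipotents \<phi> l = weval unipotents \<phi> r"
    and "inv\<^bsub>unipotents\<^esub> (one_plus Xi) \<otimes>\<^bsub>unipotents\<^esub> twist \<otimes>\<^bsub>unipotents\<^esub> one_plus Xi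
      \<otimes>\<^bsub>unipotents\<^esub> inv\<^bsub>unipotents\<^esub> twist = (one_plus Al :: 'r operator)"
proof -
  let ?U = "unipotents :: 'r operator monoid"
  show r: "range \<phi> \<subseteq> carrier ?U"
    unfolding \<phi>_def by (intro case_gen_range one_plus_unipotent twist_unipotent)
  note u [simp] = one_plus_unipotent[where 'a = 'r, of Xi] one_plus_unipotent[where 'a = 'r, of Al]
    twist_unipotent[where 'a = 'r]
  have "twist \<otimes>\<^bsub>?U\<^esub> one_plus Xi = one_plus Xi \<otimes>\<^bsub>?U\<^esub> (one_plus Al \<otimes>\<^bsub>?U\<^esub> twist)"
    by (rule ext) (simp add: twist_one_plus_Xi del: u)
  then have "inv\<^bsub>?U\<^esub> (one_plus Xi) \<otimes>\<^bsub>?U\<^esub> (twist \<otimes>\<^bsub>?U\<^esub> one_plus Xi) = one_plus Al \<otimes>\<^bsub>?U\<^esub> twist"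
    using U.inv_solve_left'[OF U.m_closed[OF u(2,3)] u(1) U.m_closed[OF u(3,1)]] by blast
  then have "inv\<^bsub>?U\<^esub> (one_plus Xi) \<otimes>\<^bsub>?U\<^esub> twist \<otimes>\<^bsub>?U\<^esub> one_plus Xi = one_plus Al \<otimes>\<^bsub>?U\<^esub> twist"
    by (simp only: U.m_assoc[OF U.inv_closed[OF u(1)] u(3,1)])
  then show a: "inv\<^bsub>?U\<^esub> (one_plus Xi) \<otimes>\<^bsub>?U\<^esub> twist \<otimes>\<^bsub>?U\<^esub> one_plus Xi \<otimes>\<^bsub>?U\<^esub> inv\<^bsub>?U\<^esub> twist
      = one_plus Al"
    by (simp only: U.m_assoc[OF u(2,3) U.inv_closed[OF u(3)]] U.r_inv[OF u(3)] U.r_one[OF u(2)])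
  have "one_plus Al \<otimes>\<^bsub>?U\<^esub> twist = twist \<otimes>\<^bsub>?U\<^esub> one_plus Al"
    by (rule ext) (simp add: twist_one_plus_Al del: u)
  then have "weval ?U \<phi> (wcomm (wcomm (letter X) (letter Y)) (letter Y)) = \<one>\<^bsub>?U\<^esub>"
    unfolding U.weval_wcomm[OF r] U.weval_letter[OF r] unfolding \<phi>_def gen.case
    using U.commutator_relation_iff[OF u(1,3)] by (simp only: a)
  then show "weval ?U \<phi> l = weval ?U \<phi> r"
    if "(l, r) \<in> {(wcomm (wcomm (letter X) (letter Y)) (letter Y), [])}" for l r
    using that by simp
qed

lemma rho_hom: "rho \<in> hom group_xyy unipotents"
  unfolding rho_def group_xyy_def by (intro pres_lift_hom group_unipotents rho_images)

interpretation rho: group_hom group_xyy "unipotents :: 'r::comm_ring_1 operator monoid" rho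
  using rho_hom by unfold_locales

lemma rho_gword: "rho (gword w) = weval unipotents (case_gen (one_plus Xi) twist) w"
  unfolding rho_def gword_def
  by (rule pres_lift_word_class[OF group_unipotents rho_images(1)]) (rule rho_images(2))

lemma rho_gx: "rho gx = one_plus Xi" and rho_gy: "rho gy = twist"
  by (simp_all only: gx_def gy_def rho_gword U.weval_letter[OF rho_images(1)] gen.case)

lemma rho_ga: "rho ga = one_plus Al"
  unfolding ga_def rho_images(3)[symmetric]
  by (simp only: rho.hom_mult rho.hom_inv G.m_closed G.inv_closed gxya rho_gx rho_gy)

lemma rho_unipotent: "g \<in> carrier group_xyy \<Longrightarrow> raises 1 (rho g - id)"
  using rho.hom_closed unfolding unipotents_simps .

lemma rho_mult: "g \<in> carrier group_xyy \<Longrightarrow> h \<in> carrier group_xyy \<Longrightarrow> rho (g \<odot> h) v = rho g (rho h v)"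
  by simp

lemma rho_one: "rho \<one>\<^bsub>group_xyy\<^esub> v = v"
  by simp

lemma rho_inv:
  assumes "g \<in> carrier group_xyy"
  shows "rho (\<iota> g) (rho g v) = v" "rho g (rho (\<iota> g) v) = v"
  unfolding rho.hom_inv[OF assms] by (rule unipotents_inv[OF rho.hom_closed[OF assms]])+

text \<open>The normal free subgroup of rank two over which \<open>G\<close> is an extension by an infinite cyclic group.\<close>

definition basegroup :: "gen word set set" where
  "basegroup = generate group_xyy {gx, ga}"

lemma basegroup_subgroup: "subgroup basegroup group_xyy"
  unfolding basegroup_def by (rule G.generate_is_subgroup) auto

lemma basegroup_closed: "f \<in> basegroup \<Longrightarrow> f \<in> carrier group_xyy"
  using subgroup.mem_carrier[OF basegroup_subgroup] .

lemma gx_basegroup: "gx \<in> basegroup" and ga_basegroup: "ga \<in> basegroup"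
  by (auto simp: basegroup_def intro: generate.incl)

lemma gy_pow_gx: "gy \<up> k \<odot> gx = gx \<odot> ga \<up> k \<odot> gy \<up> (k :: int)"
proof -
  let ?P = "\<lambda>k :: int. gy \<up> k \<odot> gx = gx \<odot> ga \<up> k \<odot> gy \<up> k"
  have comm: "gy \<up> j \<odot> ga \<up> i = ga \<up> i \<odot> gy \<up> j" for i j :: int
    using G.commutes_int_pow[OF _ _ G.commutes_int_pow[OF _ _ gx_gy_relation(1), symmetric]] by simp
  have add: "?P (k + l)" if "?P k" "?P l" for k l
  proof -
    have "gy \<up> (k + l) \<odot> gx = gy \<up> k \<odot> (gy \<up> l \<odot> gx)"
      by (simp add: G.int_pow_mult G.m_assoc)
    also have "\<dots> = gy \<up> k \<odot> gx \<odot> (ga \<up> l \<odot> gy \<up> l)"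
      by (simp only: that(2)) (simp add: G.m_assoc)
    also have "\<dots> = gx \<odot> ga \<up> k \<odot> (gy \<up> k \<odot> ga \<up> l) \<odot> gy \<up> l"
      by (simp only: that(1)) (simp add: G.m_assoc)
    also have "\<dots> = gx \<odot> (ga \<up> k \<odot> ga \<up> l) \<odot> (gy \<up> k \<odot> gy \<up> l)"
      by (simp only: comm) (simp add: G.m_assoc)
    finally show ?thesis by (simp add: G.int_pow_mult)
  qed
  \<comment> \<open>the claim is additive in \<open>k\<close>, so it suffices to know it for \<open>1\<close> and \<open>-1\<close>\<close>
  have 1: "?P 1" using gx_gy_relation(2) by simp
  have m1: "?P (- 1)"
  proof -
    have "gx \<odot> \<iota> ga \<odot> \<iota> gy = \<iota> gy \<odot> gx"
    proof -
      have "\<iota> (gx \<odot> \<iota> ga \<odot> \<iota> gy) = gy \<odot> ga \<odot> \<iota> gx"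
        by (simp add: G.inv_mult_group G.m_assoc)
      have "gy \<odot> (gx \<odot> \<iota> ga \<odot> \<iota> gy) = gy \<odot> gx \<odot> \<iota> ga \<odot> \<iota> gy" by (simp add: G.m_assoc)
      also have "\<dots> = gx \<odot> (ga \<odot> gy) \<odot> \<iota> ga \<odot> \<iota> gy" by (simp only: gx_gy_relation(2)) (simp add: G.m_assoc)
      also have "\<dots> = gx" by (simp only: gx_gy_relation(1)) (simp add: G.m_assoc G.r_inv)
      finally show ?thesis using G.inv_solve_left[of "gx \<odot> \<iota> ga \<odot> \<iota> gy" gy gx] by simp
    qed
    then show ?thesis by (simp add: G.int_pow_neg)
  qed
  show "?P k"
  proof (induction k rule: int_induct[where k = 0])
    case (step1 i)
    then show ?case using add[of i 1] 1 by blast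
  next
    case (step2 i)
    then show ?case using add[of i "- 1"] m1 by simp
  qed simp
qed

text \<open>Letters can be appended on the right: \<open>y\<^sup>k x = (x a\<^sup>k) y\<^sup>k\<close> moves an \<open>x\<close> past the power of \<open>y\<close>.\<close>

lemma normal_form:
  assumes "g \<in> carrier group_xyy"
  shows "\<exists>f\<in>basegroup. \<exists>k::int. g = f \<odot> gy \<up> k"
  using assms
proof (induction rule: carrier_induct)
  case one
  show ?case
    by (rule bexI[of _ "\<one>\<^bsub>group_xyy\<^esub>"], rule exI[of _ 0])
      (simp_all add: subgroup.one_closed[OF basegroup_subgroup])
next
  case (mult g s)
  then obtain f and k :: int where f: "f \<in> basegroup" and g: "g = f \<odot> gy \<up> k" by blast
  note fc [simp] = basegroup_closed[OF f]
  define c where "c = gx \<odot> ga \<up> k"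
  have c: "c \<in> basegroup"
    unfolding c_def
    by (intro subgroup.m_closed[OF basegroup_subgroup] gx_basegroup
        G.subgroup_int_pow_closed[OF basegroup_subgroup] ga_basegroup)
  note cc [simp] = basegroup_closed[OF c]
  have cx: "gy \<up> k \<odot> gx = c \<odot> gy \<up> k"
    unfolding c_def by (rule gy_pow_gx)
  have ci: "gy \<up> k \<odot> \<iota> gx = \<iota> c \<odot> gy \<up> k"
  proof -
    have "c \<odot> (gy \<up> k \<odot> \<iota> gx) = gy \<up> k"
      using cx[symmetric] G.m_assoc[of c "gy \<up> k" "\<iota> gx"] by (simp add: G.m_assoc)
    then show ?thesis using G.inv_solve_left[of "gy \<up> k \<odot> \<iota> gx" c "gy \<up> k"] by simp
  qed
  consider "s = gx" | "s = \<iota> gx" | "s = gy" | "s = \<iota> gy" using mult.hyps by blast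
  then show ?case
  proof cases
    case 1
    have "g \<odot> s = (f \<odot> c) \<odot> gy \<up> k" using cx by (simp add: g 1 G.m_assoc)
    then show ?thesis using subgroup.m_closed[OF basegroup_subgroup f c] by blast
  next
    case 2
    have "g \<odot> s = (f \<odot> \<iota> c) \<odot> gy \<up> k" using ci by (simp add: g 2 G.m_assoc)
    then show ?thesis
      using subgroup.m_closed[OF basegroup_subgroup f subgroup.m_inv_closed[OF basegroup_subgroup c]] by blast
  next
    case 3
    have "g \<odot> s = f \<odot> gy \<up> (k + 1)" by (simp add: g 3 G.m_assoc G.int_pow_mult)
    then show ?thesis using f by blast
  next
    case 4
    have "g \<odot> s = f \<odot> gy \<up> (k + - 1)"
      unfolding G.int_pow_mult[OF gxya(2)] by (simp add: g 4 G.m_assoc G.int_pow_neg)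
    then show ?thesis using f by blast
  qed
qed

section \<open>Magnus coefficients and faithfulness\<close>

fun gbase :: "var \<Rightarrow> gen word set" where
  "gbase Xi = gx" | "gbase Al = ga"

fun syllables :: "(var \<times> int) list \<Rightarrow> gen word set" where
  "syllables [] = \<one>\<^bsub>group_xyy\<^esub>"
| "syllables ((c, n) # s) = gbase c \<up> n \<odot> syllables s"

fun alternating :: "var list \<Rightarrow> bool" where
  "alternating (c # d # w) \<longleftrightarrow> c \<noteq> d \<and> alternating (d # w)"
| "alternating _ \<longleftrightarrow> True"

definition reduced :: "(var \<times> int) list \<Rightarrow> bool" where
  "reduced s \<longleftrightarrow> alternating (map fst s) \<and> 0 \<notin> snd ` set s"

lemma gbase_closed [simp]: "gbase c \<in> carrier group_xyy"
  by (cases c) simp_all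

lemma basegroup_induct [consumes 1, case_names one gen inv mult]:
  assumes "f \<in> basegroup" and "P \<one>\<^bsub>group_xyy\<^esub>"
    and "\<And>c. P (gbase c)" and "\<And>c. P (\<iota> (gbase c))"
    and mult: "\<And>g h. g \<in> carrier group_xyy \<Longrightarrow> h \<in> carrier group_xyy \<Longrightarrow> P g \<Longrightarrow> P h \<Longrightarrow> P (g \<odot> h)"
  shows "P f"
  using assms(1) unfolding basegroup_def
proof (induction rule: generate.induct)
  case one
  show ?case by (rule assms(2))
next
  case (incl h)
  then show ?case using assms(3)[of Xi] assms(3)[of Al] by auto
next
  case (inv h)
  then show ?case using assms(4)[of Xi] assms(4)[of Al] by auto
next
  case (eng g h)
  then show ?case using basegroup_closed unfolding basegroup_def by (intro mult) blast+
qed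

lemma syllables_closed [simp]: "syllables s \<in> carrier group_xyy"
  by (induction s rule: syllables.induct) simp_all

lemma alternating_Cons: "alternating (c # w) \<longleftrightarrow> alternating w \<and> (w = [] \<or> hd w \<noteq> c)"
  by (cases w) auto

lemma syllables_mult_power:
  fixes m :: int
  assumes "reduced s"
  shows "\<exists>t. reduced t \<and> gbase c \<up> m \<odot> syllables s = syllables t"
proof (cases "m = 0")
  case True
  then show ?thesis using assms by (intro exI[of _ s]) simp
next
  case m: False
  show ?thesis
  proof (cases "s = [] \<or> fst (hd s) \<noteq> c")
    case True
    then have "reduced ((c, m) # s)"
      using assms m by (cases s) (auto simp: reduced_def)
    then show ?thesis by (intro exI[of _ "(c, m) # s"]) simp
  next
    case False
    then obtain n r where s: "s = (c, n) # r" by (cases s) auto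
    have r: "reduced r" and n: "n \<noteq> 0" using assms by (auto simp: s reduced_def alternating_Cons)
    have eq: "gbase c \<up> m \<odot> syllables s = gbase c \<up> (m + n) \<odot> syllables r"
      by (simp add: s G.int_pow_mult G.m_assoc)
    show ?thesis
    proof (cases "m + n = 0")
      case True
      then show ?thesis using eq r by (intro exI[of _ r]) simp
    next
      case False
      then have "reduced ((c, m + n) # r)" using assms by (auto simp: s reduced_def alternating_Cons)
      then show ?thesis using eq by (intro exI[of _ "(c, m + n) # r"]) simp
    qed
  qed
qed

text \<open>The reduced products are stable under left multiplication by powers of the generators, hence
exhaust the group that these generate.\<close>

lemma basegroup_syllables:
  assumes "f \<in> basegroup"
  shows "\<exists>s. reduced s \<and> f = syllables s"
proof -
  have "\<forall>s. reduced s \<longrightarrow> (\<exists>t. reduced t \<and> f \<odot> syllables s = syllables t)"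
    using assms
  proof (induction rule: basegroup_induct)
    case one
    then show ?case by auto
  next
    case (gen c)
    show ?case using syllables_mult_power[of _ c 1] unfolding G.int_pow_1[OF gbase_closed] by iprover
  next
    case (inv c)
    show ?case using syllables_mult_power[of _ c "- 1"]
      unfolding G.int_pow_neg[OF gbase_closed] G.int_pow_1[OF gbase_closed] by iprover
  next
    case (mult g h)
    then have "g \<odot> h \<odot> syllables s = g \<odot> (h \<odot> syllables s)" for s by (simp add: G.m_assoc)
    then show ?case using mult.IH by metis
  qed
  moreover have "reduced []" by (simp add: reduced_def)
  ultimately have "\<exists>t. reduced t \<and> f \<odot> syllables [] = syllables t" by blast
  then show ?thesis using basegroup_closed[OF assms] by auto
qed

definition unit_series :: "'r::comm_ring_1 series" where
  "unit_series w = (if w = [] then 1 else 0)"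

lemma rho_gbase: "rho (gbase c) = one_plus c"
  by (cases c) (simp_all add: rho_gx rho_ga)

text \<open>This is \<open>(1 + c)\<^sup>n v = v + n c v + \<dots>\<close> in a form that also covers negative \<open>n\<close>: at words starting
with at most one \<open>c\<close> the omitted terms, divisible by \<open>c\<^sup>2\<close> on the left, do not contribute.\<close>

lemma one_plus_power_coeff:
  fixes v :: "'r::comm_ring_1 series" and n :: int
  assumes "w = [] \<or> hd w \<noteq> c"
  shows "rho (gbase c \<up> n) v w = v w"
    and "rho (gbase c \<up> n) v (c # w) = v (c # w) + of_int n * v w"
proof -
  let ?P = "\<lambda>n (v :: 'r series). rho (gbase c \<up> n) v w = v w \<and>
    rho (gbase c \<up> n) v (c # w) = v (c # w) + of_int n * v w"
  have mul_w: "mul c v w = 0" for v :: "'r series" using assms by (cases w) auto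
  have step: "rho (gbase c \<up> (n + m)) v
      = rho (gbase c \<up> n) (rho (gbase c \<up> m) v)" for n m :: int and v :: "'r series"
    by (simp only: G.int_pow_mult[OF gbase_closed] rho_mult[OF G.int_pow_closed[OF gbase_closed] G.int_pow_closed[OF gbase_closed]])
  have 1: "rho (gbase c \<up> (1 :: int)) = (one_plus c :: 'r operator)"
    by (simp only: G.int_pow_1[OF gbase_closed] rho_gbase)
  have "?P n v" for n and v :: "'r series"
  proof (induction n arbitrary: v rule: int_induct[where k = 0])
    case base
    show ?case by (simp add: rho_one del: rho.hom_one)
  next
    case (step1 i)
    have eq: "rho (gbase c \<up> (i + 1)) v = rho (gbase c \<up> i) (one_plus c v)"
      by (simp only: step 1)
    have "one_plus c v w = v w" "one_plus c v (c # w) = v (c # w) + v w"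
      by (simp_all add: one_plus_def mul_w)
    then show ?case unfolding eq using step1(2)[of "one_plus c v"] by (simp add: algebra_simps)
  next
    case (step2 i)
    define u where "u = rho (gbase c \<up> (- 1 :: int)) v"
    have "one_plus c u = v"
      using step[of 1 "- 1" v] by (simp add: rho_gbase u_def)
    then have "v w' = u w' + mul c u w'" for w' by (auto simp: one_plus_def)
    then have v: "v w = u w" "v (c # w) = u (c # w) + u w" by (simp_all add: mul_w)
    have eq: "rho (gbase c \<up> (i - 1)) v = rho (gbase c \<up> i) u"
      using step[of i "- 1" v] by (simp add: u_def)
    show ?case unfolding eq using step2(2)[of u] by (simp add: v algebra_simps)
  qed
  then show "rho (gbase c \<up> n) v w = v w"
    "rho (gbase c \<up> n) v (c # w) = v (c # w) + of_int n * v w" by blast+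
qed

text \<open>A monomial that alternates more often than the product cannot arise from it, since each power
contributes at most one letter to an alternating monomial.\<close>

lemma rho_syllables_short:
  "alternating w \<Longrightarrow> length s < length w \<Longrightarrow> rho (syllables s) unit_series w = (0 :: 'r::comm_ring_1)"
proof (induction s arbitrary: w rule: syllables.induct)
  case 1
  then show ?case by (auto simp: unit_series_def rho_one simp del: rho.hom_one)
next
  case (2 c n s)
  then obtain d u where w: "w = d # u" by (cases w) auto
  have u: "alternating u" "u = [] \<or> hd u \<noteq> d" using 2 by (auto simp: w alternating_Cons)
  let ?v = "rho (syllables s) unit_series :: 'r series"
  have v: "?v w = 0" using 2 by simp
  have "rho (syllables ((c, n) # s)) unit_series w = rho (gbase c \<up> n) ?v w"
    by (simp only: syllables.simps rho_mult[OF G.int_pow_closed[OF gbase_closed] syllables_closed])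
  also have "\<dots> = 0"
  proof (cases "d = c")
    case True
    have "?v u = 0" using 2 u by (simp add: w)
    then show ?thesis using one_plus_power_coeff(2)[of u c n ?v] u v by (simp add: w True)
  next
    case False
    then show ?thesis using one_plus_power_coeff(1)[of w c n ?v] v by (simp add: w)
  qed
  finally show ?case .
qed

text \<open>The Magnus coefficient: each syllable has to contribute exactly one letter, and does so with
its exponent as coefficient.\<close>

lemma rho_syllables_coeff:
  "alternating (map fst s) \<Longrightarrow>
    rho (syllables s) unit_series (map fst s) = (\<Prod>x\<leftarrow>s. of_int (snd x) :: 'r::comm_ring_1)"
proof (induction s rule: syllables.induct)
  case 1
  then show ?case by (simp add: unit_series_def rho_one del: rho.hom_one)
next
  case (2 c n s)
  let ?v = "rho (syllables s) unit_series :: 'r series"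
  have "rho (syllables ((c, n) # s)) unit_series (c # map fst s)
      = rho (gbase c \<up> n) ?v (c # map fst s)"
    by (simp only: syllables.simps rho_mult[OF G.int_pow_closed[OF gbase_closed] syllables_closed])
  also have "\<dots> = ?v (c # map fst s) + of_int n * ?v (map fst s)"
    using 2 by (intro one_plus_power_coeff(2)) (simp add: alternating_Cons)
  also have "?v (c # map fst s) = 0"
    using 2 by (intro rho_syllables_short) auto
  finally show ?case using 2 by (simp add: alternating_Cons)
qed

lemma basegroup_faithful:
  assumes f: "f \<in> basegroup"
    and triv: "rho f unit_series = (unit_series :: 'r::{idom, ring_char_0} series)"
  shows "f = \<one>\<^bsub>group_xyy\<^esub>"
proof -
  obtain s where s: "reduced s" "f = syllables s" using basegroup_syllables[OF f] by blast
  have "(\<Prod>x\<leftarrow>s. of_int (snd x) :: 'r) \<noteq> 0"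
    using s(1) by (force simp: reduced_def prod_list_zero_iff)
  then have "unit_series (map fst s) \<noteq> (0 :: 'r)"
    using rho_syllables_coeff[of s, where 'r = 'r] s triv by (simp add: reduced_def)
  then have "s = []" by (auto simp: unit_series_def split: if_splits)
  then show ?thesis using s by simp
qed

text \<open>On series without constant term, modulo those of weight above \<open>2\<close> and the monomial \<open>\<xi>\<xi>\<close>, the
group acts through the transvection \<open>\<xi> \<mapsto> \<xi> + k \<alpha>\<close>, where \<open>k\<close> is the total exponent of \<open>y\<close>. This
makes \<open>k\<close> visible in the representation.\<close>

definition y_exponent_on :: "'r::comm_ring_1 operator \<Rightarrow> int \<Rightarrow> bool" where
  "y_exponent_on T k \<longleftrightarrow> (\<forall>v. v [] = 0 \<longrightarrow> T v [Xi] = v [Xi] \<and> T v [Al] = v [Al] + of_int k * v [Xi])"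

lemma rho_Nil: "g \<in> carrier group_xyy \<Longrightarrow> rho g v [] = v []"
  using raises_deep[OF rho_unipotent deep_0, of g v] by (simp add: deep_def)

lemma y_exponent_mult:
  assumes "g \<in> carrier group_xyy" "h \<in> carrier group_xyy"
    "y_exponent_on (rho g :: 'r::comm_ring_1 operator) k" "y_exponent_on (rho h :: 'r operator) l"
  shows "y_exponent_on (rho (g \<odot> h) :: 'r operator) (k + l)"
  using assms(3,4) unfolding y_exponent_on_def rho_mult[OF assms(1,2)]
  by (auto simp: rho_Nil assms algebra_simps)

lemma y_exponent_inv:
  assumes g: "g \<in> carrier group_xyy" and k: "y_exponent_on (rho g :: 'r::comm_ring_1 operator) k"
  shows "y_exponent_on (rho (\<iota> g) :: 'r operator) (- k)"
  unfolding y_exponent_on_def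
proof (intro allI impI)
  fix v :: "'r series" assume v: "v [] = 0"
  define u where "u = rho (\<iota> g) v"
  have "u [] = 0" using g v by (simp only: u_def rho_Nil G.inv_closed)
  moreover have "rho g u = v" using g by (simp only: u_def rho_inv)
  ultimately have "v [Xi] = u [Xi]" "v [Al] = u [Al] + of_int k * u [Xi]"
    using k unfolding y_exponent_on_def by metis+
  then show "rho (\<iota> g) v [Xi] = v [Xi] \<and> rho (\<iota> g) v [Al] = v [Al] + of_int (- k) * v [Xi]"
    unfolding u_def[symmetric] by simp
qed

lemma y_exponent_gens:
  "y_exponent_on (rho gx) 0" "y_exponent_on (rho ga) 0" "y_exponent_on (rho gy) 1"
  by (simp_all add: y_exponent_on_def rho_gx rho_ga rho_gy one_plus_def algebra_simps)

lemma y_exponent_one: "y_exponent_on (rho \<one>\<^bsub>group_xyy\<^esub>) 0"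
  by (simp add: y_exponent_on_def rho_one del: rho.hom_one)

lemma y_exponent_basegroup:
  assumes "f \<in> basegroup"
  shows "y_exponent_on (rho f) 0"
  using assms
proof (induction rule: basegroup_induct)
  case (gen c)
  show ?case by (cases c) (simp_all only: gbase.simps y_exponent_gens)
next
  case (inv c)
  have "y_exponent_on (rho (gbase c) :: 'a operator) 0"
    by (cases c) (simp_all only: gbase.simps y_exponent_gens)
  from y_exponent_inv[OF gbase_closed this] show ?case by (simp only: minus_zero)
next
  case (mult g h)
  from y_exponent_mult[OF mult.hyps mult.IH] show ?case by (simp only: add_0)
qed (rule y_exponent_one)

lemma y_exponent_pow:
  fixes n :: int
  assumes g: "g \<in> carrier group_xyy" and k: "y_exponent_on (rho g :: 'r::comm_ring_1 operator) k"
  shows "y_exponent_on (rho (g \<up> n) :: 'r operator) (k * n)"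
proof (induction n rule: int_induct[where k = 0])
  case base
  show ?case by (simp add: y_exponent_one del: rho.hom_one)
next
  case (step1 i)
  show ?case using y_exponent_mult[OF G.int_pow_closed[OF g] g step1(2) k]
    by (simp only: G.int_pow_mult[OF g] G.int_pow_1[OF g] distrib_left mult_1_right)
next
  case (step2 i)
  then have "y_exponent_on (rho (g \<up> i \<odot> \<iota> g) :: 'r operator) (k * i + - k)"
    using y_exponent_mult[OF G.int_pow_closed[OF g] G.inv_closed[OF g] _ y_exponent_inv[OF g k]] by blast
  moreover have "g \<up> i \<odot> \<iota> g = g \<up> (i - 1)"
    using g G.int_pow_mult[OF g, of i "- 1"] by (simp add: G.int_pow_neg)
  ultimately show ?case by (simp only: right_diff_distrib mult_1_right add_uminus_conv_diff)
qed

lemma y_exponent_normal_form: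
  assumes "f \<in> basegroup"
  shows "y_exponent_on (rho (f \<odot> gy \<up> k)) k"
  using y_exponent_mult[OF basegroup_closed[OF assms] G.int_pow_closed[OF gxya(2)]
      y_exponent_basegroup[OF assms] y_exponent_pow[OF gxya(2) y_exponent_gens(3)], of k]
  by simp

text \<open>For \<open>g = f y\<^sup>k\<close> acting trivially, the coefficient of \<open>\<alpha>\<close> gives \<open>k = 0\<close>, and then the Magnus
coefficients give \<open>f = 1\<close>.\<close>

theorem rho_faithful:
  assumes g: "g \<in> carrier group_xyy"
    and triv: "rho g = (id :: 'r::{idom, ring_char_0} operator)"
  shows "g = \<one>\<^bsub>group_xyy\<^esub>"
proof -
  obtain f and k :: int where f: "f \<in> basegroup" and gf: "g = f \<odot> gy \<up> k"
    using normal_form[OF g] by blast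
  have "y_exponent_on (id :: 'r operator) k"
    using y_exponent_normal_form[OF f, of k, where 'a = 'r] gf triv by simp
  moreover define v :: "'r series" where "v = (\<lambda>w. if w = [Xi] then 1 else 0)"
  ultimately have k: "k = 0" unfolding y_exponent_on_def by (auto dest!: spec[of _ v])
  have "rho f unit_series = (unit_series :: 'r series)"
    using triv f by (simp add: gf k basegroup_closed)
  then have "f = \<one>\<^bsub>group_xyy\<^esub>" by (rule basegroup_faithful[OF f])
  then show ?thesis by (simp add: gf k)
qed

lemma inj_rho: "inj_on (rho :: _ \<Rightarrow> 'r::{idom, ring_char_0} operator) (carrier group_xyy)"
  using rho_faithful[where 'r = 'r] by (intro rho.inj_on_one_iff[THEN iffD2]) auto

section \<open>Uniqueness of roots and rational powers\<close>

lemma unipotent_pow: "raises 1 (T - id) \<Longrightarrow> raises 1 (T ^^ n - id)"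
  using U.nat_pow_closed[of T n] unfolding unipotents_pow unipotents_simps .

lemma unipotent_shift: "raises 1 (T - id) \<Longrightarrow> v \<in> deep k \<Longrightarrow> T v - v \<in> deep (k + 1)"
  using raises_deep[of 1 "T - id"] by simp

lemma unipotent_lin: "raises 1 (T - id) \<Longrightarrow> lin T"
  by (rule raises_lin[OF raises_0_unipotent])

lemma deep_scale: "v \<in> deep k \<Longrightarrow> (\<lambda>w. c * v w) \<in> deep k"
  by (simp add: deep_def)

lemma raises_deep_le: "raises d D \<Longrightarrow> v \<in> deep k \<Longrightarrow> l \<le> k + d \<Longrightarrow> D v \<in> deep l"
  using raises_deep deep_mono by blast

text \<open>The leading term of \<open>S\<^sup>m - T\<^sup>m\<close> is \<open>m (S - T)\<close>, as in \<open>\<Sum>i. S\<^sup>i (S - T) T\<^sup>m\<^sup>-\<^sup>1\<^sup>-\<^sup>i\<close> all powers of \<open>S\<close>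
and \<open>T\<close> act trivially up to heavier terms.\<close>

lemma power_difference_leading:
  assumes S: "raises 1 (S - id)" and T: "raises 1 (T - id)" and D: "raises d (S - T)"
    and v: "v \<in> deep k"
  shows "(S ^^ m) v - (T ^^ m) v - (\<lambda>w. of_nat m * (S - T) v w) \<in> deep (k + d + 1)"
proof (induction m)
  case 0
  have "(\<lambda>w. of_nat 0 * (S - T) v w) = 0" by auto
  then show ?case by (simp add: deep_def)
next
  case (Suc m)
  define a b where "a = (S ^^ m) v" and "b = (T ^^ m) v"
  have "(\<lambda>w. of_nat m * (S - T) v w) \<in> deep (k + d)"
    by (rule deep_scale[OF raises_deep[OF D v]])
  moreover have "a - b = (a - b - (\<lambda>w. of_nat m * (S - T) v w)) + (\<lambda>w. of_nat m * (S - T) v w)"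
    by (simp only: diff_add_cancel)
  ultimately have "a - b \<in> deep (k + d)"
    using deep_add[OF deep_mono[OF Suc[folded a_def b_def]], of "k + d"] by (metis le_add1)
  then have 1: "S (a - b) - (a - b) \<in> deep (k + d + 1)" by (rule unipotent_shift[OF S])
  have "b - v \<in> deep (k + 1)"
    unfolding b_def by (rule unipotent_shift[OF unipotent_pow[OF T] v])
  then have 2: "(S - T) (b - v) \<in> deep (k + d + 1)" by (rule raises_deep_le[OF D]) simp
  have ab: "(S ^^ Suc m) v = S a" "(T ^^ Suc m) v = T b" by (simp_all add: a_def b_def)
  have eq: "S a - T b - (\<lambda>w. of_nat (Suc m) * (S - T) v w)
    = (S (a - b) - (a - b)) + (S - T) (b - v) + (a - b - (\<lambda>w. of_nat m * (S - T) v w))"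
    unfolding lin_diff[OF unipotent_lin[OF S], of a b] lin_diff[OF raises_lin[OF D], of b v]
    by (rule ext) (simp add: algebra_simps)
  show ?case unfolding ab eq using deep_add[OF deep_add[OF 1 2] Suc[folded a_def b_def]] .
qed

lemma raisesI: "lin D \<Longrightarrow> (\<And>k v. v \<in> deep k \<Longrightarrow> D v \<in> deep (k + d)) \<Longrightarrow> raises d D"
  by (simp add: raises_def)

lemma deep_scale_cancel:
  fixes v :: "'r::idom series"
  shows "c \<noteq> 0 \<Longrightarrow> (\<lambda>w. c * v w) \<in> deep k \<Longrightarrow> v \<in> deep k"
  by (simp add: deep_def)

lemma raises_all:
  assumes "\<And>d. raises d D"
  shows "D v = 0"
  by (rule deep_all) (use raises_deep[OF assms deep_0] in simp)

text \<open>If \<open>S\<^sup>n = T\<^sup>n\<close> and \<open>S - T\<close> raises weights by \<open>d\<close>, then \<open>n (S - T)\<close> raises them by \<open>d + 1\<close>; in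
characteristic zero this can be repeated forever.\<close>

theorem unipotent_roots_unique:
  fixes S T :: "'r::{idom, ring_char_0} operator"
  assumes S: "raises 1 (S - id)" and T: "raises 1 (T - id)" and n: "n > 0" and eq: "S ^^ n = T ^^ n"
  shows "S = T"
proof -
  have "raises d (S - T)" for d
  proof (induction d)
    case 0
    show ?case by (intro raises_diff raises_0_unipotent S T)
  next
    case (Suc d)
    have "(S - T) v \<in> deep (k + Suc d)" if v: "v \<in> deep k" for k v
    proof -
      have "- (\<lambda>w. of_nat n * (S - T) v w) \<in> deep (k + d + 1)"
        using power_difference_leading[OF S T Suc v, of n] by (simp add: eq)
      from deep_uminus[OF this] have "(\<lambda>w. of_nat n * (S - T) v w) \<in> deep (k + Suc d)"
        by (simp only: minus_minus Suc_eq_plus1 add.assoc)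
      then show ?thesis by (rule deep_scale_cancel[rotated]) (use n in simp)
    qed
    then show ?case by (rule raisesI[OF raises_lin[OF Suc]])
  qed
  then have "(S - T) v = 0" for v by (rule raises_all)
  then show ?thesis by (auto simp: fun_eq_iff)
qed

lemma (in group) conj_int_pow:
  fixes n :: int
  assumes "g \<in> carrier G" "h \<in> carrier G"
  shows "(g \<otimes> h \<otimes> inv g) [^] n = g \<otimes> h [^] n \<otimes> inv g"
proof -
  have "g \<otimes> (x \<otimes> y) \<otimes> inv g = g \<otimes> x \<otimes> inv g \<otimes> (g \<otimes> y \<otimes> inv g)"
    if "x \<in> carrier G" "y \<in> carrier G" for x y
    using that assms(1) by (simp add: m_assoc inv_solve_left)
  then interpret c: group_hom G G "\<lambda>x. g \<otimes> x \<otimes> inv g"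
    using assms(1) by unfold_locales (simp add: hom_def)
  show ?thesis by (rule c.hom_int_pow[OF assms(2), symmetric])
qed

text \<open>A group with unique roots is a Q-group as soon as rational powers are additive in the exponent:
every other law can be tested after raising both sides to the power \<open>b\<close>, where \<open>b\<close> is a denominator
of the exponent, and then becomes a law for integer powers.\<close>

lemma Q_groupI:
  fixes H :: "'a qgroup" (structure)
  assumes H: "group H"
    and closed: "\<And>h \<alpha>. h \<in> carrier H \<Longrightarrow> qpow H h \<alpha> \<in> carrier H"
    and one: "\<And>h. h \<in> carrier H \<Longrightarrow> qpow H h 1 = h"
    and add: "\<And>h \<alpha> \<beta>. h \<in> carrier H \<Longrightarrow> qpow H h (\<alpha> + \<beta>) = qpow H h \<alpha> \<otimes> qpow H h \<beta>"
    and roots: "\<And>g h (n::nat). g \<in> carrier H \<Longrightarrow> h \<in> carrier H \<Longrightarrow> n > 0 \<Longrightarrow>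
      g [^] n = h [^] n \<Longrightarrow> g = h"
  shows "Q_group H"
proof -
  interpret group H by fact
  have zero: "qpow H h 0 = \<one>" if "h \<in> carrier H" for h
    using add[OF that, of 0 0] closed[OF that, of 0] by (metis add_0 r_cancel_one')
  have neg: "qpow H h (- \<alpha>) = inv qpow H h \<alpha>" if "h \<in> carrier H" for h \<alpha>
    using add[OF that, of "- \<alpha>" \<alpha>] closed[OF that] zero[OF that] by (simp add: inv_equality)
  have nat: "qpow H h (of_nat n * \<alpha>) = qpow H h \<alpha> [^] n" if "h \<in> carrier H" for h \<alpha> and n :: nat
  proof (induction n)
    case (Suc n)
    have "of_nat (Suc n) * \<alpha> = \<alpha> + of_nat n * \<alpha>" by (simp add: distrib_right)
    then show ?case by (simp only: add[OF that] Suc nat_pow_Suc2[OF closed[OF that]])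
  qed (simp add: zero that)
  have int: "qpow H h (of_int n * \<alpha>) = qpow H h \<alpha> [^] n" if "h \<in> carrier H" for h \<alpha> and n :: int
  proof (cases n)
    case (nonneg m)
    then show ?thesis using nat[OF that, of m \<alpha>] by (simp add: int_pow_int)
  next
    case (neg m)
    then show ?thesis
      using nat[OF that, of "Suc m" \<alpha>] \<open>\<And>h \<alpha>. h \<in> carrier H \<Longrightarrow> qpow H h (- \<alpha>) = inv qpow H h \<alpha>\<close>[OF that, of "of_nat (Suc m) * \<alpha>"]
      by (simp only: int_pow_neg_int closed[OF that] of_int_minus of_int_of_nat_eq mult_minus_left)
  qed
  \<comment> \<open>\<open>b\<close> is a denominator of \<open>\<alpha>\<close>, the exponent to which both sides of a law are raised\<close>
  have frac: "\<exists>(b::nat) (a::int). b > 0 \<and> of_nat b * \<alpha> = of_int a" for \<alpha> :: rat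
  proof -
    obtain a b where "\<alpha> = Fract a b" "b > 0" by (cases \<alpha>) auto
    then have "of_nat (nat b) * \<alpha> = of_int a" by (simp add: Fract_of_int_quotient)
    then show ?thesis using \<open>b > 0\<close> by (intro exI[of _ "nat b"] exI[of _ a]) simp
  qed
  have root_eq: "u = v" if u: "u \<in> carrier H" "v \<in> carrier H"
    and "\<And>(b::nat) (a::int). of_nat b * \<alpha> = of_int a \<Longrightarrow> u [^] b = v [^] b" for u v and \<alpha> :: rat
    using frac[of \<alpha>] roots[OF u] that(3) by blast
  have pow: "qpow H h \<alpha> [^] b = h [^] a" if h: "h \<in> carrier H" and ba: "of_nat b * \<alpha> = of_int a"
    for h \<alpha> and b :: nat and a :: int
    using nat[OF h, of b \<alpha>] int[OF h, of a 1] by (simp add: ba one h)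
  have conj: "qpow H (inv g \<otimes> h \<otimes> g) \<alpha> = inv g \<otimes> qpow H h \<alpha> \<otimes> g"
    if g: "g \<in> carrier H" and h: "h \<in> carrier H" for g h \<alpha>
  proof (rule root_eq)
    fix b :: nat and a :: int assume ba: "of_nat b * \<alpha> = of_int a"
    have "qpow H (inv g \<otimes> h \<otimes> g) \<alpha> [^] b = (inv g \<otimes> h \<otimes> g) [^] a"
      by (rule pow[OF _ ba]) (simp add: g h)
    also have "\<dots> = inv g \<otimes> h [^] a \<otimes> g" using conj_int_pow[OF inv_closed[OF g] h, of a] g by simp
    also have "\<dots> = inv g \<otimes> qpow H h \<alpha> [^] b \<otimes> g" by (simp only: pow[OF h ba])
    also have "\<dots> = (inv g \<otimes> qpow H h \<alpha> \<otimes> g) [^] b"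
      using conj_int_pow[OF inv_closed[OF g] closed[OF h], where n = "int b"] g by (simp add: int_pow_int)
    finally show "qpow H (inv g \<otimes> h \<otimes> g) \<alpha> [^] b = \<dots>" .
  qed (simp_all add: closed g h)
  have commute: "qpow H h \<alpha> \<otimes> g = g \<otimes> qpow H h \<alpha>"
    if g: "g \<in> carrier H" and h: "h \<in> carrier H" and gh: "h \<otimes> g = g \<otimes> h" for g h \<alpha>
  proof -
    have "inv g \<otimes> h \<otimes> g = h" using g h gh by (simp add: m_assoc inv_solve_left')
    then have "inv g \<otimes> (qpow H h \<alpha> \<otimes> g) = qpow H h \<alpha>"
      using conj[OF g h, of \<alpha>] g closed[OF h] by (simp add: m_assoc)
    then show ?thesis using g closed[OF h] by (simp add: inv_solve_left')
  qed
  show ?thesis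
  proof unfold_locales
    fix \<alpha> show "qpow H \<one> \<alpha> = \<one>"
      by (rule root_eq[of _ _ \<alpha>]) (simp_all add: closed pow[OF one_closed])
  next
    fix h \<alpha> \<beta> assume h: "h \<in> carrier H"
    show "qpow H h (\<alpha> * \<beta>) = qpow H (qpow H h \<alpha>) \<beta>"
    proof (rule root_eq[of _ _ \<beta>])
      fix b :: nat and a :: int assume ba: "of_nat b * \<beta> = of_int a"
      have "qpow H h (\<alpha> * \<beta>) [^] b = qpow H h (of_nat b * (\<alpha> * \<beta>))" by (simp only: nat[OF h])
      also have "of_nat b * (\<alpha> * \<beta>) = of_int a * \<alpha>" by (simp flip: ba)
      also have "qpow H h (of_int a * \<alpha>) = qpow H h \<alpha> [^] a" by (rule int[OF h])
      also have "\<dots> = qpow H (qpow H h \<alpha>) \<beta> [^] b" by (rule pow[OF closed[OF h] ba, symmetric])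
      finally show "qpow H h (\<alpha> * \<beta>) [^] b = qpow H (qpow H h \<alpha>) \<beta> [^] b" .
    qed (simp_all add: closed h)
  next
    fix g h \<alpha> assume g: "g \<in> carrier H" and h: "h \<in> carrier H" and gh: "g \<otimes> h = h \<otimes> g"
    show "qpow H (g \<otimes> h) \<alpha> = qpow H g \<alpha> \<otimes> qpow H h \<alpha>"
    proof (rule root_eq[of _ _ \<alpha>])
      fix b :: nat and a :: int assume ba: "of_nat b * \<alpha> = of_int a"
      have comm: "qpow H g \<alpha> \<otimes> qpow H h \<alpha> = qpow H h \<alpha> \<otimes> qpow H g \<alpha>"
        by (rule commute[OF closed[OF h] g commute[OF g h gh[symmetric], symmetric]])
      have "qpow H (g \<otimes> h) \<alpha> [^] b = (g \<otimes> h) [^] a" by (rule pow[OF m_closed[OF g h] ba])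
      also have "\<dots> = g [^] a \<otimes> h [^] a" by (rule int_pow_mult_distrib[OF gh g h])
      also have "\<dots> = qpow H g \<alpha> [^] b \<otimes> qpow H h \<alpha> [^] b" by (simp only: pow[OF g ba] pow[OF h ba])
      also have "\<dots> = (qpow H g \<alpha> \<otimes> qpow H h \<alpha>) [^] b"
        by (rule pow_mult_distrib[OF comm closed[OF g] closed[OF h], symmetric])
      finally show "qpow H (g \<otimes> h) \<alpha> [^] b = \<dots>" .
    qed (simp_all add: closed g h)
  qed (simp_all add: closed one zero add conj)
qed

definition Q_unipotents :: "rat operator qgroup" where
  "Q_unipotents = \<lparr>carrier = carrier unipotents, monoid.mult = (\<circ>), one = id,
     qpow = (\<lambda>T \<alpha>. opseries (\<lambda>k. \<alpha> gchoose k) (T - id))\<rparr>"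

lemma Q_unipotents_simps:
  "carrier Q_unipotents = carrier unipotents" "S \<otimes>\<^bsub>Q_unipotents\<^esub> T = S \<circ> T" "\<one>\<^bsub>Q_unipotents\<^esub> = id"
  "qpow Q_unipotents T \<alpha> = opseries (\<lambda>k. \<alpha> gchoose k) (T - id)"
  by (simp_all add: Q_unipotents_def)

text \<open>Additivity of the binomial series in the exponent is Vandermonde's identity.\<close>

lemma Q_group_unipotents: "Q_group Q_unipotents"
proof (rule Q_groupI)
  have u: "S \<otimes>\<^bsub>Q_unipotents\<^esub> T = S \<otimes>\<^bsub>unipotents\<^esub> T" "\<one>\<^bsub>Q_unipotents\<^esub> = \<one>\<^bsub>unipotents\<^esub>" for S T
    by (simp_all add: Q_unipotents_simps)
  show "group Q_unipotents"
  proof (rule groupI)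
    fix T assume "T \<in> carrier Q_unipotents"
    then show "\<exists>S\<in>carrier Q_unipotents. S \<otimes>\<^bsub>Q_unipotents\<^esub> T = \<one>\<^bsub>Q_unipotents\<^esub>"
      unfolding u Q_unipotents_simps(1) by (rule U.l_inv_ex)
  qed (simp_all only: u Q_unipotents_simps(1) U.m_closed U.one_closed U.m_assoc U.l_one)
next
  fix T :: "rat operator" and \<alpha> assume "T \<in> carrier Q_unipotents"
  then have T: "raises 1 (T - id)" by (simp add: Q_unipotents_simps)
  show "qpow Q_unipotents T \<alpha> \<in> carrier Q_unipotents"
    using raises_opseries[OF T, of "\<lambda>k. \<alpha> gchoose k"] by (simp add: Q_unipotents_simps)
  have "(\<lambda>k. (1 :: rat) gchoose k) = (\<lambda>k. if k \<le> 1 then 1 else 0)"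
  proof
    fix k show "(1 :: rat) gchoose k = (if k \<le> 1 then 1 else 0)"
      using binomial_gbinomial[of 1 k, where 'a = rat] by (cases k) (auto simp: binomial_eq_0)
  qed
  then show "qpow Q_unipotents T 1 = T"
    using opseries_linear[OF T] by (simp add: Q_unipotents_simps)
  fix \<beta>
  show "qpow Q_unipotents T (\<alpha> + \<beta>) = qpow Q_unipotents T \<alpha> \<otimes>\<^bsub>Q_unipotents\<^esub> qpow Q_unipotents T \<beta>"
    using opseries_comp[OF T, of "\<lambda>k. \<alpha> gchoose k" "\<lambda>k. \<beta> gchoose k"] gbinomial_Vandermonde[of \<alpha> \<beta>]
    by (simp add: Q_unipotents_simps fun_eq_iff atLeast0AtMost)
next
  fix S T :: "rat operator" and n :: nat
  assume ST: "S \<in> carrier Q_unipotents" "T \<in> carrier Q_unipotents" and n: "n > 0"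
    and eq: "S [^]\<^bsub>Q_unipotents\<^esub> n = T [^]\<^bsub>Q_unipotents\<^esub> n"
  have "R [^]\<^bsub>Q_unipotents\<^esub> n = R [^]\<^bsub>unipotents\<^esub> n" for R and n :: nat
    by (simp add: nat_pow_def Q_unipotents_simps)
  then have "S ^^ n = T ^^ n" using eq by (simp add: unipotents_pow)
  from unipotent_roots_unique[OF _ _ n this] ST show "S = T"
    unfolding Q_unipotents_simps unipotents_simps by blast
qed

text \<open>The embedding into the Q-group of rational unipotent operators factors through the canonical map
into the tensor completion, which is therefore injective.\<close>

theorem Q_faithful_group_xyy: "Q_faithful group_xyy"
proof -
  have hom: "rho \<in> hom group_xyy Q_unipotents"
    using rho_hom[where 'a = rat] unfolding hom_def Q_unipotents_simps unipotents_simps(2) .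
  have tc: "is_tensor_completion TYPE(rat operator) group_xyy
      (tensor_completion group_xyy) (tensor_map group_xyy)"
    by (rule tensor_completion_universal[OF G.is_group])
  have "\<exists>!\<phi>. \<phi> \<in> qhom (tensor_completion group_xyy) Q_unipotents \<and>
      \<phi> \<in> extensional (carrier (tensor_completion group_xyy)) \<and>
      (\<forall>g\<in>carrier group_xyy. \<phi> (tensor_map group_xyy g) = rho g)"
    using tc[unfolded is_tensor_completion_def, THEN conjunct2, THEN conjunct2, rule_format,
      OF Q_group_unipotents hom] .
  then obtain \<phi> where
    \<phi>: "\<forall>g\<in>carrier group_xyy. \<phi> (tensor_map group_xyy g) = (rho g :: rat operator)"
    by blast
  have "inj_on (tensor_map group_xyy) (carrier group_xyy)"
  proof (rule inj_onI)
    fix g h assume gh: "g \<in> carrier group_xyy" "h \<in> carrier group_xyy"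
      and "tensor_map group_xyy g = tensor_map group_xyy h"
    then have "rho g = (rho h :: rat operator)" using \<phi> by metis
    then show "g = h" using gh inj_rho[where 'r = rat] by (simp add: inj_on_def)
  qed
  then show ?thesis
    unfolding Q_faithful_def using tensor_completion_universal[OF G.is_group] by blast
qed

section \<open>Maximal abelian subgroups\<close>

text \<open>By Zorn's lemma there is a maximal commuting set; it contains everything that commutes with all
of its elements, hence is a subgroup.\<close>

lemma (in group) commuting_set_in_maximal_abelian:
  assumes A: "A \<subseteq> carrier G" and comm: "\<And>x y. x \<in> A \<Longrightarrow> y \<in> A \<Longrightarrow> x \<otimes> y = y \<otimes> x"
  shows "\<exists>H. A \<subseteq> H \<and> maximal_abelian_subgroup G H"
proof -
  define \<A> where "\<A> = {B. A \<subseteq> B \<and> B \<subseteq> carrier G \<and> (\<forall>x\<in>B. \<forall>y\<in>B. x \<otimes> y = y \<otimes> x)}"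
  have "\<exists>M\<in>\<A>. \<forall>B\<in>\<A>. M \<subseteq> B \<longrightarrow> B = M"
  proof (rule subset_Zorn_nonempty)
    have "A \<in> \<A>" using A comm by (simp add: \<A>_def)
    then show "\<A> \<noteq> {}" by blast
  next
    fix \<C> assume ne: "\<C> \<noteq> {}" and ch: "subset.chain \<A> \<C>"
    then have sub: "\<C> \<subseteq> \<A>" and tot: "\<And>B C. B \<in> \<C> \<Longrightarrow> C \<in> \<C> \<Longrightarrow> B \<subseteq> C \<or> C \<subseteq> B"
      by (auto simp: subset_chain_def)
    have "x \<otimes> y = y \<otimes> x" if "x \<in> B" "B \<in> \<C>" "y \<in> C" "C \<in> \<C>" for x y B C
    proof -
      have "B \<in> \<A>" "C \<in> \<A>" using sub that by auto
      then have cB: "\<forall>x\<in>B. \<forall>y\<in>B. x \<otimes> y = y \<otimes> x" and cC: "\<forall>x\<in>C. \<forall>y\<in>C. x \<otimes> y = y \<otimes> x"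
        unfolding \<A>_def by simp_all
      from tot[OF that(2,4)] show ?thesis
      proof
        assume "B \<subseteq> C" then show ?thesis using that cC by auto
      next
        assume "C \<subseteq> B" then show ?thesis using that cB by auto
      qed
    qed
    then have comm: "\<forall>x\<in>\<Union>\<C>. \<forall>y\<in>\<Union>\<C>. x \<otimes> y = y \<otimes> x" by auto
    have mem: "A \<subseteq> B \<and> B \<subseteq> carrier G" if "B \<in> \<C>" for B
      using sub that unfolding \<A>_def by auto
    obtain B where "B \<in> \<C>" using ne by auto
    then have "A \<subseteq> \<Union>\<C>" using mem by auto
    moreover have "\<Union>\<C> \<subseteq> carrier G" using mem by auto
    ultimately show "\<Union>\<C> \<in> \<A>" using comm unfolding \<A>_def by simp
  qed
  then obtain M where M: "M \<in> \<A>" and max: "\<And>B. B \<in> \<A> \<Longrightarrow> M \<subseteq> B \<Longrightarrow> B = M" by blast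
  have AM: "A \<subseteq> M" and MG: "M \<subseteq> carrier G" and Mc: "\<And>x y. x \<in> M \<Longrightarrow> y \<in> M \<Longrightarrow> x \<otimes> y = y \<otimes> x"
    using M by (auto simp: \<A>_def)
  have central: "z \<in> M" if z: "z \<in> carrier G" and zc: "\<And>x. x \<in> M \<Longrightarrow> z \<otimes> x = x \<otimes> z" for z
  proof -
    have "x \<otimes> y = y \<otimes> x" if "x \<in> insert z M" "y \<in> insert z M" for x y
      using that zc[of x] zc[of y] Mc[of x y] by auto
    then have "insert z M \<in> \<A>" using AM MG z unfolding \<A>_def by blast
    then show ?thesis using max[of "insert z M"] by blast
  qed
  have "subgroup M G"
  proof (rule subgroupI[OF MG])
    have "\<one> \<in> M" by (rule central) (use MG in auto)
    then show "M \<noteq> {}" by blast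
  next
    fix a assume a: "a \<in> M"
    show "inv a \<in> M"
    proof (rule central)
      show "inv a \<in> carrier G" using a MG by blast
      show "inv a \<otimes> x = x \<otimes> inv a" if "x \<in> M" for x
        by (rule commutes_inv) (use a that MG Mc in auto)
    qed
  next
    fix a b assume ab: "a \<in> M" "b \<in> M"
    show "a \<otimes> b \<in> M"
    proof (rule central)
      show "a \<otimes> b \<in> carrier G" using ab MG by blast
      show "a \<otimes> b \<otimes> x = x \<otimes> (a \<otimes> b)" if "x \<in> M" for x
        by (rule commutes_mult) (use ab that MG in \<open>auto intro: Mc\<close>)
    qed
  qed
  then have "maximal_abelian_subgroup G M"
    unfolding maximal_abelian_subgroup_def Defs.abelian_subgroup_def
  proof (intro conjI allI impI)
    show "\<forall>x\<in>M. \<forall>y\<in>M. x \<otimes> y = y \<otimes> x" using Mc by blast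
    fix K assume K: "subgroup K G \<and> (\<forall>x\<in>K. \<forall>y\<in>K. x \<otimes> y = y \<otimes> x)" and MK: "M \<subseteq> K"
    then have "K \<in> \<A>" using AM subgroup.subset unfolding \<A>_def by blast
    then show "K = M" using max MK by blast
  qed
  then show ?thesis using AM by blast
qed

lemma ga_neq_one: "ga \<noteq> \<one>\<^bsub>group_xyy\<^esub>"
proof
  assume "ga = \<one>\<^bsub>group_xyy\<^esub>"
  then have "one_plus Al unit_series [Al] = (unit_series [Al] :: int)"
    using rho_one[of "unit_series :: int series"] by (simp add: rho_ga[symmetric] del: rho.hom_one)
  then show False by (simp add: one_plus_def unit_series_def)
qed

text \<open>A malnormal maximal abelian subgroup containing \<open>y\<close> and \<open>z = x\<^sup>-\<^sup>1 y x\<close> meets its conjugate by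
\<open>x\<close> in \<open>z \<noteq> 1\<close>, so it contains \<open>x\<close>. But \<open>x\<close> and \<open>y\<close> do not commute, as \<open>a \<noteq> 1\<close>.\<close>

theorem not_CSA_group_xyy: "\<not> CSA_group group_xyy"
proof
  assume csa: "CSA_group group_xyy"
  define z where "z = \<iota> gx \<odot> gy \<odot> gx"
  have z: "z \<in> carrier group_xyy" by (simp add: z_def)
  have "z = ga \<odot> gy" by (simp add: ga_def z_def G.m_assoc)
  then have zy: "z \<odot> gy = gy \<odot> z"
    using G.commutes_mult[OF gxya(3,2,2) gx_gy_relation(1) HOL.refl] by simp
  have "\<exists>H. {gy, z} \<subseteq> H \<and> maximal_abelian_subgroup group_xyy H"
  proof (rule G.commuting_set_in_maximal_abelian)
    show "{gy, z} \<subseteq> carrier group_xyy" using z by simp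
    show "a \<odot> b = b \<odot> a" if "a \<in> {gy, z}" "b \<in> {gy, z}" for a b
      using that zy[symmetric] zy by blast
  qed
  then obtain H where H: "gy \<in> H" "z \<in> H" "maximal_abelian_subgroup group_xyy H" by blast
  have ab: "\<And>a b. a \<in> H \<Longrightarrow> b \<in> H \<Longrightarrow> a \<odot> b = b \<odot> a"
    using H(3) unfolding maximal_abelian_subgroup_def Defs.abelian_subgroup_def by blast
  have mal: "malnormal group_xyy H" using csa H(3) unfolding CSA_group_def by blast
  show False
  proof (cases "gx \<in> H")
    case True
    have "gx \<odot> ga \<odot> gy = gx \<odot> gy" using gx_gy_relation(2) ab[OF H(1) True] by simp
    then have "gx \<odot> (ga \<odot> gy) = gx \<odot> (\<one>\<^bsub>group_xyy\<^esub> \<odot> gy)" by (simp add: G.m_assoc)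
    then have "ga = \<one>\<^bsub>group_xyy\<^esub>" by (simp del: G.l_one)
    then show False using ga_neq_one by blast
  next
    case False
    then have "H \<inter> (\<lambda>h. \<iota> gx \<odot> h \<odot> gx) ` H = {\<one>\<^bsub>group_xyy\<^esub>}"
      using mal gxya(1) unfolding malnormal_def by blast
    moreover have "z \<in> (\<lambda>h. \<iota> gx \<odot> h \<odot> gx) ` H" using H(1) z_def by blast
    ultimately have "z = \<one>\<^bsub>group_xyy\<^esub>" using H(2) by blast
    then have "gx \<odot> z \<odot> \<iota> gx = \<one>\<^bsub>group_xyy\<^esub>" by simp
    moreover have "gx \<odot> z \<odot> \<iota> gx = gy"
      unfolding z_def by (simp add: G.m_assoc) (simp flip: G.m_assoc)
    ultimately have gy1: "gy = \<one>\<^bsub>group_xyy\<^esub>" by simp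
    have "ga = \<one>\<^bsub>group_xyy\<^esub>" unfolding ga_def gy1 by simp
    then show False using ga_neq_one by blast
  qed
qed

section \<open>Baumslag-Solitar relations\<close>

lemma deep_trans: "u - v \<in> deep k \<Longrightarrow> v - w \<in> deep k \<Longrightarrow> u - w \<in> deep k"
  using deep_add[of "u - v" k "v - w"] by simp

text \<open>If \<open>h\<close> acts as \<open>1 + N\<close> with \<open>N\<close> raising weights by \<open>d\<close>, then \<open>h\<^sup>n\<close> acts as \<open>1 + n N\<close> up to
heavier terms, also for negative \<open>n\<close>.\<close>

lemma int_power_leading:
  fixes h :: "gen word set" and n :: int and v :: "'r::comm_ring_1 series"
  assumes h: "h \<in> carrier group_xyy" and D: "raises d (rho h - id :: 'r operator)"
    and v: "v \<in> deep k"
  shows "rho (h \<up> n) v - v - (\<lambda>w. of_int n * (rho h v - v) w) \<in> deep (k + d + 1)"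
proof -
  have uid: "raises 1 (id - id :: 'r operator)" using U.one_closed unfolding unipotents_simps .
  have nat: "rho (g \<up> m) v - v - (\<lambda>w. of_nat m * (rho g v - v) w) \<in> deep (k + d + 1)"
    if g: "g \<in> carrier group_xyy" and gD: "raises d (rho g - id :: 'r operator)" for g and m :: nat
  proof -
    have p: "rho (g \<up> m) = (rho g ^^ m :: 'r operator)"
      using rho.hom_nat_pow[OF g, of m] by (simp only: unipotents_pow)
    have "(id ^^ m) v = v" by (induction m) auto
    then show ?thesis
      using power_difference_leading[OF rho_unipotent[OF g] uid gD v, of m] by (simp only: p id_apply minus_apply)
  qed
  show ?thesis
  proof (cases n)
    case (nonneg m)
    then show ?thesis using nat[OF h D, of m] by (simp only: int_pow_int of_int_of_nat_eq)
  next
    case (neg m)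
    define g where "g = \<iota> h"
    have g: "g \<in> carrier group_xyy" using h by (simp add: g_def)
    \<comment> \<open>the inverse of \<open>1 + N\<close> is \<open>1 - N\<close> up to heavier terms\<close>
    have lead: "rho g u - u + (rho h u - u) \<in> deep (j + d + 1)" "rho g u - u \<in> deep (j + d)"
      if u: "u \<in> deep j" for u :: "'r series" and j
    proof -
      define x where "x = rho g u"
      have hx: "rho h x = u" using rho_inv(2)[OF h] by (simp only: x_def g_def)
      have "u - x \<in> deep (j + 1)"
        using unipotent_shift[OF rho_unipotent[OF g] u] deep_uminus[of "x - u"] by (simp add: x_def)
      then have "(rho h - id) (u - x) \<in> deep (j + d + 1)" by (rule raises_deep_le[OF D]) simp
      moreover have "(rho h - id) (u - x) = x - u + (rho h u - u)"
        unfolding lin_diff[OF raises_lin[OF D], of u x] using hx by (simp add: algebra_simps)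
      ultimately show 1: "rho g u - u + (rho h u - u) \<in> deep (j + d + 1)" by (simp only: x_def)
      have "rho h u - u \<in> deep (j + d)" using raises_deep[OF D u] by simp
      from deep_diff[OF deep_mono[OF 1] this] show "rho g u - u \<in> deep (j + d)" by simp
    qed
    have "lin (rho g - id :: 'r operator)" by (rule raises_lin[OF rho_unipotent[OF g]])
    then have "raises d (rho g - id :: 'r operator)" by (rule raisesI) (use lead(2) in simp)
    then have "rho (g \<up> Suc m) v - v - (\<lambda>w. of_nat (Suc m) * (rho g v - v) w) \<in> deep (k + d + 1)"
      by (rule nat[OF g])
    moreover have "(\<lambda>w. of_nat (Suc m) * (rho g v - v + (rho h v - v)) w) \<in> deep (k + d + 1)"
      by (rule deep_scale[OF lead(1)[OF v]])
    moreover have "h \<up> n = g \<up> Suc m"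
      unfolding neg g_def G.int_pow_neg_int[OF h] G.nat_pow_inv[OF h] by (rule HOL.refl)
    moreover have "(\<lambda>w. of_int n * (rho h v - v) w)
        = (\<lambda>w. of_nat (Suc m) * (rho g v - v) w) - (\<lambda>w. of_nat (Suc m) * (rho g v - v + (rho h v - v)) w)"
      by (rule ext) (simp only: neg minus_apply plus_fun_apply of_int_minus of_int_of_nat_eq
          mult_minus_left distrib_left diff_diff_eq[symmetric] diff_self diff_0)
    ultimately show ?thesis
      using deep_add[of "rho (g \<up> Suc m) v - v - (\<lambda>w. of_nat (Suc m) * (rho g v - v) w)" "k + d + 1"
          "\<lambda>w. of_nat (Suc m) * (rho g v - v + (rho h v - v)) w"]
      by (simp only: diff_diff_eq2 diff_add_eq)
  qed
qed

lemma G_roots_unique: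
  fixes m :: int
  assumes g: "g \<in> carrier group_xyy" and h: "h \<in> carrier group_xyy" and m: "m \<noteq> 0"
    and eq: "g \<up> m = h \<up> m"
  shows "g = h"
proof -
  have nat: "g = h" if n: "n > 0" and e: "g \<up> n = h \<up> n" for n :: nat
  proof -
    have "(rho g ^^ n :: int operator) = rho h ^^ n"
      using arg_cong[OF e, of "rho :: _ \<Rightarrow> int operator"]
      by (simp only: rho.hom_nat_pow[OF g] rho.hom_nat_pow[OF h] unipotents_pow)
    then have "rho g = (rho h :: int operator)"
      by (rule unipotent_roots_unique[OF rho_unipotent[OF g] rho_unipotent[OF h] n])
    then show ?thesis using inj_onD[OF inj_rho _ g h] by blast
  qed
  show ?thesis
  proof (cases m)
    case (nonneg n)
    then show ?thesis using nat[of n] eq m by (simp add: int_pow_int)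
  next
    case (neg n)
    then have "\<iota> (g \<up> Suc n) = \<iota> (h \<up> Suc n)"
      using eq by (simp only: G.int_pow_neg_int g h)
    then have "g \<up> Suc n = h \<up> Suc n"
      by (metis G.inv_inv G.nat_pow_closed g h)
    then show ?thesis by (rule nat[rotated]) simp
  qed
qed

text \<open>If \<open>m \<noteq> n\<close>, write the action of \<open>h\<close> as \<open>1 + N\<close>. Conjugation does not change leading terms, so the
relation gives \<open>m N = n N\<close> up to heavier terms, and \<open>N\<close> raises weights by one more than known before.
If \<open>m = n\<close>, the relation says that \<open>g h g\<^sup>-\<^sup>1\<close> and \<open>h\<close> have the same \<open>m\<close>-th power.\<close>

theorem baumslag_solitar_relation_commutes:
  fixes m n :: int
  assumes g: "g \<in> carrier group_xyy" and h: "h \<in> carrier group_xyy" and m: "m \<noteq> 0"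
    and rel: "g \<odot> h \<up> m \<odot> \<iota> g = h \<up> n"
  shows "g \<odot> h = h \<odot> g"
proof (cases "m = n")
  case True
  have "(g \<odot> h \<odot> \<iota> g) \<up> m = h \<up> m"
    using rel True by (simp only: G.conj_int_pow[OF g h])
  then have "g \<odot> h \<odot> \<iota> g = h" using G_roots_unique[OF _ h m] g h by simp
  then show ?thesis using G.inv_solve_right'[of h "g \<odot> h" g] g h by simp
next
  case False
  have "raises (Suc d) (rho h - id :: int operator)" for d
  proof (induction d)
    case 0
    show ?case using rho_unipotent[OF h] unfolding One_nat_def .
  next
    case (Suc d)
    let ?N = "rho h - id :: int operator"
    have "?N v \<in> deep (k + Suc (Suc d))" if v: "v \<in> deep k" for k and v :: "int series"
    proof -
      let ?K = "k + Suc d + 1"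
      define u where "u = rho (\<iota> g) v"
      have gu: "rho g u = v" by (simp only: u_def rho_inv(2)[OF g])
      have uv: "u - v \<in> deep (k + 1)"
        unfolding u_def by (rule unipotent_shift[OF rho_unipotent v]) (use g in simp)
      have "u \<in> deep k" using deep_add[OF deep_mono[OF uv] v] by simp
      then have 1: "rho (h \<up> m) u - u - (\<lambda>w. m * ?N u w) \<in> deep ?K"
        using int_power_leading[OF h Suc, of u k m] by (simp only: of_int_eq_id id_apply minus_apply)
      have "?N (u - v) \<in> deep ?K" by (rule raises_deep_le[OF Suc uv]) simp
      then have "(\<lambda>w. m * ?N (u - v) w) \<in> deep ?K" by (rule deep_scale)
      then have 2: "(\<lambda>w. m * ?N u w) - (\<lambda>w. m * ?N v w) \<in> deep ?K"
        unfolding lin_diff[OF raises_lin[OF Suc], of u v] by (simp add: deep_def right_diff_distrib)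
      define a where "a = rho (h \<up> m) u - u"
      have 3: "a - (\<lambda>w. m * ?N v w) \<in> deep ?K" unfolding a_def by (rule deep_trans[OF 1 2])
      have "(\<lambda>w. m * ?N v w) \<in> deep (k + Suc d)" by (rule deep_scale[OF raises_deep[OF Suc v]])
      from deep_add[OF deep_mono[OF 3] this] have "a \<in> deep (k + Suc d)" by simp
      then have 4: "rho g a - a \<in> deep ?K" by (rule unipotent_shift[OF rho_unipotent[OF g]])
      have hm: "h \<up> m \<in> carrier group_xyy" using h by simp
      have "rho (h \<up> n) v = rho (g \<odot> h \<up> m \<odot> \<iota> g) v" by (simp only: rel)
      also have "\<dots> = rho g (rho (h \<up> m) u)"
        by (simp only: u_def rho_mult[OF G.m_closed[OF g hm] G.inv_closed[OF g]] rho_mult[OF g hm])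
      finally have "rho (h \<up> n) v - v = rho g a"
        using lin_diff[OF unipotent_lin[OF rho_unipotent[OF g]], of "rho (h \<up> m) u" u] gu
        by (simp only: a_def)
      moreover have "rho (h \<up> n) v - v - (\<lambda>w. n * ?N v w) \<in> deep ?K"
        using int_power_leading[OF h Suc v, of n] by (simp only: of_int_eq_id id_apply minus_apply)
      ultimately have 5: "rho g a - (\<lambda>w. n * ?N v w) \<in> deep ?K" by simp
      have "(\<lambda>w. n * ?N v w) - rho g a \<in> deep ?K" using deep_uminus[OF 5] by simp
      from deep_trans[OF deep_trans[OF this 4] 3] have "(\<lambda>w. (n - m) * ?N v w) \<in> deep ?K"
        by (simp add: deep_def left_diff_distrib)
      then have "?N v \<in> deep ?K" by (rule deep_scale_cancel[rotated]) (use False in simp)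
      then show ?thesis by simp
    qed
    then show ?case by (rule raisesI[OF raises_lin[OF Suc]])
  qed
  then have "raises d (rho h - id :: int operator)" for d by (rule raises_mono[OF _ le_SucI[OF order_refl]])
  then have "(rho h - id :: int operator) v = 0" for v by (rule raises_all)
  then have "rho h = (id :: int operator)" by (simp add: fun_eq_iff)
  then have "h = \<one>\<^bsub>group_xyy\<^esub>" by (rule rho_faithful[OF h])
  then show ?thesis using g by simp
qed

lemma comm_group_presentation:
  fixes R :: "('g word \<times> 'g word) set"
  assumes comm: "\<And>a b. word_class R (letter a) \<otimes>\<^bsub>presentation R\<^esub> word_class R (letter b)
    = word_class R (letter b) \<otimes>\<^bsub>presentation R\<^esub> word_class R (letter a)"
  shows "comm_group (presentation R)"
proof -
  interpret P: group "presentation R" by (rule group_presentation)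
  let ?\<phi> = "\<lambda>a. word_class R (letter a)"
  note closed = P.weval_closed[OF range_letter_classes]
  have \<phi>: "?\<phi> a \<in> carrier (presentation R)" for a by (rule word_class_in_carrier)
  have step: "weval (presentation R) ?\<phi> w \<otimes>\<^bsub>presentation R\<^esub> z = z \<otimes>\<^bsub>presentation R\<^esub> weval (presentation R) ?\<phi> w"
    if z: "z \<in> carrier (presentation R)"
      and c: "\<And>a. ?\<phi> a \<otimes>\<^bsub>presentation R\<^esub> z = z \<otimes>\<^bsub>presentation R\<^esub> ?\<phi> a" for w z
  proof (induction w)
    case (Cons l w)
    then show ?case unfolding weval.simps
      by (intro P.commutes_mult closed z) (auto simp: \<phi> c z P.commutes_inv)
  qed (simp add: z)
  have "word_class R u \<otimes>\<^bsub>presentation R\<^esub> word_class R v = word_class R v \<otimes>\<^bsub>presentation R\<^esub> word_class R u" for u v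
    using step[OF word_class_in_carrier step[OF \<phi> comm, symmetric, where w = v, unfolded weval_word_class], of u]
    by (simp only: weval_word_class)
  then show ?thesis
    by (intro P.group_comm_groupI) (auto simp: carrier_presentation)
qed

theorem no_nonabelian_baumslag_solitar:
  assumes mn: "m * n \<noteq> 0" and nc: "\<not> comm_group (baumslag_solitar m n)" and H: "subgroup H group_xyy"
  shows "\<not> baumslag_solitar m n \<cong> group_xyy\<lparr>carrier := H\<rparr>"
proof
  assume "baumslag_solitar m n \<cong> group_xyy\<lparr>carrier := H\<rparr>"
  then obtain f where f: "f \<in> iso (baumslag_solitar m n) (group_xyy\<lparr>carrier := H\<rparr>)"
    by (auto simp: is_iso_def)
  define R where "R = {(letter Y @ wpow (letter X) m @ winv (letter Y), wpow (letter X) n)}"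
  have BS: "baumslag_solitar m n = presentation R" by (simp add: baumslag_solitar_def R_def)
  interpret P: group "presentation R" by (rule group_presentation)
  have fh: "f \<in> hom (presentation R) group_xyy" and inj: "inj_on f (carrier (presentation R))"
    using f subgroup.subset[OF H] unfolding BS iso_def bij_betw_def hom_def by auto
  interpret f: group_hom "presentation R" group_xyy f
    using fh by unfold_locales
  define x y where "x = word_class R (letter X)" and "y = word_class R (letter Y)"
  have xy: "x \<in> carrier (presentation R)" "y \<in> carrier (presentation R)"
    by (simp_all add: x_def y_def word_class_in_carrier)
  have rel: "(letter Y @ wpow (letter X) m @ winv (letter Y), wpow (letter X) n) \<in> R"
    by (simp add: R_def)
  have "y \<otimes>\<^bsub>presentation R\<^esub> x [^]\<^bsub>presentation R\<^esub> m \<otimes>\<^bsub>presentation R\<^esub> inv\<^bsub>presentation R\<^esub> y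
      = x [^]\<^bsub>presentation R\<^esub> n"
    using presentation_relation[OF rel]
    unfolding P.weval_append[OF range_letter_classes] P.weval_wpow[OF range_letter_classes]
      P.weval_winv[OF range_letter_classes] P.weval_letter[OF range_letter_classes]
      x_def[symmetric] y_def[symmetric]
    using xy by (simp add: P.m_assoc)
  from arg_cong[OF this, of f]
  have "f y \<odot> f x \<up> m \<odot> \<iota> (f y) = f x \<up> n"
    using xy by (simp add: f.hom_int_pow)
  then have "f y \<odot> f x = f x \<odot> f y"
    by (intro baumslag_solitar_relation_commutes[of _ _ m n]) (use mn xy in auto)
  then have "f (y \<otimes>\<^bsub>presentation R\<^esub> x) = f (x \<otimes>\<^bsub>presentation R\<^esub> y)" using xy by simp
  then have yx: "y \<otimes>\<^bsub>presentation R\<^esub> x = x \<otimes>\<^bsub>presentation R\<^esub> y"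
    using inj_onD[OF inj] xy by blast
  have "comm_group (presentation R)"
  proof (rule comm_group_presentation)
    show "word_class R (letter a) \<otimes>\<^bsub>presentation R\<^esub> word_class R (letter b)
      = word_class R (letter b) \<otimes>\<^bsub>presentation R\<^esub> word_class R (letter a)" for a b
      using yx by (cases a; cases b) (simp_all only: x_def y_def)
  qed
  then show False using nc by (simp add: BS)
qed

section \<open>Congruence kernels\<close>

text \<open>For \<open>m = 0\<close> divisibility means vanishing. In this way the torsion-free quotients (\<open>m = 0\<close>) and the
finite quotients (\<open>m = p\<^sup>k\<close>) are treated by the same lemmas.\<close>

definition divisible_below :: "nat \<Rightarrow> int \<Rightarrow> int series set" where
  "divisible_below L m = {v. \<forall>w. wt w < L \<longrightarrow> m dvd v w}"

lemma divisible_below_add: "u \<in> divisible_below L m \<Longrightarrow> v \<in> divisible_below L m \<Longrightarrow> u + v \<in> divisible_below L m"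
  and divisible_below_diff: "u \<in> divisible_below L m \<Longrightarrow> v \<in> divisible_below L m \<Longrightarrow> u - v \<in> divisible_below L m"
  and divisible_below_scale: "v \<in> divisible_below L m \<Longrightarrow> (\<lambda>w. c * v w) \<in> divisible_below L m"
  by (auto simp: divisible_below_def)

lemma divisible_below_cancel:
  assumes "u \<in> divisible_below L m" "u - v \<in> divisible_below L m"
  shows "v \<in> divisible_below L m"
proof -
  have "u - (u - v) = v" by (rule ext) simp
  then show ?thesis using divisible_below_diff[OF assms] by (simp only:)
qed

lemma divisible_below_multiple: "(\<lambda>w. m * v w) \<in> divisible_below L m"
  by (simp add: divisible_below_def)

lemma deep_divisible_below: "v \<in> deep L \<Longrightarrow> v \<in> divisible_below L m"
  by (simp add: deep_def divisible_below_def)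

lemma divisible_below_decompose:
  assumes "v \<in> divisible_below L m"
  obtains u z where "z \<in> deep L" "v = (\<lambda>w. m * u w) + z"
proof (rule that)
  let ?u = "\<lambda>w. if wt w < L then v w div m else 0"
  show "v - (\<lambda>w. m * ?u w) \<in> deep L"
    using assms by (simp add: deep_def divisible_below_def)
  show "v = (\<lambda>w. m * ?u w) + (v - (\<lambda>w. m * ?u w))" by (simp only: add_diff_cancel_left' diff_add_cancel add_diff_eq)
qed

lemma raises_divisible_below:
  assumes T: "raises 0 T" and v: "v \<in> divisible_below L m"
  shows "T v \<in> divisible_below L m"
proof -
  obtain u z where z: "z \<in> deep L" and v: "v = (\<lambda>w. m * u w) + z"
    using divisible_below_decompose[OF v] .
  have "T v = (\<lambda>w. m * T u w) + T z"
    unfolding v lin_add[OF raises_lin[OF T]] lin_scale[OF raises_lin[OF T]] ..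
  moreover have "T z \<in> deep L" using raises_deep[OF T z] by simp
  ultimately show ?thesis
    by (simp only: divisible_below_add divisible_below_multiple deep_divisible_below)
qed

text \<open>Here \<open>T\<close> acts trivially, modulo the series in question, on what is heavier than \<open>v\<close>. So
\<open>T\<^sup>s v = v + s (T v - v)\<close> there, because \<open>T v - v\<close> is heavier than \<open>v\<close>.\<close>

lemma power_first_order:
  assumes T: "raises 1 (T - id)" and step: "\<And>u. u \<in> deep (j + 1) \<Longrightarrow> T u - u \<in> divisible_below L m"
    and v: "v \<in> deep j"
  shows "(T ^^ s) v - v - (\<lambda>w. int s * (T v - v) w) \<in> divisible_below L m"
proof (induction s)
  case 0
  then show ?case by (simp add: divisible_below_def)
next
  case (Suc s)
  let ?W = "divisible_below L m"
  define a where "a = (T ^^ s) v - v - (\<lambda>w. int s * (T v - v) w)"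
  have lin: "lin T" by (rule unipotent_lin[OF T])
  have "T v - v \<in> deep (j + 1)" by (rule unipotent_shift[OF T v])
  then have "T (T v - v) - (T v - v) \<in> ?W" by (rule step)
  then have 1: "(\<lambda>w. int s * (T (T v - v) - (T v - v)) w) \<in> ?W" by (rule divisible_below_scale)
  have 2: "T a \<in> ?W" using raises_divisible_below[OF raises_0_unipotent[OF T] Suc] by (simp only: a_def)
  have Ta: "T a = (T ^^ Suc s) v - T v - (\<lambda>w. int s * T (T v - v) w)"
    unfolding a_def lin_diff[OF lin] lin_scale[OF lin] by simp
  have "(T ^^ Suc s) v - v - (\<lambda>w. int (Suc s) * (T v - v) w)
      = T a + (\<lambda>w. int s * (T (T v - v) - (T v - v)) w)"
    unfolding Ta by (rule ext) (simp add: algebra_simps)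
  then show ?case using divisible_below_add[OF 2 1] by (simp only:)
qed

text \<open>Downward induction on the weight of \<open>v\<close>: once \<open>T\<close> is trivial on heavier series, \<open>T\<^sup>s v - v\<close> is
\<open>s (T v - v)\<close>.\<close>

lemma unipotent_power_torsion_free:
  assumes T: "raises 1 (T - id)" and s: "s > 0" and pow: "\<And>v. (T ^^ s) v - v \<in> divisible_below L 0"
  shows "T v - v \<in> divisible_below L 0"
proof -
  have "\<forall>v\<in>deep (L - i). T v - v \<in> divisible_below L 0" for i
  proof (induction i)
    case 0
    show ?case
    proof
      fix v :: "int series" assume "v \<in> deep (L - 0)"
      then have "T v - v \<in> deep L" using deep_mono[OF unipotent_shift[OF T], of v "L - 0" L] by simp
      then show "T v - v \<in> divisible_below L 0" by (rule deep_divisible_below)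
    qed
  next
    case (Suc i)
    show ?case
    proof
      fix v :: "int series" assume v: "v \<in> deep (L - Suc i)"
      have "T u - u \<in> divisible_below L 0" if "u \<in> deep (L - Suc i + 1)" for u
        by (rule bspec[OF Suc deep_mono[OF that]]) simp
      from power_first_order[OF T this v] have "(T ^^ s) v - v - (\<lambda>w. int s * (T v - v) w) \<in> divisible_below L 0" .
      from divisible_below_cancel[OF pow[of v] this] have "(\<lambda>w. int s * (T v - v) w) \<in> divisible_below L 0" .
      then show "T v - v \<in> divisible_below L 0" using s by (simp add: divisible_below_def)
    qed
  qed
  from this[of L] show ?thesis by (simp add: deep_0)
qed

text \<open>Downward induction on the weight of \<open>v\<close>: each further \<open>m\<close>-th power makes the operator trivial
modulo \<open>m\<close> on series lighter by one.\<close>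

lemma unipotent_power_exponent:
  assumes T: "raises 1 (T - id)"
  shows "(T ^^ (m ^ L)) v - v \<in> divisible_below L (int m)"
proof -
  have "i \<le> L \<Longrightarrow> \<forall>v\<in>deep (L - i). (T ^^ (m ^ i)) v - v \<in> divisible_below L (int m)" for i
  proof (induction i)
    case 0
    show ?case
    proof
      fix v :: "int series" assume "v \<in> deep (L - 0)"
      then have "T v - v \<in> deep L" using deep_mono[OF unipotent_shift[OF T], of v "L - 0" L] by simp
      then show "(T ^^ (m ^ 0)) v - v \<in> divisible_below L (int m)" by (simp add: deep_divisible_below)
    qed
  next
    case (Suc i)
    let ?S = "T ^^ (m ^ i)"
    have S: "raises 1 (?S - id)" by (rule unipotent_pow[OF T])
    show ?case
    proof
      fix v :: "int series" assume v: "v \<in> deep (L - Suc i)"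
      have "L - Suc i + 1 = L - i" using Suc.prems by simp
      then have "?S u - u \<in> divisible_below L (int m)" if "u \<in> deep (L - Suc i + 1)" for u
        using bspec[OF Suc.IH[OF Suc_leD[OF Suc.prems]], of u] that by (simp only:)
      from power_first_order[OF S this v, of m]
      have "(?S ^^ m) v - v - (\<lambda>w. int m * (?S v - v) w) \<in> divisible_below L (int m)" .
      from divisible_below_add[OF this divisible_below_multiple[of "int m" "?S v - v"]]
      have "(?S ^^ m) v - v \<in> divisible_below L (int m)" by simp
      then show "(T ^^ (m ^ Suc i)) v - v \<in> divisible_below L (int m)"
        by (simp add: funpow_mult mult.commute)
    qed
  qed
  from this[of L] show ?thesis by (simp add: deep_0)
qed

definition congruence_kernel :: "nat \<Rightarrow> int \<Rightarrow> gen word set set" where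
  "congruence_kernel L m = {g \<in> carrier group_xyy. \<forall>v. rho g v - v \<in> divisible_below L m}"

lemma congruence_kernelD:
  "g \<in> congruence_kernel L m \<Longrightarrow> g \<in> carrier group_xyy"
  "g \<in> congruence_kernel L m \<Longrightarrow> rho g v - v \<in> divisible_below L m"
  by (simp_all add: congruence_kernel_def)

lemma rho_divisible_below:
  "g \<in> carrier group_xyy \<Longrightarrow> v \<in> divisible_below L m \<Longrightarrow> rho g v \<in> divisible_below L m"
  by (rule raises_divisible_below[OF raises_0_unipotent[OF rho_unipotent]])

lemma rho_diff: "g \<in> carrier group_xyy \<Longrightarrow> rho g (u - v) = rho g u - rho g v"
  by (rule lin_diff[OF unipotent_lin[OF rho_unipotent]])

lemma congruence_kernel_quotient_iff:
  assumes g: "g \<in> carrier group_xyy" and h: "h \<in> carrier group_xyy"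
  shows "g \<odot> \<iota> h \<in> congruence_kernel L m \<longleftrightarrow> (\<forall>v. rho g v - rho h v \<in> divisible_below L m)"
proof
  assume gh: "g \<odot> \<iota> h \<in> congruence_kernel L m"
  show "\<forall>v. rho g v - rho h v \<in> divisible_below L m"
  proof
    fix v :: "int series"
    show "rho g v - rho h v \<in> divisible_below L m"
      using congruence_kernelD(2)[OF gh, of "rho h v"]
      by (simp only: rho_mult[OF g G.inv_closed[OF h]] rho_inv(1)[OF h])
  qed
next
  assume gh: "\<forall>v. rho g v - rho h v \<in> divisible_below L m"
  have "rho (g \<odot> \<iota> h) v - v \<in> divisible_below L m" for v
    using gh[rule_format, of "rho (\<iota> h) v"]
    by (simp only: rho_mult[OF g G.inv_closed[OF h]] rho_inv(2)[OF h])
  then show "g \<odot> \<iota> h \<in> congruence_kernel L m" using g h by (simp add: congruence_kernel_def del: rho.hom_mult)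
qed

lemma congruence_kernel_normal: "congruence_kernel L m \<lhd> group_xyy"
  unfolding G.normal_inv_iff
proof (intro conjI ballI)
  show "subgroup (congruence_kernel L m) group_xyy"
  proof (rule G.subgroupI)
    show "congruence_kernel L m \<subseteq> carrier group_xyy" by (auto simp: congruence_kernel_def)
    have "\<one>\<^bsub>group_xyy\<^esub> \<in> congruence_kernel L m"
      by (simp add: congruence_kernel_def rho_one divisible_below_def del: rho.hom_one)
    then show "congruence_kernel L m \<noteq> {}" by blast
  next
    fix g assume g: "g \<in> congruence_kernel L m"
    note gc = congruence_kernelD(1)[OF g]
    have "rho \<one>\<^bsub>group_xyy\<^esub> v - rho g v \<in> divisible_below L m" for v
      using divisible_below_scale[OF congruence_kernelD(2)[OF g, of v], of "- 1"]
      by (simp add: rho_one divisible_below_def del: rho.hom_one)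
    then have "\<one>\<^bsub>group_xyy\<^esub> \<odot> \<iota> g \<in> congruence_kernel L m"
      using congruence_kernel_quotient_iff[OF G.one_closed gc] by blast
    then show "\<iota> g \<in> congruence_kernel L m" using gc by simp
  next
    fix g h assume gh: "g \<in> congruence_kernel L m" "h \<in> congruence_kernel L m"
    note gc = congruence_kernelD(1)[OF gh(1)] congruence_kernelD(1)[OF gh(2)]
    have "rho (g \<odot> h) v - v \<in> divisible_below L m" for v
      using divisible_below_add[OF congruence_kernelD(2)[OF gh(1), of "rho h v"]
          congruence_kernelD(2)[OF gh(2), of v]]
      by (simp only: rho_mult[OF gc] add_diff_eq diff_add_cancel)
    then show "g \<odot> h \<in> congruence_kernel L m"
      using gc by (simp add: congruence_kernel_def del: rho.hom_mult)
  qed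
next
  fix x h assume x: "x \<in> carrier group_xyy" and h: "h \<in> congruence_kernel L m"
  note hc = congruence_kernelD(1)[OF h]
  have "rho (x \<odot> h) v - rho x v \<in> divisible_below L m" for v
    using rho_divisible_below[OF x congruence_kernelD(2)[OF h, of v]]
    by (simp only: rho_mult[OF x hc] rho_diff[OF x])
  then show "x \<odot> h \<odot> \<iota> x \<in> congruence_kernel L m"
    using congruence_kernel_quotient_iff[OF G.m_closed[OF x hc] x] by blast
qed

section \<open>Normal subgroups of p-power index\<close>

lemma (in group) finite_rcosetsI:
  assumes N: "subgroup N G" and fin: "finite (E ` carrier G)"
    and E: "\<And>g h. g \<in> carrier G \<Longrightarrow> h \<in> carrier G \<Longrightarrow> E g = E h \<Longrightarrow> g \<otimes> inv h \<in> N"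
  shows "finite (rcosets N)"
proof -
  have "N #> g = (\<lambda>e. N #> (SOME h. h \<in> carrier G \<and> E h = e)) (E g)" if g: "g \<in> carrier G" for g
  proof -
    define h where "h = (SOME h. h \<in> carrier G \<and> E h = E g)"
    have h: "h \<in> carrier G \<and> E h = E g" unfolding h_def by (rule someI[of _ g]) (use g in simp)
    then have "N #> (g \<otimes> inv h) = N" using E[of g h] g by (intro coset_join2 N) auto
    then have "N #> g = N #> h" using coset_mult_inv1[of N g h] g h subgroup.subset[OF N] by blast
    then show ?thesis by (simp add: h_def)
  qed
  then have "rcosets N \<subseteq> (\<lambda>e. N #> (SOME h. h \<in> carrier G \<and> E h = e)) ` (E ` carrier G)"
    by (auto simp: RCOSETS_def)
  then show ?thesis using fin by (rule finite_surj[rotated])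
qed

text \<open>Below weight \<open>L\<close> the operator is given by a finite matrix, its values on monomials.\<close>

lemma unipotent_finite_expansion:
  assumes T: "raises 1 (T - id)" and w: "wt w < L"
  shows "T v w = (\<Sum>u\<in>{u. wt u < L}. v u * T (\<lambda>z. if z = u then 1 else 0) w)"
proof -
  have "T v w = T (\<lambda>z. \<Sum>u\<in>{u. wt u < L}. v u * (if z = u then 1 else 0)) w"
  proof (rule lin_locally_determined[OF raises_0_unipotent[OF T]])
    fix z assume "wt z \<le> wt w"
    then show "v z = (\<Sum>u\<in>{u. wt u < L}. v u * (if z = u then 1 else 0))"
      using w finite_wt_less[of L] by (simp add: if_distrib[of "(*) _"] cong: if_cong)
  qed
  then show ?thesis by (simp add: lin_sum[OF unipotent_lin[OF T]])
qed

text \<open>A coset is determined by the entries modulo \<open>m\<close> of a finite matrix.\<close>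

lemma congruence_kernel_finite_index:
  assumes m: "m > 0"
  shows "finite (rcosets\<^bsub>group_xyy\<^esub> congruence_kernel L m)"
proof (rule G.finite_rcosetsI)
  show "subgroup (congruence_kernel L m) group_xyy"
    by (rule normal_imp_subgroup[OF congruence_kernel_normal])
  define P where "P = {u. wt u < L} \<times> {w. wt w < L}"
  define E where "E g = (\<lambda>x. if x \<in> P
    then rho g (\<lambda>z. if z = fst x then 1 else 0 :: int) (snd x) mod m else 0)" for g
  have "finite P" by (simp add: P_def finite_wt_less)
  then have "finite {f. \<forall>x. (x \<in> P \<longrightarrow> f x \<in> {0..<m}) \<and> (x \<notin> P \<longrightarrow> f x = (0 :: int))}"
    by (intro finite_set_of_finite_funs) simp_all
  moreover have "range E \<subseteq> {f. \<forall>x. (x \<in> P \<longrightarrow> f x \<in> {0..<m}) \<and> (x \<notin> P \<longrightarrow> f x = (0 :: int))}"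
    using m by (auto simp: E_def)
  ultimately show "finite (E ` carrier group_xyy)" by (meson finite_subset image_mono subset_UNIV)
  fix g h assume g: "g \<in> carrier group_xyy" and h: "h \<in> carrier group_xyy" and eq: "E g = E h"
  have "m dvd rho g v w - rho h v w" if w: "wt w < L" for v w
  proof -
    let ?e = "\<lambda>u z. if z = u then 1 else 0 :: int"
    have "m dvd rho g (?e u) w - rho h (?e u) w" if u: "wt u < L" for u
      using fun_cong[OF eq, of "(u, w)"] u w by (simp add: E_def P_def mod_eq_dvd_iff)
    then have "m dvd (\<Sum>u\<in>{u. wt u < L}. v u * (rho g (?e u) w - rho h (?e u) w))"
      by (intro dvd_sum) simp
    then show ?thesis
      by (simp only: right_diff_distrib sum_subtractf
          flip: unipotent_finite_expansion[OF rho_unipotent[OF g] w, of v] unipotent_finite_expansion[OF rho_unipotent[OF h] w, of v])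
  qed
  then show "g \<odot> \<iota> h \<in> congruence_kernel L m"
    unfolding congruence_kernel_quotient_iff[OF g h] by (simp add: divisible_below_def)
qed

lemma (in normal) rcoset_pow: "g \<in> carrier G \<Longrightarrow> (H #> g) [^]\<^bsub>G Mod H\<^esub> (n::nat) = H #> (g [^] n)"
  using hom_nat_pow[OF r_coset_hom_Mod _ is_group factorgroup_is_group] by simp

lemma (in group) rcoset_eq_self_iff: "subgroup N G \<Longrightarrow> g \<in> carrier G \<Longrightarrow> N #> g = N \<longleftrightarrow> g \<in> N"
  using coset_join1 coset_join2 by blast

lemma order_FactGroup: "order (G Mod N) = card (rcosets\<^bsub>G\<^esub> N)"
  by (simp add: order_def FactGroup_def)

lemma (in group) coprime_pows_one:
  assumes x: "x \<in> carrier G" and m: "x [^] (m::nat) = \<one>" and n: "x [^] (n::nat) = \<one>" and mn: "coprime m n"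
  shows "x = \<one>"
proof -
  obtain u v where uv: "u * int m + v * int n = 1"
    using bezout_int[of "int m" "int n"] mn by (auto simp: coprime_iff_gcd_eq_1)
  have "x = x [^] (int m * u + int n * v)" using x uv by (simp add: mult.commute)
  also have "\<dots> = (x [^] m) [^] u \<otimes> (x [^] n) [^] v"
    by (simp only: int_pow_mult[OF x] int_pow_pow[OF x, symmetric] int_pow_int)
  finally show ?thesis by (simp add: m n)
qed

text \<open>If another prime divided the order, Sylow's theorem would give a nontrivial element whose order
is a power of that prime and of \<open>p\<close>.\<close>

lemma (in group) p_power_order:
  assumes p: "prime p" and fin: "finite (carrier G)"
    and exp: "\<And>g. g \<in> carrier G \<Longrightarrow> \<exists>k. g [^] (p ^ k) = \<one>"
  shows "\<exists>k. order G = p ^ k"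
proof -
  have pos: "order G > 0" using fin order_gt_0_iff_finite by blast
  have "q = p" if q: "prime q" "q dvd order G" for q
  proof (rule ccontr)
    assume qp: "q \<noteq> p"
    obtain r where "order G = q ^ 1 * r" using q(2) by auto
    then obtain H where H: "subgroup H G" "card H = q"
      using sylow_thm[OF q(1) is_group _ fin, of 1 r] by auto
    have "card H > 1" using H(2) prime_gt_1_nat[OF q(1)] by simp
    then obtain x where x: "x \<in> H" "x \<noteq> \<one>"
      by (metis One_nat_def card.empty card.insert card_mono empty_iff finite.emptyI finite.insertI insertCI
          insert_absorb linorder_not_less subsetI)
    have xG: "x \<in> carrier G" using x(1) subgroup.mem_carrier[OF H(1)] by blast
    interpret H: group "G\<lparr>carrier := H\<rparr>" by (rule subgroup.subgroup_is_group[OF H(1) is_group])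
    have "x [^]\<^bsub>G\<lparr>carrier := H\<rparr>\<^esub> order (G\<lparr>carrier := H\<rparr>) = \<one>\<^bsub>G\<lparr>carrier := H\<rparr>\<^esub>"
      by (rule H.pow_order_eq_1) (simp add: x(1))
    then have xq: "x [^] q = \<one>" by (simp add: order_def H(2) nat_pow_consistent[symmetric])
    obtain k where xk: "x [^] (p ^ k) = \<one>" using exp[OF xG] by blast
    have "coprime q (p ^ k)" using primes_coprime[OF q(1) p qp] by simp
    then show False using coprime_pows_one[OF xG xq xk] x(2) by blast
  qed
  then have "prime_factors (order G) \<subseteq> {p}" using pos by (auto simp: prime_factors_dvd)
  then have pf: "prime_factors (order G) = {} \<or> prime_factors (order G) = {p}" by blast
  have "(\<Prod>q\<in>prime_factors (order G). q ^ multiplicity q (order G)) = order G"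
    using prod_prime_factors[of "order G"] pos by simp
  with pf show ?thesis
  proof (elim disjE)
    assume *: "prime_factors (order G) = {}" "(\<Prod>q\<in>prime_factors (order G). q ^ multiplicity q (order G)) = order G"
    then have "order G = p ^ 0" by simp
    then show ?thesis by blast
  next
    assume *: "prime_factors (order G) = {p}" "(\<Prod>q\<in>prime_factors (order G). q ^ multiplicity q (order G)) = order G"
    then have "order G = p ^ multiplicity p (order G)" by simp
    then show ?thesis by blast
  qed
qed

lemma (in group) p_power_index_normals_iff:
  assumes p: "prime p"
  shows "N \<in> p_power_index_normals p G \<longleftrightarrow>
    N \<lhd> G \<and> finite (rcosets N) \<and> (\<forall>g\<in>carrier G. \<exists>k. g [^] (p ^ k) \<in> N)"
proof (cases "N \<lhd> G \<and> finite (rcosets N)")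
  case True
  then interpret N: normal N G by blast
  interpret Q: group "G Mod N" by (rule N.factorgroup_is_group)
  have pow: "(N #> g) [^]\<^bsub>G Mod N\<^esub> n = \<one>\<^bsub>G Mod N\<^esub> \<longleftrightarrow> g [^] n \<in> N" if "g \<in> carrier G" for g and n :: nat
    using that by (simp add: N.rcoset_pow rcoset_eq_self_iff[OF N.subgroup_axioms])
  have fin: "finite (carrier (G Mod N))" using True by (simp add: FactGroup_def)
  show ?thesis
  proof
    assume "N \<in> p_power_index_normals p G"
    then obtain k where "order (G Mod N) = p ^ k"
      by (auto simp: p_power_index_normals_def order_FactGroup)
    then have "g [^] (p ^ k) \<in> N" if "g \<in> carrier G" for g
      using Q.pow_order_eq_1[of "N #> g"] that pow[of g "p ^ k"] by (auto simp: carrier_FactGroup)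
    then show "N \<lhd> G \<and> finite (rcosets N) \<and> (\<forall>g\<in>carrier G. \<exists>k. g [^] (p ^ k) \<in> N)" using True by blast
  next
    assume R: "N \<lhd> G \<and> finite (rcosets N) \<and> (\<forall>g\<in>carrier G. \<exists>k. g [^] (p ^ k) \<in> N)"
    have "\<exists>k. order (G Mod N) = p ^ k"
    proof (rule Q.p_power_order[OF p fin])
      fix C assume "C \<in> carrier (G Mod N)"
      then obtain g where g: "g \<in> carrier G" "C = N #> g" by (auto simp: carrier_FactGroup)
      then show "\<exists>k. C [^]\<^bsub>G Mod N\<^esub> (p ^ k) = \<one>\<^bsub>G Mod N\<^esub>" using R pow[OF g(1)] by blast
    qed
    then show "N \<in> p_power_index_normals p G" using True by (simp add: p_power_index_normals_def order_FactGroup)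
  qed
qed (auto simp: p_power_index_normals_def)

lemma (in subgroup) nat_pow_in_subgroup: "x \<in> H \<Longrightarrow> x [^] (n::nat) \<in> H"
  by (induction n) simp_all

lemma (in group) p_power_index_normals_Int:
  assumes p: "prime p" and M: "M \<in> p_power_index_normals p G" and N: "N \<in> p_power_index_normals p G"
  shows "M \<inter> N \<in> p_power_index_normals p G"
  unfolding p_power_index_normals_iff[OF p]
proof (intro conjI ballI)
  have MN: "M \<lhd> G" "N \<lhd> G" and fin: "finite (rcosets M)" "finite (rcosets N)"
    using M N by (auto simp: p_power_index_normals_def)
  note sub = MN[THEN normal_imp_subgroup]
  show nMN: "M \<inter> N \<lhd> G"
    using MN subgroups_Inter_pair[OF sub] by (auto simp: normal_inv_iff)
  show "finite (rcosets (M \<inter> N))"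
  proof (rule finite_rcosetsI[where E = "\<lambda>g. (M #> g, N #> g)"])
    show "subgroup (M \<inter> N) G" by (rule normal_imp_subgroup[OF nMN])
    show "finite ((\<lambda>g. (M #> g, N #> g)) ` carrier G)"
      by (rule finite_subset[OF _ finite_cartesian_product[OF fin]]) (auto simp: RCOSETS_def)
    fix g h assume gh: "g \<in> carrier G" "h \<in> carrier G" "(M #> g, N #> g) = (M #> h, N #> h)"
    then have "M #> (g \<otimes> inv h) = M" "N #> (g \<otimes> inv h) = N"
      using coset_mult_inv2 sub[THEN subgroup.subset] by auto
    then show "g \<otimes> inv h \<in> M \<inter> N" using gh(1,2) rcoset_eq_self_iff[OF sub(1)] rcoset_eq_self_iff[OF sub(2)] by simp
  qed
  fix g assume g: "g \<in> carrier G"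
  obtain i j where ij: "g [^] (p ^ i) \<in> M" "g [^] (p ^ j) \<in> N"
    using M N g unfolding p_power_index_normals_iff[OF p] by blast
  have "g [^] (p ^ (i + j)) = (g [^] (p ^ i)) [^] (p ^ j)"
    using g by (simp add: nat_pow_pow power_add)
  then have "g [^] (p ^ (i + j)) \<in> M" using subgroup.nat_pow_in_subgroup[OF sub(1) ij(1)] by simp
  moreover have "g [^] (p ^ (i + j)) = (g [^] (p ^ j)) [^] (p ^ i)"
    using g by (simp add: nat_pow_pow power_add mult.commute)
  then have "g [^] (p ^ (i + j)) \<in> N" using subgroup.nat_pow_in_subgroup[OF sub(2) ij(2)] by simp
  ultimately have "g [^] (p ^ (i + j)) \<in> M \<inter> N" by blast
  then show "\<exists>k. g [^] (p ^ k) \<in> M \<inter> N" by blast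
qed

lemma congruence_kernel_p_power_index:
  assumes p: "prime p"
  shows "congruence_kernel L (int (p ^ k)) \<in> p_power_index_normals p group_xyy"
  unfolding G.p_power_index_normals_iff[OF p]
proof (intro conjI ballI)
  show "congruence_kernel L (int (p ^ k)) \<lhd> group_xyy" by (rule congruence_kernel_normal)
  show "finite (rcosets\<^bsub>group_xyy\<^esub> congruence_kernel L (int (p ^ k)))"
    by (rule congruence_kernel_finite_index) (simp add: prime_gt_0_nat[OF p])
  fix g assume g: "g \<in> carrier group_xyy"
  have pw: "rho (g \<up> n) = (rho g ^^ n :: int operator)" for n :: nat
    using rho.hom_nat_pow[OF g, of n] by (simp only: unipotents_pow)
  have "rho (g \<up> (p ^ (k * L))) v - v \<in> divisible_below L (int (p ^ k))" for v
    unfolding pw power_mult by (rule unipotent_power_exponent[OF rho_unipotent[OF g]])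
  then show "\<exists>j. g \<up> (p ^ j) \<in> congruence_kernel L (int (p ^ k))"
    using g by (auto simp: congruence_kernel_def simp del: rho.hom_nat_pow)
qed

lemma rho_moves:
  assumes g: "g \<in> carrier group_xyy" "g \<noteq> \<one>\<^bsub>group_xyy\<^esub>"
  obtains v w where "rho g v w \<noteq> (v w :: int)"
proof -
  have "rho g \<noteq> (id :: int operator)" using rho_faithful[OF g(1), where 'r = int] g(2) by blast
  then show ?thesis using that by (auto simp: fun_eq_iff)
qed

theorem residually_p_group_xyy:
  assumes p: "prime p"
  shows "residually_p p group_xyy"
  unfolding residually_p_def
proof (intro ballI impI)
  fix g assume g: "g \<in> carrier group_xyy" "g \<noteq> \<one>\<^bsub>group_xyy\<^esub>"
  obtain v w where vw: "rho g v w \<noteq> (v w :: int)" using rho_moves[OF g] .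
  define c where "c = \<bar>rho g v w - v w\<bar>"
  \<comment> \<open>a power of \<open>p\<close> too large to divide the coefficient that \<open>g\<close> changes\<close>
  have "nat c < p ^ nat c"
    by (rule less_le_trans[OF less_exp power_mono[OF prime_ge_2_nat[OF p]]]) simp
  then have "c < int (p ^ nat c)" by linarith
  moreover have "c > 0" using vw by (simp add: c_def)
  ultimately have "\<not> int (p ^ nat c) dvd c" using zdvd_not_zless by blast
  then have "g \<notin> congruence_kernel (Suc (wt w)) (int (p ^ nat c))"
    using congruence_kernelD(2)[of g "Suc (wt w)" _ v] by (auto simp: divisible_below_def c_def)
  then show "\<exists>N\<in>p_power_index_normals p group_xyy. g \<notin> N"
    using congruence_kernel_p_power_index[OF p] by blast
qed

section \<open>Torsion-free nilpotent quotients\<close>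

text \<open>A central filtration of \<open>G\<close>, which bounds the lower central series from above.\<close>

definition depth_subgroup :: "nat \<Rightarrow> gen word set set" where
  "depth_subgroup d = {g \<in> carrier group_xyy. raises d (rho g - id :: int operator)}"

lemma depth_subgroupI:
  assumes g: "g \<in> carrier group_xyy"
    and "\<And>k v. v \<in> deep k \<Longrightarrow> rho g v - v \<in> (deep (k + d) :: int series set)"
  shows "g \<in> depth_subgroup d"
proof -
  have "raises d (rho g - id :: int operator)"
    by (rule raisesI[OF raises_lin[OF rho_unipotent[OF g]]]) (use assms(2) in simp)
  then show ?thesis using g by (simp only: depth_subgroup_def mem_Collect_eq)
qed

lemma depth_subgroupD:
  assumes "g \<in> depth_subgroup d"
  shows "g \<in> carrier group_xyy" and "v \<in> deep k \<Longrightarrow> rho g v - v \<in> (deep (k + d) :: int series set)"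
  using assms raises_deep[of d "rho g - id :: int operator" v k] by (auto simp: depth_subgroup_def)

lemma rho_deep: "g \<in> carrier group_xyy \<Longrightarrow> v \<in> deep k \<Longrightarrow> rho g v \<in> deep k"
  using raises_deep[OF raises_0_unipotent[OF rho_unipotent]] by fastforce

lemma depth_subgroup_subgroup: "subgroup (depth_subgroup d) group_xyy"
proof (rule G.subgroupI)
  show "depth_subgroup d \<subseteq> carrier group_xyy" by (auto simp: depth_subgroup_def)
  have "\<one>\<^bsub>group_xyy\<^esub> \<in> depth_subgroup d"
    by (rule depth_subgroupI) (simp_all add: rho_one deep_def del: rho.hom_one)
  then show "depth_subgroup d \<noteq> {}" by blast
next
  fix g assume g: "g \<in> depth_subgroup d"
  note gc = depth_subgroupD(1)[OF g]
  show "\<iota> g \<in> depth_subgroup d"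
  proof (rule depth_subgroupI)
    fix k and v :: "int series" assume v: "v \<in> deep k"
    have "rho (\<iota> g) (- (rho g v - v)) \<in> deep (k + d)"
      using depth_subgroupD(2)[OF g v] gc by (intro rho_deep deep_uminus) auto
    then show "rho (\<iota> g) v - v \<in> deep (k + d)"
      by (simp only: minus_diff_eq rho_diff[OF G.inv_closed[OF gc]] rho_inv(1)[OF gc])
  qed (use gc in simp)
next
  fix g h assume gh: "g \<in> depth_subgroup d" "h \<in> depth_subgroup d"
  note gc = depth_subgroupD(1)[OF gh(1)] depth_subgroupD(1)[OF gh(2)]
  show "g \<odot> h \<in> depth_subgroup d"
  proof (rule depth_subgroupI)
    fix k and v :: "int series" assume v: "v \<in> deep k"
    from deep_trans[OF depth_subgroupD(2)[OF gh(1) rho_deep[OF gc(2) v]] depth_subgroupD(2)[OF gh(2) v]]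
    show "rho (g \<odot> h) v - v \<in> deep (k + d)" by (simp only: rho_mult[OF gc])
  qed (use gc in simp)
qed

text \<open>With \<open>A = a - 1\<close> and \<open>B = b - 1\<close> as operators, \<open>a b - b a = A B - B A\<close> raises weights by \<open>d + 1\<close>.\<close>

lemma depth_subgroup_commutator:
  assumes a: "a \<in> depth_subgroup d" and b: "b \<in> carrier group_xyy"
  shows "\<iota> a \<odot> \<iota> b \<odot> a \<odot> b \<in> depth_subgroup (Suc d)"
proof -
  note ac = depth_subgroupD(1)[OF a]
  note ic = G.inv_closed[OF ac] G.inv_closed[OF b]
  show ?thesis
  proof (rule depth_subgroupI)
    fix k and v :: "int series" assume v: "v \<in> deep k"
    define A B where "A = (\<lambda>v :: int series. rho a v - v)" and "B = (\<lambda>v :: int series. rho b v - v)"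
    have "B v \<in> deep (k + 1)" unfolding B_def by (rule unipotent_shift[OF rho_unipotent[OF b] v])
    from depth_subgroupD(2)[OF a this] have 1: "A (B v) \<in> deep (k + Suc d)" by (simp add: A_def)
    have "A v \<in> deep (k + d)" unfolding A_def by (rule depth_subgroupD(2)[OF a v])
    from unipotent_shift[OF rho_unipotent[OF b] this] have 2: "B (A v) \<in> deep (k + Suc d)" by (simp add: B_def)
    have "rho a (rho b v) - rho b (rho a v) = A (B v) - B (A v)"
      by (rule ext) (simp add: A_def B_def rho_diff[OF ac] rho_diff[OF b])
    then have ab: "rho a (rho b v) - rho b (rho a v) \<in> deep (k + Suc d)" using deep_diff[OF 1 2] by simp
    have "rho (\<iota> a) (rho (\<iota> b) (rho a (rho b v) - rho b (rho a v))) \<in> deep (k + Suc d)"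
      by (intro rho_deep ic ab)
    moreover have "rho (\<iota> a \<odot> \<iota> b \<odot> a \<odot> b) v = rho (\<iota> a) (rho (\<iota> b) (rho a (rho b v)))"
      using ac b ic by (simp only: rho_mult G.m_closed)
    ultimately show "rho (\<iota> a \<odot> \<iota> b \<odot> a \<odot> b) v - v \<in> deep (k + Suc d)"
      by (simp only: rho_diff[OF ic(1)] rho_diff[OF ic(2)] rho_inv(1)[OF ac] rho_inv(1)[OF b])
  qed (use ac b in simp)
qed

lemma congruence_kernel_0_quotient_nilpotent:
  "nilpotent_group (group_xyy Mod congruence_kernel L 0)"
proof -
  let ?N = "congruence_kernel L 0"
  interpret N: normal ?N group_xyy by (rule congruence_kernel_normal)
  let ?Q = "group_xyy Mod ?N"
  let ?c = "\<lambda>a. ?N #>\<^bsub>group_xyy\<^esub> a"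
  interpret c: group_hom group_xyy ?Q ?c
    using N.r_coset_hom_Mod N.factorgroup_is_group by (simp add: group_hom_def group_hom_axioms_def G.is_group)
  have lc: "lower_central ?Q n \<subseteq> ?c ` depth_subgroup (Suc n)" for n
  proof (induction n)
    case 0
    have "depth_subgroup (Suc 0) = carrier group_xyy"
      using rho_unipotent unfolding depth_subgroup_def One_nat_def by blast
    then show ?case by (simp add: carrier_FactGroup)
  next
    case (Suc n)
    have "{inv\<^bsub>?Q\<^esub> a \<otimes>\<^bsub>?Q\<^esub> inv\<^bsub>?Q\<^esub> b \<otimes>\<^bsub>?Q\<^esub> a \<otimes>\<^bsub>?Q\<^esub> b | a b. a \<in> lower_central ?Q n \<and> b \<in> carrier ?Q}
        \<subseteq> ?c ` depth_subgroup (Suc (Suc n))"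
    proof clarify
      fix a b assume "a \<in> lower_central ?Q n" "b \<in> carrier ?Q"
      then obtain g h where g: "g \<in> depth_subgroup (Suc n)" "a = ?c g" and h: "h \<in> carrier group_xyy" "b = ?c h"
        using Suc by (auto simp: carrier_FactGroup)
      note gc = depth_subgroupD(1)[OF g(1)]
      have "inv\<^bsub>?Q\<^esub> a \<otimes>\<^bsub>?Q\<^esub> inv\<^bsub>?Q\<^esub> b \<otimes>\<^bsub>?Q\<^esub> a \<otimes>\<^bsub>?Q\<^esub> b = ?c (\<iota> g \<odot> \<iota> h \<odot> g \<odot> h)"
        unfolding g(2) h(2) using gc h(1) by (simp only: c.hom_mult c.hom_inv G.m_closed G.inv_closed)
      then show "inv\<^bsub>?Q\<^esub> a \<otimes>\<^bsub>?Q\<^esub> inv\<^bsub>?Q\<^esub> b \<otimes>\<^bsub>?Q\<^esub> a \<otimes>\<^bsub>?Q\<^esub> b \<in> ?c ` depth_subgroup (Suc (Suc n))"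
        using depth_subgroup_commutator[OF g(1) h(1)] by blast
    qed
    then show ?case unfolding lower_central.simps
      by (rule c.H.generate_subgroup_incl[OF _ c.subgroup_img_is_subgroup[OF depth_subgroup_subgroup]])
  qed
  have "depth_subgroup (Suc L) \<subseteq> ?N"
  proof
    fix g assume g: "g \<in> depth_subgroup (Suc L)"
    have "rho g v - v \<in> deep L" for v :: "int series"
      by (rule deep_mono[OF depth_subgroupD(2)[OF g deep_0]]) simp
    then show "g \<in> ?N"
      unfolding congruence_kernel_def using depth_subgroupD(1)[OF g] deep_divisible_below by blast
  qed
  moreover have "?c g = \<one>\<^bsub>?Q\<^esub>" if "g \<in> ?N" for g
    using that congruence_kernelD(1)[OF that] by (simp add: G.coset_join2 N.subgroup_axioms)
  ultimately have "lower_central ?Q L \<subseteq> {\<one>\<^bsub>?Q\<^esub>}" using lc[of L] by blast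
  moreover have "\<one>\<^bsub>?Q\<^esub> \<in> lower_central ?Q L"
    using c.H.one_closed by (cases L) (simp_all add: generate.one del: one_FactGroup)
  ultimately have "lower_central ?Q L = {\<one>\<^bsub>?Q\<^esub>}" by blast
  then show ?thesis unfolding nilpotent_group_def using N.factorgroup_is_group by blast
qed

lemma rho_nat_pow:
  "g \<in> carrier group_xyy \<Longrightarrow> rho (g \<up> n) = rho g ^^ (n :: nat)"
  unfolding unipotents_pow[symmetric] by (rule rho.hom_nat_pow)

lemma congruence_kernel_0_quotient_torsion_free:
  "torsion_free (group_xyy Mod congruence_kernel L 0)"
  unfolding torsion_free_def
proof (intro ballI allI impI)
  let ?N = "congruence_kernel L 0"
  interpret N: normal ?N group_xyy by (rule congruence_kernel_normal)
  fix C and n :: nat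
  assume "C \<in> carrier (group_xyy Mod ?N)" and n: "n > 0"
    and pow: "C [^]\<^bsub>group_xyy Mod ?N\<^esub> n = \<one>\<^bsub>group_xyy Mod ?N\<^esub>"
  then obtain g where g: "g \<in> carrier group_xyy" and C: "C = ?N #>\<^bsub>group_xyy\<^esub> g"
    by (auto simp: carrier_FactGroup)
  have "?N #>\<^bsub>group_xyy\<^esub> (g \<up> n) = ?N"
    using pow unfolding C N.rcoset_pow[OF g] one_FactGroup .
  then have gn: "g \<up> n \<in> ?N"
    using G.rcoset_eq_self_iff[OF N.subgroup_axioms G.nat_pow_closed[OF g]] by blast
  have "(rho g ^^ n) v - v \<in> divisible_below L 0" for v
    using congruence_kernelD(2)[OF gn, of v] unfolding rho_nat_pow[OF g] .
  then have "rho g v - v \<in> divisible_below L 0" for v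
    by (rule unipotent_power_torsion_free[OF rho_unipotent[OF g] n])
  then have "g \<in> ?N" unfolding congruence_kernel_def using g by blast
  then show "C = \<one>\<^bsub>group_xyy Mod ?N\<^esub>" unfolding C one_FactGroup using N.rcos_const G.is_group by blast
qed

theorem residually_torsion_free_nilpotent_group_xyy: "residually_torsion_free_nilpotent group_xyy"
  unfolding residually_torsion_free_nilpotent_def
proof (intro ballI impI)
  fix g assume g: "g \<in> carrier group_xyy" "g \<noteq> \<one>\<^bsub>group_xyy\<^esub>"
  obtain v w where vw: "rho g v w \<noteq> (v w :: int)" using rho_moves[OF g] .
  let ?N = "congruence_kernel (Suc (wt w)) 0"
  interpret N: normal ?N group_xyy by (rule congruence_kernel_normal)
  have "g \<notin> ?N" using congruence_kernelD(2)[of g "Suc (wt w)" 0 v] vw by (auto simp: divisible_below_def)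
  then have "?N #>\<^bsub>group_xyy\<^esub> g \<noteq> \<one>\<^bsub>group_xyy Mod ?N\<^esub>"
    using G.rcoset_eq_self_iff[OF N.subgroup_axioms g(1)] by simp
  then show "\<exists>(H :: gen word set set monoid) f. nilpotent_group H \<and> torsion_free H \<and>
      f \<in> hom group_xyy H \<and> f g \<noteq> \<one>\<^bsub>H\<^esub>"
    using congruence_kernel_0_quotient_nilpotent congruence_kernel_0_quotient_torsion_free N.r_coset_hom_Mod
    by blast
qed

section \<open>Finite p-groups acting on integer-valued functions\<close>

text \<open>Orbits other than fixed points have size divisible by \<open>p\<close>, so the number of fixed points is
divisible by \<open>p\<close>; being positive it exceeds one.\<close>

lemma (in group_action) p_group_second_fixed_point:
  assumes p: "prime p" and ord: "order G = p ^ k" and fin: "finite E" and dvd: "p dvd card E"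
    and x0: "x0 \<in> E" and fix0: "\<And>g. g \<in> carrier G \<Longrightarrow> \<phi> g x0 = x0"
  shows "\<exists>x\<in>E. x \<noteq> x0 \<and> (\<forall>g\<in>carrier G. \<phi> g x = x)"
proof (rule ccontr)
  assume only: "\<not> ?thesis"
  have G: "group G" using group_hom by (simp add: group_hom_def)
  have o0: "orbit G \<phi> x0 = {x0}"
    using fix0 group.is_monoid[OF G, THEN monoid.one_closed] by (force simp: orbit_def)
  have others: "p dvd card O'" if O: "O' \<in> orbits G E \<phi> - {{x0}}" for O'
  proof -
    obtain x where x: "x \<in> E" "O' = orbit G \<phi> x" using O by (auto simp: orbits_def)
    have "card O' dvd p ^ k" using orbit_stabilizer_theorem[OF x(1)] ord x(2) by (metis dvd_triv_left)
    then obtain i where i: "card O' = p ^ i" using divides_primepow_nat[OF p] by blast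
    have "i \<noteq> 0"
    proof
      assume "i = 0"
      then obtain y where y: "O' = {y}" using i by (auto simp: card_Suc_eq)
      then have xy: "O' = {x}" using orbit_refl[OF x(1)] x(2) by auto
      then have "\<forall>g\<in>carrier G. \<phi> g x = x" using x(2) unfolding orbit_def by auto
      then have "x = x0" using only x(1) by blast
      then show False using O xy by simp
    qed
    then show ?thesis using i by simp
  qed
  have fino: "finite (orbits G E \<phi>)"
    using fin orbits_coverture by (metis finite_UnionD)
  have mem: "{x0} \<in> orbits G E \<phi>" using x0 o0 by (auto simp: orbits_def)
  have "card E = (\<Sum>O'\<in>orbits G E \<phi>. card O')"
    using disjoint_sum[OF fin, of "\<lambda>_. 1 :: nat"] by simp
  also have "\<dots> = 1 + (\<Sum>O'\<in>orbits G E \<phi> - {{x0}}. card O')"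
    using sum.remove[OF fino mem, of card] by simp
  finally have "card E = 1 + (\<Sum>O'\<in>orbits G E \<phi> - {{x0}}. card O')" .
  moreover have "p dvd (\<Sum>O'\<in>orbits G E \<phi> - {{x0}}. card O')" by (rule dvd_sum) (rule others)
  ultimately have "p dvd 1" using dvd dvd_add_left_iff by metis
  then show False using prime_gt_1_nat[OF p] by simp
qed

text \<open>The action of a group on functions by right translation of the argument. Functions are left
alone outside the carrier, so that translations are invertible on all functions on the type.\<close>

definition translate :: "('a, 'b) monoid_scheme \<Rightarrow> 'a \<Rightarrow> ('a \<Rightarrow> int) \<Rightarrow> 'a \<Rightarrow> int" where
  "translate G g b = (\<lambda>x. if x \<in> carrier G then b (x \<otimes>\<^bsub>G\<^esub> g) else b x)"

text \<open>The preimage of the upper series of fixed points: the functions vanishing modulo \<open>p\<close> come first,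
and each step takes the functions fixed modulo the previous level. That a level is everything says
that the corresponding power of the augmentation ideal kills all functions modulo \<open>p\<close>.\<close>

primrec fixed_level :: "('a, 'b) monoid_scheme \<Rightarrow> nat \<Rightarrow> nat \<Rightarrow> ('a \<Rightarrow> int) set" where
  "fixed_level G p 0 = {b. \<forall>x\<in>carrier G. int p dvd b x}"
| "fixed_level G p (Suc i) = {b. \<forall>g\<in>carrier G. translate G g b - b \<in> fixed_level G p i}"

lemma translate_add: "translate G g (b + c) = translate G g b + translate G g c"
  and translate_diff: "translate G g (b - c) = translate G g b - translate G g c"
  by (auto simp: translate_def)

lemma fixed_level_add: "b \<in> fixed_level G p i \<Longrightarrow> c \<in> fixed_level G p i \<Longrightarrow> b + c \<in> fixed_level G p i"
proof (induction i arbitrary: b c)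
  case (Suc i)
  have "translate G g (b + c) - (b + c) = (translate G g b - b) + (translate G g c - c)" for g
    by (simp only: translate_add add_diff_add)
  then have "translate G g (b + c) - (b + c) \<in> fixed_level G p i" if "g \<in> carrier G" for g
    using Suc.IH[of "translate G g b - b" "translate G g c - c"] Suc.prems that
    by (simp only: fixed_level.simps mem_Collect_eq)
  then show ?case unfolding fixed_level.simps by blast
qed simp

lemma fixed_level_diff: "b \<in> fixed_level G p i \<Longrightarrow> c \<in> fixed_level G p i \<Longrightarrow> b - c \<in> fixed_level G p i"
proof (induction i arbitrary: b c)
  case (Suc i)
  have "translate G g (b - c) - (b - c) = (translate G g b - b) - (translate G g c - c)" for g
    by (rule ext) (simp add: translate_diff)
  then have "translate G g (b - c) - (b - c) \<in> fixed_level G p i" if "g \<in> carrier G" for g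
    using Suc.IH[of "translate G g b - b" "translate G g c - c"] Suc.prems that
    by (simp only: fixed_level.simps mem_Collect_eq)
  then show ?case unfolding fixed_level.simps by blast
qed simp

context group
begin

lemma translate_mult:
  "g \<in> carrier G \<Longrightarrow> h \<in> carrier G \<Longrightarrow> translate G (g \<otimes> h) b = translate G g (translate G h b)"
  by (auto simp: translate_def m_assoc)

lemma translate_one: "translate G \<one> b = b"
  by (auto simp: translate_def)

lemma translate_inv:
  assumes "g \<in> carrier G"
  shows "translate G (inv g) (translate G g b) = b" "translate G g (translate G (inv g) b) = b"
  using assms translate_mult[of "inv g" g b] translate_mult[of g "inv g" b] by (simp_all add: translate_one)

lemma fixed_level_translate:
  "h \<in> carrier G \<Longrightarrow> b \<in> fixed_level G p i \<Longrightarrow> translate G h b \<in> fixed_level G p i"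
proof (induction i arbitrary: b)
  case 0
  then show ?case by (simp add: translate_def)
next
  case (Suc i)
  have "translate G g (translate G h b) - translate G h b \<in> fixed_level G p i" if g: "g \<in> carrier G" for g
  proof -
    let ?k = "inv h \<otimes> g \<otimes> h"
    have k: "?k \<in> carrier G" using g Suc.prems(1) by simp
    have hk: "h \<otimes> ?k = g \<otimes> h" using g Suc.prems(1) by (simp flip: m_assoc)
    have "translate G h (translate G ?k b - b) \<in> fixed_level G p i"
      using Suc k by simp
    moreover have "translate G h (translate G ?k b) = translate G g (translate G h b)"
      by (simp only: translate_mult[symmetric] g k Suc.prems(1) hk)
    ultimately show ?thesis by (simp only: translate_diff)
  qed
  then show ?case by simp
qed

lemma fixed_level_Suc: "b \<in> fixed_level G p i \<Longrightarrow> b \<in> fixed_level G p (Suc i)"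
  by (auto intro: fixed_level_diff fixed_level_translate)

lemma fixed_level_0: "b \<in> fixed_level G p 0 \<Longrightarrow> b \<in> fixed_level G p i"
  by (induction i) (auto simp del: fixed_level.simps intro: fixed_level_Suc)

lemma translate_image_fixed_level:
  assumes g: "g \<in> carrier G"
  shows "translate G g ` fixed_level G p i = fixed_level G p i"
proof
  show "translate G g ` fixed_level G p i \<subseteq> fixed_level G p i"
    using fixed_level_translate[OF g] by blast
  show "fixed_level G p i \<subseteq> translate G g ` fixed_level G p i"
  proof
    fix b assume "b \<in> fixed_level G p i"
    then have "translate G (inv g) b \<in> fixed_level G p i" using g by (intro fixed_level_translate) simp
    then show "b \<in> translate G g ` fixed_level G p i"
      using translate_inv(2)[OF g, of b] by (metis imageI)
  qed
qed

end

definition additive_functions :: "('a \<Rightarrow> int) monoid" where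
  "additive_functions = \<lparr>carrier = UNIV, monoid.mult = (+), one = 0\<rparr>"

lemma additive_functions_simps [simp]:
  "carrier additive_functions = UNIV" "b \<otimes>\<^bsub>additive_functions\<^esub> c = b + c" "\<one>\<^bsub>additive_functions\<^esub> = 0"
  by (simp_all add: additive_functions_def)

lemma group_additive_functions: "group additive_functions"
proof (rule groupI)
  fix b :: "'a \<Rightarrow> int"
  show "\<exists>c\<in>carrier additive_functions. c \<otimes>\<^bsub>additive_functions\<^esub> b = \<one>\<^bsub>additive_functions\<^esub>"
    by (rule bexI[of _ "- b"]) simp_all
qed (simp_all add: add.assoc)

interpretation A: group "additive_functions :: ('a \<Rightarrow> int) monoid"
  by (rule group_additive_functions)

lemma additive_functions_inv: "inv\<^bsub>additive_functions\<^esub> b = - b"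
  by (rule A.inv_equality) simp_all

lemma additive_functions_pow: "b [^]\<^bsub>additive_functions\<^esub> (n::nat) = (\<lambda>x. int n * b x)"
  by (induction n) (auto simp: fun_eq_iff distrib_right nat_pow_def)

lemma (in group) fixed_level_normal: "fixed_level G p i \<lhd> additive_functions"
  unfolding A.normal_inv_iff
proof (intro conjI ballI)
  have zero: "0 \<in> fixed_level G p i" by (rule fixed_level_0) simp
  show "subgroup (fixed_level G p i) additive_functions"
  proof (rule A.subgroupI)
    show "fixed_level G p i \<noteq> {}" using zero by blast
    fix b assume b: "b \<in> fixed_level G p i"
    show "inv\<^bsub>additive_functions\<^esub> b \<in> fixed_level G p i"
      using fixed_level_diff[OF zero b] by (simp add: additive_functions_inv)
    fix c assume "c \<in> fixed_level G p i"
    then show "b \<otimes>\<^bsub>additive_functions\<^esub> c \<in> fixed_level G p i" using b by (simp add: fixed_level_add)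
  qed simp
  fix b c :: "'a \<Rightarrow> int" assume "c \<in> fixed_level G p i"
  then show "b \<otimes>\<^bsub>additive_functions\<^esub> c \<otimes>\<^bsub>additive_functions\<^esub> inv\<^bsub>additive_functions\<^esub> b \<in> fixed_level G p i"
    by (simp add: additive_functions_inv)
qed

lemma (in group) reduction_mod_p:
  fixes b :: "'a \<Rightarrow> int"
  shows "b - (\<lambda>x. if x \<in> carrier G then b x mod int p else 0) \<in> fixed_level G p i"
  by (rule fixed_level_0) (simp add: minus_mod_eq_mult_div)

lemma (in group) finite_reductions:
  assumes "finite (carrier G)" and "p > 0"
  shows "finite (range (\<lambda>b x. if x \<in> carrier G then b x mod int p else 0))"
proof (rule finite_subset)
  show "finite {f. \<forall>x. (x \<in> carrier G \<longrightarrow> f x \<in> {0..<int p}) \<and> (x \<notin> carrier G \<longrightarrow> f x = 0)}"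
    using assms by (intro finite_set_of_finite_funs) simp_all
qed (use assms in auto)

lemma (in group) fixed_level_p_power_index:
  assumes p: "prime p" and fin: "finite (carrier G)"
  shows "fixed_level G p i \<in> p_power_index_normals p additive_functions"
  unfolding A.p_power_index_normals_iff[OF p]
proof (intro conjI ballI)
  let ?red = "\<lambda>b x. if x \<in> carrier G then b x mod int p else 0 :: int"
  note sub = normal_imp_subgroup[OF fixed_level_normal]
  show "finite (rcosets\<^bsub>additive_functions\<^esub> fixed_level G p i)"
  proof (rule A.finite_rcosetsI[where E = ?red])
    show "finite (?red ` carrier additive_functions)"
      using finite_reductions[OF fin prime_gt_0_nat[OF p]] by simp
    fix b c :: "'a \<Rightarrow> int" assume "?red b = ?red c"
    then have "b - c = (b - ?red b) - (c - ?red c)" by simp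
    then show "b \<otimes>\<^bsub>additive_functions\<^esub> inv\<^bsub>additive_functions\<^esub> c \<in> fixed_level G p i"
      using fixed_level_diff[OF reduction_mod_p[of b p i] reduction_mod_p[of c p i]] by (simp add: additive_functions_inv)
  qed (rule sub)
  fix b :: "'a \<Rightarrow> int"
  have "b [^]\<^bsub>additive_functions\<^esub> (p ^ 1) \<in> fixed_level G p i"
    by (rule fixed_level_0) (simp add: additive_functions_pow)
  then show "\<exists>k. b [^]\<^bsub>additive_functions\<^esub> (p ^ k) \<in> fixed_level G p i" by blast
qed (rule fixed_level_normal)

text \<open>The quotient of the functions by a proper level is a nontrivial \<open>p\<close>-group on which the
\<open>p\<close>-group \<open>G\<close> acts fixing the zero coset. There is then a second fixed coset, and its elements
belong to the next level.\<close>

lemma (in group) fixed_level_grows: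
  assumes p: "prime p" and ord: "order G = p ^ k" and ne: "fixed_level G p i \<noteq> UNIV"
  shows "\<exists>b\<in>fixed_level G p (Suc i). b \<notin> fixed_level G p i"
proof -
  let ?B = "fixed_level G p i"
  let ?A = "additive_functions :: ('a \<Rightarrow> int) monoid"
  define E where "E = rcosets\<^bsub>?A\<^esub> ?B"
  define \<phi> where "\<phi> g = (\<lambda>C\<in>E. translate G g ` C)" for g
  have fin: "finite (carrier G)"
    using ord prime_gt_0_nat[OF p] by (metis order_gt_0_iff_finite zero_less_power)
  note sub = normal_imp_subgroup[OF fixed_level_normal[of p i]]
  have coset: "translate G g ` (?B #>\<^bsub>?A\<^esub> b) = ?B #>\<^bsub>?A\<^esub> translate G g b" if "g \<in> carrier G" for g b
  proof -
    have "translate G g ` (?B #>\<^bsub>?A\<^esub> b) = (\<Union>c\<in>translate G g ` ?B. {c + translate G g b})"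
      by (simp add: r_coset_def image_UN translate_add)
    then show ?thesis unfolding translate_image_fixed_level[OF that] by (simp add: r_coset_def)
  qed
  have E: "C \<in> E \<longleftrightarrow> (\<exists>b. C = ?B #>\<^bsub>?A\<^esub> b)" for C by (auto simp: E_def RCOSETS_def)
  have maps: "translate G g ` C \<in> E" if "g \<in> carrier G" "C \<in> E" for g C
    using that coset by (auto simp: E)
  have bij: "\<phi> g \<in> Bij E" if g: "g \<in> carrier G" for g
  proof -
    have "bij_betw (\<phi> g) E E"
    proof (rule bij_betw_byWitness[where f' = "\<phi> (inv g)"])
      have ii: "translate G (inv g) ` translate G g ` C = C" "translate G g ` translate G (inv g) ` C = C" for C
        by (simp_all add: image_image translate_inv[OF g])
      show "\<forall>C\<in>E. \<phi> (inv g) (\<phi> g C) = C" "\<forall>C\<in>E. \<phi> g (\<phi> (inv g) C) = C"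
        using maps[OF g] maps[OF inv_closed[OF g]] by (simp_all add: \<phi>_def ii)
      show "\<phi> g ` E \<subseteq> E" "\<phi> (inv g) ` E \<subseteq> E"
        using maps[OF g] maps[OF inv_closed[OF g]] by (auto simp: \<phi>_def)
    qed
    then show ?thesis by (simp add: Bij_def \<phi>_def)
  qed
  have "\<phi> \<in> hom G (BijGroup E)"
  proof (rule homI)
    fix g assume g: "g \<in> carrier G"
    then show "\<phi> g \<in> carrier (BijGroup E)" using bij by (simp add: BijGroup_def)
    fix h assume h: "h \<in> carrier G"
    have "\<phi> (g \<otimes> h) C = compose E (\<phi> g) (\<phi> h) C" for C
      using maps[OF h] by (auto simp: \<phi>_def compose_def translate_mult[OF g h] image_image)
    then show "\<phi> (g \<otimes> h) = \<phi> g \<otimes>\<^bsub>BijGroup E\<^esub> \<phi> h"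
      using bij g h by (auto simp: BijGroup_def)
  qed
  then interpret act: group_action G E \<phi>
    by (intro group_action.intro group_hom.intro group_hom_axioms.intro is_group group_BijGroup)
  have finE: "finite E" and "\<exists>j. card E = p ^ j"
    using fixed_level_p_power_index[OF p fin, of i] by (simp_all add: E_def p_power_index_normals_def)
  then obtain j where j: "card E = p ^ j" by blast
  have BE: "?B \<in> E" unfolding E by (rule exI[of _ 0]) (simp add: r_coset_def)
  have "j \<noteq> 0"
  proof
    assume "j = 0"
    then have "E = {?B}" using BE j by (metis card_1_singletonE power_0 singletonD)
    then have "?B #>\<^bsub>?A\<^esub> b = ?B" for b using E by blast
    then have "b \<in> ?B" for b using A.rcoset_eq_self_iff[OF sub] by simp
    then show False using ne by blast
  qed
  then have "p dvd card E" using j by simp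
  from act.p_group_second_fixed_point[OF p ord finE this BE]
  obtain C where C: "C \<in> E" "C \<noteq> ?B" "\<forall>g\<in>carrier G. \<phi> g C = C"
    using translate_image_fixed_level BE by (auto simp: \<phi>_def)
  obtain b where b: "C = ?B #>\<^bsub>?A\<^esub> b" using C(1) by (auto simp: E)
  have "b \<notin> ?B" using C(2) A.rcoset_eq_self_iff[OF sub, of b] by (auto simp: b)
  moreover have "translate G g b - b \<in> ?B" if g: "g \<in> carrier G" for g
  proof -
    have "?B #>\<^bsub>?A\<^esub> translate G g b = ?B #>\<^bsub>?A\<^esub> b"
      using C(3) g C(1) coset[OF g, of b] by (auto simp: \<phi>_def b)
    then have "?B #>\<^bsub>?A\<^esub> (translate G g b \<otimes>\<^bsub>?A\<^esub> inv\<^bsub>?A\<^esub> b) = ?B"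
      by (intro A.coset_mult_inv2) simp_all
    then show ?thesis using A.rcoset_eq_self_iff[OF sub, of "translate G g b - b"]
      by (simp add: additive_functions_inv)
  qed
  ultimately show ?thesis by auto
qed

text \<open>The levels are determined by the finitely many reductions modulo \<open>p\<close>, so they cannot grow
strictly forever.\<close>

theorem (in group) fixed_level_exhausts:
  assumes p: "prime p" and ord: "order G = p ^ k"
  shows "\<exists>n. fixed_level G p n = UNIV"
proof (rule ccontr)
  assume "\<not> ?thesis"
  then have ne: "fixed_level G p i \<noteq> UNIV" for i by blast
  let ?red = "\<lambda>b x. if x \<in> carrier G then b x mod int p else 0 :: int"
  have fin: "finite (carrier G)"
    using ord prime_gt_0_nat[OF p] by (metis order_gt_0_iff_finite zero_less_power)
  have finR: "finite (range ?red)" by (rule finite_reductions[OF fin prime_gt_0_nat[OF p]])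
  have red: "?red b \<in> fixed_level G p i \<longleftrightarrow> b \<in> fixed_level G p i" for b i
  proof
    assume "?red b \<in> fixed_level G p i"
    from fixed_level_add[OF reduction_mod_p[of b p i] this] show "b \<in> fixed_level G p i"
      by (simp only: diff_add_cancel)
  next
    assume "b \<in> fixed_level G p i"
    from fixed_level_diff[OF this reduction_mod_p[of b p i]] show "?red b \<in> fixed_level G p i"
      by (simp only: diff_diff_eq2 add_diff_cancel_left')
  qed
  have "i \<le> card (range ?red \<inter> fixed_level G p i)" for i
  proof (induction i)
    case (Suc i)
    obtain b where b: "b \<in> fixed_level G p (Suc i)" "b \<notin> fixed_level G p i"
      using fixed_level_grows[OF p ord ne] by blast
    have "?red b \<in> range ?red" by (rule range_eqI[where x = b]) (rule HOL.refl)
    moreover have "?red b \<in> fixed_level G p (Suc i)" "?red b \<notin> fixed_level G p i"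
      using b by (simp_all only: red not_False_eq_True)
    ultimately have "range ?red \<inter> fixed_level G p i \<subset> range ?red \<inter> fixed_level G p (Suc i)"
      using fixed_level_Suc by blast
    then have "card (range ?red \<inter> fixed_level G p i) < card (range ?red \<inter> fixed_level G p (Suc i))"
      using finR by (intro psubset_card_mono) auto
    then show ?case using Suc by linarith
  qed simp
  from this[of "Suc (card (range ?red))"] show False
    using card_mono[OF finR Int_lower1] by (meson Suc_n_not_le_n order_trans)
qed

section \<open>Cofinality of the congruence kernels\<close>

text \<open>The operator obtained from a monomial by substituting \<open>r\<^sub>c - 1\<close> for the variable \<open>c\<close>, where \<open>r\<^sub>c\<close>
is the action of the group generator that corresponds to \<open>c\<close>.\<close>

primrec word_operator :: "(gen word set \<Rightarrow> ('q \<Rightarrow> int) \<Rightarrow> 'q \<Rightarrow> int) \<Rightarrow> var list \<Rightarrow> ('q \<Rightarrow> int) \<Rightarrow> 'q \<Rightarrow> int" where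
  "word_operator r [] b = b"
| "word_operator r (c # w) b = r (gbase c) (word_operator r w b) - word_operator r w b"

text \<open>Let \<open>F\<close> act by translations on the functions on the finite \<open>p\<close>-group \<open>G / N\<close>. Substituting the
operators \<open>r\<^sub>c - 1\<close> for the variables turns a series into an operator modulo \<open>p\<close>; this is well
defined because long products of such operators vanish modulo \<open>p\<close>. The substitution sends the Magnus
series of \<open>f\<close> to the action of \<open>f\<close>. If the series is \<open>1\<close> modulo \<open>p\<close> in low weights, then \<open>f\<close> acts
trivially modulo \<open>p\<close>, and testing this on the indicator function of the trivial coset gives
\<open>f \<in> N\<close>.\<close>

lemma basegroup_congruence_kernel_cofinal:
  assumes p: "prime p" and N: "N \<in> p_power_index_normals p group_xyy"
  shows "\<exists>L. \<forall>f\<in>basegroup. f \<in> congruence_kernel L (int p) \<longrightarrow> f \<in> N"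
proof -
  interpret N: normal N group_xyy using N by (simp add: p_power_index_normals_def)
  define Q where "Q = group_xyy Mod N"
  interpret Q: group Q unfolding Q_def by (rule N.factorgroup_is_group)
  obtain k where "order Q = p ^ k"
    using N by (auto simp: p_power_index_normals_def order_FactGroup Q_def)
  then obtain n where n: "fixed_level Q p n = UNIV" using Q.fixed_level_exhausts[OF p] by blast
  define r where "r g = translate Q (N #>\<^bsub>group_xyy\<^esub> g)" for g
  have cQ: "N #>\<^bsub>group_xyy\<^esub> g \<in> carrier Q" if "g \<in> carrier group_xyy" for g
    using that by (auto simp: Q_def carrier_FactGroup)
  have r_mult: "r (g \<odot> h) b = r g (r h b)" if "g \<in> carrier group_xyy" "h \<in> carrier group_xyy" for g h b
    using Q.translate_mult[OF cQ[OF that(1)] cQ[OF that(2)], of b] N.rcos_sum[OF that]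
    by (simp add: r_def Q_def)
  have r_one: "r \<one>\<^bsub>group_xyy\<^esub> b = b" for b
    using Q.translate_one[of b] G.coset_join2[OF G.one_closed N.subgroup_axioms N.one_closed]
    by (simp add: r_def Q_def)
  have r_level: "r g b \<in> fixed_level Q p i" if "g \<in> carrier group_xyy" "b \<in> fixed_level Q p i" for g b i
    unfolding r_def by (rule Q.fixed_level_translate[OF cQ[OF that(1)] that(2)])
  have r_diff: "r g (b - c) = r g b - r g c" for g b c unfolding r_def by (rule translate_diff)
  have word_level: "word_operator r w b \<in> fixed_level Q p (n - length w)" for w b
  proof (induction w)
    case (Cons c w)
    show ?case
    proof (cases "n - length w")
      case 0
      then have "word_operator r w b \<in> fixed_level Q p 0" using Cons by simp
      moreover have "n - length (c # w) = 0" using 0 by simp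
      ultimately show ?thesis
        using fixed_level_diff[OF r_level[OF gbase_closed]] by (simp only: word_operator.simps)
    next
      case (Suc j)
      then have "word_operator r w b \<in> fixed_level Q p (Suc j)" using Cons by simp
      then have "r (gbase c) (word_operator r w b) - word_operator r w b \<in> fixed_level Q p j"
        using cQ[OF gbase_closed] unfolding fixed_level.simps r_def by blast
      moreover have "n - length (c # w) = j" using Suc by simp
      ultimately show ?thesis by (simp only: word_operator.simps)
    qed
  qed (simp add: n)
  \<comment> \<open>a monomial of weight at least \<open>2 n\<close> has at least \<open>n\<close> letters; the successor keeps the constant term\<close>
  define L where "L = Suc (2 * n)"
  have word_long: "int p dvd word_operator r w b x" if "L \<le> wt w" "x \<in> carrier Q" for w b x
  proof -
    have "n - length w = 0" using wt_le_length[of w] that(1) by (simp add: L_def)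
    then have "word_operator r w b \<in> fixed_level Q p 0" using word_level[of w b] by (simp only:)
    then show ?thesis using that(2) by simp
  qed
  define ev where "ev v b = (\<lambda>x. \<Sum>w\<in>{w. wt w < L}. v w * word_operator r w b x)" for v b
  have ev_gbase: "ev (one_plus c v) b - r (gbase c) (ev v b) \<in> fixed_level Q p 0" for c v b
  proof -
    have "int p dvd (ev (one_plus c v) b - r (gbase c) (ev v b)) x" if x: "x \<in> carrier Q" for x
    proof -
      let ?W = "{w. wt w < L}"
      let ?y = "x \<otimes>\<^bsub>Q\<^esub> (N #>\<^bsub>group_xyy\<^esub> gbase c)"
      have "(\<Sum>w\<in>?W. mul c v w * word_operator r w b x)
        = (\<Sum>w\<in>(#) c ` {u. wt (c # u) < L}. mul c v w * word_operator r w b x)"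
      proof (rule sum.mono_neutral_right)
        show "finite ?W" by (rule finite_wt_less)
        show "\<forall>w\<in>?W - (#) c ` {u. wt (c # u) < L}. mul c v w * word_operator r w b x = 0"
        proof
          fix w assume w: "w \<in> ?W - (#) c ` {u. wt (c # u) < L}"
          show "mul c v w * word_operator r w b x = 0"
            by (cases w) (use w in auto)
        qed
      qed auto
      also have "\<dots> = (\<Sum>u\<in>{u. wt (c # u) < L}. v u * word_operator r (c # u) b x)"
        by (subst sum.reindex) (auto simp: inj_on_def)
      finally have m: "(\<Sum>w\<in>?W. mul c v w * word_operator r w b x)
        = (\<Sum>u\<in>{u. wt (c # u) < L}. v u * word_operator r (c # u) b x)" .
      \<comment> \<open>the monomials lost by the truncation when multiplying by \<open>c\<close> have weight at least \<open>L\<close>\<close>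
      have sub: "{u. wt (c # u) < L} \<subseteq> ?W" by (cases c) auto
      have split: "(\<Sum>u\<in>?W. v u * word_operator r (c # u) b x)
        = (\<Sum>u\<in>?W - {u. wt (c # u) < L}. v u * word_operator r (c # u) b x)
          + (\<Sum>u\<in>{u. wt (c # u) < L}. v u * word_operator r (c # u) b x)"
        by (rule sum.subset_diff[OF sub finite_wt_less])
      have "r (gbase c) (ev v b) x = (\<Sum>w\<in>?W. v w * word_operator r w b ?y)"
        using x by (simp add: r_def translate_def ev_def)
      also have "\<dots> = (\<Sum>w\<in>?W. v w * word_operator r w b x) + (\<Sum>u\<in>?W. v u * word_operator r (c # u) b x)"
        using x by (simp add: r_def translate_def algebra_simps flip: sum.distrib)
      finally have rr: "r (gbase c) (ev v b) x
        = (\<Sum>w\<in>?W. v w * word_operator r w b x) + (\<Sum>u\<in>?W. v u * word_operator r (c # u) b x)" .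
      have "ev (one_plus c v) b x
        = (\<Sum>w\<in>?W. v w * word_operator r w b x) + (\<Sum>w\<in>?W. mul c v w * word_operator r w b x)"
        by (simp add: ev_def one_plus_def distrib_right sum.distrib)
      then have "(ev (one_plus c v) b - r (gbase c) (ev v b)) x
        = - (\<Sum>u\<in>?W - {u. wt (c # u) < L}. v u * word_operator r (c # u) b x)"
        unfolding minus_apply rr m split by simp
      moreover have "int p dvd (\<Sum>u\<in>?W - {u. wt (c # u) < L}. v u * word_operator r (c # u) b x)"
        by (intro dvd_sum dvd_mult word_long x) auto
      ultimately show ?thesis by simp
    qed
    then show ?thesis by simp
  qed
  have ev_basegroup: "\<forall>v. ev (rho f v) b - r f (ev v b) \<in> fixed_level Q p 0" if "f \<in> basegroup" for f b
    using that
  proof (induction rule: basegroup_induct)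
    case one
    show ?case by (simp add: rho_one r_one del: rho.hom_one)
  next
    case (gen c)
    show ?case unfolding rho_gbase using ev_gbase by blast
  next
    case (inv c)
    define h where c: "h = gbase c"
    have "ev (rho (\<iota> h) v) b - r (\<iota> h) (ev v b) \<in> fixed_level Q p 0" for v
    proof -
      define u where "u = rho (\<iota> h) v"
      have hu: "rho h u = v" unfolding u_def c by (rule rho_inv(2)[OF gbase_closed])
      have "ev v b - r h (ev u b) \<in> fixed_level Q p 0"
        using ev_gbase[of c u b] unfolding rho_gbase[symmetric] c[symmetric] hu .
      from r_level[OF G.inv_closed[OF gbase_closed] this, of c]
      have "r (\<iota> h) (ev v b) - r (\<iota> h) (r h (ev u b)) \<in> fixed_level Q p 0"
        by (simp only: r_diff c)
      moreover have "r (\<iota> h) (r h (ev u b)) = ev u b"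
        unfolding c r_mult[OF G.inv_closed[OF gbase_closed] gbase_closed, symmetric]
        by (simp only: G.l_inv[OF gbase_closed] r_one)
      ultimately have "r (\<iota> h) (ev v b) - ev u b \<in> fixed_level Q p 0" by (simp only:)
      moreover have "0 \<in> fixed_level Q p 0" by simp
      ultimately have "0 - (r (\<iota> h) (ev v b) - ev u b) \<in> fixed_level Q p 0" by (rule fixed_level_diff[rotated])
      then show "ev (rho (\<iota> h) v) b - r (\<iota> h) (ev v b) \<in> fixed_level Q p 0"
        by (simp only: u_def diff_0 minus_diff_eq)
    qed
    then show ?case unfolding c by blast
  next
    case (mult g h)
    note gh = mult.hyps
    show ?case
    proof
      fix v :: "int series"
      have 1: "ev (rho g (rho h v)) b - r g (ev (rho h v) b) \<in> fixed_level Q p 0" using mult.IH(1) by blast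
      have "ev (rho h v) b - r h (ev v b) \<in> fixed_level Q p 0" using mult.IH(2) by blast
      from r_level[OF gh(1) this] have 2: "r g (ev (rho h v) b) - r g (r h (ev v b)) \<in> fixed_level Q p 0"
        by (simp only: r_diff)
      from fixed_level_add[OF 1 2] show "ev (rho (g \<odot> h) v) b - r (g \<odot> h) (ev v b) \<in> fixed_level Q p 0"
        by (simp only: rho_mult[OF gh] r_mult[OF gh] add_diff_eq diff_add_cancel)
    qed
  qed
  have "f \<in> N" if f: "f \<in> basegroup" "f \<in> congruence_kernel L (int p)" for f
  proof -
    note fc = basegroup_closed[OF f(1)]
    \<comment> \<open>translating the indicator function of the trivial coset by \<open>f\<close> moves it unless \<open>f \<in> N\<close>\<close>
    define b where "b = (\<lambda>C. if C = N then 1 else 0 :: int)"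
    have NQ: "N \<in> carrier Q" using Q.one_closed by (simp add: Q_def)
    have "int p dvd (ev (rho f unit_series) b - r f (ev unit_series b)) N"
      using ev_basegroup[OF f(1), of b] NQ by simp
    moreover have "int p dvd (ev (rho f unit_series) b - ev unit_series b) N"
    proof -
      have "int p dvd (\<Sum>w\<in>{w. wt w < L}. (rho f unit_series w - unit_series w) * word_operator r w b N)"
        using congruence_kernelD(2)[OF f(2), of unit_series]
        by (intro dvd_sum dvd_mult2) (simp add: divisible_below_def)
      then show ?thesis by (simp add: ev_def left_diff_distrib sum_subtractf)
    qed
    moreover have ev_unit: "ev unit_series b = b"
    proof
      fix x
      have "ev unit_series b x = (\<Sum>w\<in>{[]}. unit_series w * word_operator r w b x)"
        unfolding ev_def by (rule sum.mono_neutral_right) (auto simp: finite_wt_less unit_series_def L_def)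
      then show "ev unit_series b x = b x" by (simp add: unit_series_def)
    qed
    ultimately have "int p dvd r f b N - b N"
      unfolding minus_apply ev_unit by (metis diff_add_cancel dvd_diff_commute dvd_add diff_diff_eq2 add_diff_eq)
    moreover have "r f b N = b (N #>\<^bsub>group_xyy\<^esub> f)"
      using NQ Q.l_one[OF cQ[OF fc]] by (simp add: r_def translate_def Q_def)
    ultimately have "int p dvd b (N #>\<^bsub>group_xyy\<^esub> f) - 1" by (simp add: b_def)
    moreover have "\<not> int p dvd 0 - 1" using prime_gt_1_nat[OF p] by simp
    ultimately have "N #>\<^bsub>group_xyy\<^esub> f = N" by (auto simp: b_def split: if_splits)
    then show "f \<in> N" using G.rcoset_eq_self_iff[OF N.subgroup_axioms fc] by blast
  qed
  then show ?thesis by blast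
qed

section \<open>Convolution and leading coefficients modulo p\<close>

text \<open>The product of power series, computed by stripping letters from the left factor.\<close>

fun conv :: "'r::comm_ring_1 series \<Rightarrow> 'r series \<Rightarrow> 'r series" where
  "conv u v [] = u [] * v []"
| "conv u v (c # w) = u [] * v (c # w) + conv (\<lambda>z. u (c # z)) v w"

lemma conv_add: "conv (u + u') v w = conv u v w + conv u' v w"
proof (induction w arbitrary: u u')
  case (Cons c w)
  have eq: "(\<lambda>z. (u + u') (c # z)) = (\<lambda>z. u (c # z)) + (\<lambda>z. u' (c # z))" by auto
  show ?case unfolding conv.simps eq Cons by (simp add: algebra_simps)
qed (simp add: algebra_simps)

lemma conv_scale: "conv (\<lambda>z. k * u z) v w = k * conv u v w"
  by (induction w arbitrary: u) (simp_all add: algebra_simps)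

lemma conv_zero: "conv (\<lambda>_. 0) v w = 0"
  by (induction w) simp_all

lemma conv_unit: "conv unit_series v w = v w"
  by (cases w) (simp_all add: unit_series_def conv_zero)

lemma conv_diff: "conv (u - u') v w = conv u v w - conv u' v w"
  using conv_add[of "u - u'" u' v w] by simp

lemma conv_assoc: "conv (conv u v) t w = conv u (conv v t) w"
proof (induction w arbitrary: u v)
  case (Cons c w)
  have "(\<lambda>z. conv u v (c # z)) = (\<lambda>z. u [] * v (c # z)) + conv (\<lambda>z. u (c # z)) v" by auto
  then show ?case by (simp add: conv_add conv_scale Cons algebra_simps)
qed simp

lemma rho_gbase_conv: "rho (gbase c) v w = conv (rho (gbase c) unit_series) v w"
proof (cases w)
  case (Cons d u)
  have eq: "(\<lambda>z. one_plus c unit_series (d # z)) = (if d = c then unit_series else (\<lambda>_. 0))"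
    by (auto simp: one_plus_def unit_series_def)
  have "conv (\<lambda>z. one_plus c unit_series (d # z)) v u = (if d = c then v u else 0)"
    unfolding eq by (simp add: conv_unit conv_zero)
  then show ?thesis by (simp add: Cons rho_gbase) (simp add: one_plus_def unit_series_def)
qed (simp add: rho_gbase one_plus_def unit_series_def)

text \<open>The elements of \<open>F\<close> act by left multiplication with their Magnus series.\<close>

lemma rho_basegroup_conv:
  assumes "f \<in> basegroup"
  shows "rho f v = conv (rho f unit_series) v"
proof -
  have "\<forall>v :: 'a series. rho f v = conv (rho f unit_series) v"
    using assms
  proof (induction rule: basegroup_induct)
    case one
    show ?case by (auto simp: rho_one conv_unit fun_eq_iff simp del: rho.hom_one)
  next
    case (gen c)
    show ?case using rho_gbase_conv by blast
  next
    case (inv c)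
    define h where c: "h = gbase c"
    have hc: "h \<in> carrier group_xyy" by (simp add: c)
    have h: "rho h v = conv (rho h unit_series) v" for v :: "'a series"
      unfolding c using rho_gbase_conv by blast
    show ?case unfolding c[symmetric]
    proof
      fix v :: "'a series"
      let ?u = "rho (\<iota> h) unit_series"
      have "rho h (conv ?u v) = conv (conv (rho h unit_series) ?u) v"
        unfolding h[of "conv ?u v"] by (rule ext) (rule conv_assoc[symmetric])
      also have "\<dots> = v"
        unfolding h[symmetric] rho_inv(2)[OF hc] by (rule ext) (rule conv_unit)
      finally have "rho (\<iota> h) (rho h (conv ?u v)) = rho (\<iota> h) v" by (simp only:)
      then show "rho (\<iota> h) v = conv ?u v" unfolding rho_inv(1)[OF hc] by (rule HOL.sym)
    qed
  next
    case (mult g h)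
    note gh = mult.hyps
    show ?case
    proof
      fix v :: "'a series"
      have "rho (g \<odot> h) v = conv (rho g unit_series) (conv (rho h unit_series) v)"
        unfolding rho_mult[OF gh] by (metis mult.IH)
      also have "\<dots> = conv (conv (rho g unit_series) (rho h unit_series)) v"
        by (rule ext) (rule conv_assoc[symmetric])
      also have "conv (rho g unit_series) (rho h unit_series) = rho (g \<odot> h) (unit_series :: 'a series)"
        unfolding rho_mult[OF gh] by (metis mult.IH)
      finally show "rho (g \<odot> h) v = conv (rho (g \<odot> h) unit_series) v" .
    qed
  qed
  then show ?thesis by blast
qed

lemma conv_below:
  assumes "u \<in> divisible_below l m" "v \<in> divisible_below k m" "wt z < l + k"
  shows "m dvd conv u v z"
  using assms
proof (induction z arbitrary: u l)
  case Nil
  then show ?case by (cases "0 < l") (auto simp: divisible_below_def)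
next
  case (Cons c z)
  have wc: "wt (c # z) = wt [c] + wt z" using wt_append[of "[c]" z] by simp
  have 1: "m dvd u [] * v (c # z)"
    using Cons.prems by (cases "0 < l") (auto simp: divisible_below_def)
  have "(\<lambda>z. u (c # z)) \<in> divisible_below (l - wt [c]) m"
    unfolding divisible_below_def
  proof (intro CollectI allI impI)
    fix w assume "wt w < l - wt [c]"
    then have "wt (c # w) < l" using wt_append[of "[c]" w] by simp
    then show "m dvd u (c # w)" using Cons.prems(1) by (simp add: divisible_below_def)
  qed
  then have "m dvd conv (\<lambda>z. u (c # z)) v z"
    by (rule Cons.IH) (use Cons.prems wc in auto)
  then show ?case using 1 by simp
qed

text \<open>If \<open>u\<close> and \<open>v\<close> vanish modulo \<open>m\<close> below the weights of \<open>w\<close> and \<open>z\<close>, then the only splitting of the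
monomial \<open>w z\<close> that contributes to its coefficient modulo \<open>m\<close> is the obvious one, as weights of
letters are positive.\<close>

lemma conv_leading:
  assumes "u \<in> divisible_below (wt w) m" "v \<in> divisible_below (wt z) m"
  shows "m dvd conv u v (w @ z) - u w * v z"
  using assms(1)
proof (induction w arbitrary: u)
  case Nil
  show ?case
  proof (cases z)
    case (Cons c z')
    have "wt z' < 0 + wt z" using wt_append[of "[c]" z'] by (cases c) (auto simp: Cons)
    moreover have "(\<lambda>z. u (c # z)) \<in> divisible_below 0 m" by (simp add: divisible_below_def)
    ultimately have "m dvd conv (\<lambda>z. u (c # z)) v z'" using conv_below[OF _ assms(2)] by blast
    then show ?thesis by (simp add: Cons)
  qed simp
next
  case (Cons c w)
  have "0 < wt (c # w)" by (cases c) auto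
  then have 1: "m dvd u [] * v (c # w @ z)" using Cons.prems by (simp add: divisible_below_def)
  have "m dvd u (c # y)" if "wt y < wt w" for y
  proof -
    have "wt (c # y) < wt (c # w)" using that by (cases c) auto
    then show ?thesis using Cons.prems unfolding divisible_below_def by blast
  qed
  then have "(\<lambda>z. u (c # z)) \<in> divisible_below (wt w) m" by (simp add: divisible_below_def)
  then have "m dvd conv (\<lambda>z. u (c # z)) v (w @ z) - u (c # w) * v z" by (rule Cons.IH)
  from dvd_add[OF 1 this] show ?case by (simp add: algebra_simps)
qed

lemma unipotent_pow_opseries:
  fixes T :: "'r::comm_ring_1 operator"
  assumes T: "raises 1 (T - id)"
  shows "(T ^^ m) v = opseries (\<lambda>k. of_nat (m choose k)) (T - id) v"
proof (induction m arbitrary: v)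
  case 0
  have "(\<lambda>k. of_nat (0 choose k) :: 'r) = (\<lambda>k. if k = 0 then 1 else 0)" by (auto simp: binomial_eq_0)
  then show ?case by (simp add: opseries_id)
next
  case (Suc m)
  have c: "(\<lambda>n. \<Sum>i\<le>n. of_nat (m choose i) * (if n - i \<le> 1 then 1 else 0)) = (\<lambda>k. of_nat (Suc m choose k) :: 'r)"
  proof
    fix n
    show "(\<Sum>i\<le>n. of_nat (m choose i) * (if n - i \<le> 1 then 1 else 0)) = (of_nat (Suc m choose n) :: 'r)"
    proof (cases n)
      case (Suc j)
      have "(\<Sum>i\<le>n. of_nat (m choose i) * (if n - i \<le> 1 then 1 else 0 :: 'r))
        = (\<Sum>i\<in>{j, n}. of_nat (m choose i) * (if n - i \<le> 1 then 1 else 0))"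
        using Suc by (intro sum.mono_neutral_right) auto
      then show ?thesis using Suc by simp
    qed simp
  qed
  have "(T ^^ Suc m) v = (T ^^ m) (T v)" by (simp add: funpow_swap1)
  also have "\<dots> = opseries (\<lambda>k. of_nat (m choose k)) (T - id)
      (opseries (\<lambda>k. if k \<le> 1 then 1 else 0) (T - id) v)"
    unfolding Suc opseries_linear[OF T] ..
  also have "\<dots> = opseries (\<lambda>k. of_nat (Suc m choose k)) (T - id) v"
    unfolding opseries_comp[OF T] c ..
  finally show ?case .
qed

text \<open>Let \<open>1 + u\<close> be the Magnus series of \<open>f\<close>, and let \<open>w\<close> be a monomial of minimal weight whose
coefficient in \<open>u\<close> is not divisible by \<open>p\<close>. Modulo \<open>p\<close> the series of \<open>f\<^sup>p\<close> is \<open>1 + u\<^sup>p\<close>, and its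
coefficient at \<open>w\<^sup>p\<close>, of weight \<open>p\<close> times that of \<open>w\<close>, is the \<open>p\<close>-th power of the coefficient of
\<open>u\<close> at \<open>w\<close>.\<close>

lemma basegroup_prime_root:
  assumes p: "prime p" and f: "f \<in> basegroup"
    and fp: "f \<up> p \<in> congruence_kernel (p * n) (int p)"
  shows "f \<in> congruence_kernel n (int p)"
proof -
  note fc = basegroup_closed[OF f]
  define u :: "int series" where "u = rho f unit_series - unit_series"
  define D where "D = rho f - (id :: int operator)"
  have D: "D v = conv u v" for v
  proof
    fix w
    have "conv u v w = conv (rho f unit_series) v w - v w" by (simp add: u_def conv_diff conv_unit)
    then show "D v w = conv u v w"
      using fun_cong[OF rho_basegroup_conv[OF f, of v], of w] by (simp add: D_def)
  qed
  have u: "u \<in> divisible_below n (int p)"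
  proof (rule ccontr)
    assume "u \<notin> divisible_below n (int p)"
    then have "\<exists>w. wt w < n \<and> \<not> int p dvd u w" by (auto simp: divisible_below_def)
    then obtain w where w: "wt w < n" "\<not> int p dvd u w"
      and min: "\<And>z. wt z < wt w \<Longrightarrow> wt z < n \<and> \<not> int p dvd u z \<Longrightarrow> False"
      using ex_has_least_nat[of "\<lambda>w. wt w < n \<and> \<not> int p dvd u w" _ wt] by (metis not_le)
    have low: "u \<in> divisible_below (wt w) (int p)"
      using min w(1) by (force simp: divisible_below_def)
    have "u [] = 0" by (simp add: u_def rho_Nil[OF fc])
    then have "w \<noteq> []" using w(2) by auto
    then have wpos: "0 < wt w" using length_le_wt[of w] by (metis length_greater_0_conv less_le_trans)
    let ?z = "\<lambda>j. concat (replicate j w)"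
    have wz: "wt (?z j) = j * wt w" for j by (induction j) (simp_all add: wt_append)
    have lead: "(D ^^ j) unit_series \<in> divisible_below (wt (?z j)) (int p) \<and>
        int p dvd (D ^^ j) unit_series (?z j) - u w ^ j" for j
    proof (induction j)
      case 0
      show ?case by (simp add: divisible_below_def unit_series_def)
    next
      case (Suc j)
      let ?v = "(D ^^ j) unit_series"
      have S: "(D ^^ Suc j) unit_series = conv u ?v" by (simp add: D)
      have below: "conv u ?v \<in> divisible_below (wt (?z (Suc j))) (int p)"
        unfolding divisible_below_def using conv_below[OF low conjunct1[OF Suc]] by (simp add: wt_append)
      have "int p dvd conv u ?v (w @ ?z j) - u w * ?v (?z j)"
        by (rule conv_leading[OF low conjunct1[OF Suc]])
      moreover have "int p dvd u w * (?v (?z j) - u w ^ j)" using Suc by simp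
      ultimately have "int p dvd (conv u ?v (w @ ?z j) - u w * ?v (?z j)) + u w * (?v (?z j) - u w ^ j)"
        by (rule dvd_add)
      then have "int p dvd conv u ?v (?z (Suc j)) - u w ^ Suc j" by (simp add: algebra_simps)
      then show ?case unfolding S using below by blast
    qed
    let ?zp = "?z p"
    have p2: "p \<ge> 2" by (rule prime_ge_2_nat[OF p])
    have wzp: "wt ?zp = p * wt w" by (rule wz)
    have zne: "unit_series ?zp = (0 :: int)" using \<open>w \<noteq> []\<close> p2 by (simp add: unit_series_def)
    have ple: "p \<le> wt ?zp" using wpos by (simp add: wzp)
    have "wt ?zp < p * n" using w(1) p2 by (simp add: wzp)
    then have "int p dvd ((rho f ^^ p) unit_series - unit_series) ?zp"
      using congruence_kernelD(2)[OF fp, of unit_series]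
      unfolding rho_nat_pow[OF fc] divisible_below_def by blast
    then have 1: "int p dvd (rho f ^^ p) unit_series ?zp" by (simp only: minus_apply zne diff_0_right)
    have "(rho f ^^ p) unit_series ?zp = (\<Sum>k\<le>wt ?zp. int (p choose k) * (D ^^ k) unit_series ?zp)"
      unfolding unipotent_pow_opseries[OF rho_unipotent[OF fc]] by (simp add: opseries_def D_def)
    also have "\<dots> = (D ^^ p) unit_series ?zp
        + (\<Sum>k\<in>{..wt ?zp} - {p}. int (p choose k) * (D ^^ k) unit_series ?zp)"
      using ple by (subst sum.remove[of _ p]) auto
    finally have 2: "(rho f ^^ p) unit_series ?zp = (D ^^ p) unit_series ?zp
        + (\<Sum>k\<in>{..wt ?zp} - {p}. int (p choose k) * (D ^^ k) unit_series ?zp)" .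
    have "int p dvd (\<Sum>k\<in>{..wt ?zp} - {p}. int (p choose k) * (D ^^ k) unit_series ?zp)"
    proof (rule dvd_sum)
      fix k assume k: "k \<in> {..wt ?zp} - {p}"
      consider "k = 0" | "0 < k" "k < p" | "p < k" using k by fastforce
      then show "int p dvd int (p choose k) * (D ^^ k) unit_series ?zp"
      proof cases
        case 1
        then show ?thesis using zne by simp
      next
        case 2
        then have "p dvd (p choose k)" using p by (intro dvd_choose_prime) auto
        then show ?thesis by simp
      next
        case 3
        then show ?thesis by (simp add: binomial_eq_0)
      qed
    qed
    then have "int p dvd (D ^^ p) unit_series ?zp"
      using 1 unfolding 2 by (simp only: dvd_add_left_iff)
    from dvd_diff[OF this conjunct2[OF lead[of p]]] have "int p dvd u w ^ p"
      by (simp only: diff_diff_eq2 add_diff_cancel_left')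
    moreover have "prime (int p)" using p by simp
    ultimately have "int p dvd u w" by (rule prime_dvd_power[rotated])
    then show False using w(2) by blast
  qed
  have "rho f v - v \<in> divisible_below n (int p)" for v
  proof -
    have "rho f v - v = conv u v" using D[of v] by (simp add: D_def)
    moreover have "int p dvd conv u v w" if "wt w < n" for w
      by (rule conv_below[OF u, of v 0]) (use that in \<open>simp_all add: divisible_below_def\<close>)
    ultimately show ?thesis by (simp add: divisible_below_def)
  qed
  then show ?thesis unfolding congruence_kernel_def using fc by blast
qed

section \<open>The pro-p-completion\<close>

lemma congruence_kernel_mono:
  assumes "K \<le> L" "m dvd n"
  shows "congruence_kernel L n \<subseteq> congruence_kernel K m"
  using assms unfolding congruence_kernel_def divisible_below_def
  by (auto intro: dvd_trans)

text \<open>Write \<open>g = f y\<^sup>k\<close>. If \<open>g\<^sup>p\<close> is close to \<open>1\<close> modulo a high power of \<open>p\<close>, then \<open>p k\<close>, hence \<open>k\<close>, is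
divisible by a high power of \<open>p\<close>, so that \<open>y\<^sup>k\<close> lies in \<open>N\<close> and is close to \<open>1\<close> itself. Therefore
\<open>f\<^sup>p\<close> is close to \<open>g\<^sup>p\<close>, hence to \<open>1\<close>, which forces \<open>f\<close> to be close to \<open>1\<close> and to lie in \<open>N\<close>.\<close>

theorem p_th_roots_of_deep_elements:
  assumes p: "prime p" and N: "N \<in> p_power_index_normals p group_xyy"
  shows "\<exists>M\<in>p_power_index_normals p group_xyy.
    \<forall>g\<in>carrier group_xyy. g \<up> p \<in> M \<longrightarrow> g \<in> N"
proof -
  have Nsub: "subgroup N group_xyy" using N normal_imp_subgroup by (auto simp: p_power_index_normals_def)
  obtain L0 where L0: "\<And>f. f \<in> basegroup \<Longrightarrow> f \<in> congruence_kernel L0 (int p) \<Longrightarrow> f \<in> N"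
    using basegroup_congruence_kernel_cofinal[OF p N] by blast
  obtain K0 where K0: "gy \<up> (p ^ K0) \<in> N"
    using N unfolding G.p_power_index_normals_iff[OF p] by (meson gxya(2))
  \<comment> \<open>at least \<open>2\<close>, so that the coefficient of \<open>\<alpha>\<close>, which carries the exponent of \<open>y\<close>, is below weight \<open>L\<close>\<close>
  define n where "n = max L0 2"
  define L where "L = p * n"
  \<comment> \<open>\<open>K0\<close> puts the \<open>p\<^sup>K\<close>-th power of \<open>y\<close> into \<open>N\<close>, and \<open>L\<close> makes it trivial modulo \<open>p\<close> below weight \<open>L\<close>\<close>
  define K where "K = K0 + L"
  define M where "M = congruence_kernel L (int (p ^ Suc K))"
  have p2: "p \<ge> 2" by (rule prime_ge_2_nat[OF p])
  have "g \<in> N" if g: "g \<in> carrier group_xyy" and gM: "g \<up> p \<in> M" for g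
  proof -
    obtain f and k :: int where f: "f \<in> basegroup" and gf: "g = f \<odot> gy \<up> k"
      using normal_form[OF g] by blast
    note fc = basegroup_closed[OF f]
    have "y_exponent_on (rho g :: int operator) k" unfolding gf by (rule y_exponent_normal_form[OF f])
    from y_exponent_pow[OF g this, of "int p"]
    have ye: "y_exponent_on (rho (g \<up> p) :: int operator) (k * int p)"
      by (simp only: int_pow_int)
    define v :: "int series" where "v = (\<lambda>w. if w = [Xi] then 1 else 0)"
    have "rho (g \<up> p) v [Al] = v [Al] + of_int (k * int p) * v [Xi]"
      using ye[unfolded y_exponent_on_def, rule_format, of v] by (simp add: v_def)
    moreover have "2 * 2 \<le> L" unfolding L_def using p2 by (intro mult_le_mono) (auto simp: n_def)
    then have "wt [Al] < L" by simp
    then have "int (p ^ Suc K) dvd (rho (g \<up> p) v - v) [Al]"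
      using congruence_kernelD(2)[OF gM[unfolded M_def], of v] unfolding divisible_below_def by blast
    ultimately have "int (p ^ Suc K) dvd k * int p" by (simp add: v_def)
    then have "int p * int (p ^ K) dvd int p * k" by (simp add: mult.commute)
    then have "int (p ^ K) dvd k" using p2 by (subst (asm) dvd_mult_cancel_left) simp
    then obtain j where j: "k = int (p ^ K) * j" by (rule dvdE)
    have yk: "gy \<up> k \<in> H" if H: "subgroup H group_xyy" and i: "gy \<up> (p ^ i) \<in> H" "i \<le> K" for H i
    proof -
      have "k = int (p ^ i) * (int (p ^ (K - i)) * j)"
        using i(2) by (simp add: j flip: power_add mult.assoc)
      then have "gy \<up> k = (gy \<up> (p ^ i)) \<up> (int (p ^ (K - i)) * j)"
        by (simp only: G.int_pow_pow[OF gxya(2), symmetric] int_pow_int)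
      then show ?thesis using G.subgroup_int_pow_closed[OF H i(1)] by simp
    qed
    have ykN: "gy \<up> k \<in> N" by (rule yk[OF Nsub K0]) (simp add: K_def)
    let ?C = "congruence_kernel L (int p)"
    interpret C: normal ?C group_xyy by (rule congruence_kernel_normal)
    have "rho (gy \<up> (p ^ L)) v - v \<in> divisible_below L (int p)" for v :: "int series"
      unfolding rho_nat_pow[OF gxya(2)] by (rule unipotent_power_exponent[OF rho_unipotent[OF gxya(2)]])
    then have "gy \<up> (p ^ L) \<in> ?C" unfolding congruence_kernel_def by simp
    then have ykC: "gy \<up> k \<in> ?C" by (rule yk[OF C.subgroup_axioms]) (simp add: K_def)
    \<comment> \<open>modulo the congruence kernel, \<open>f\<close> and \<open>g\<close> have the same \<open>p\<close>-th power\<close>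
    have gfC: "?C #>\<^bsub>group_xyy\<^esub> g = ?C #>\<^bsub>group_xyy\<^esub> f"
    proof (rule G.coset_mult_inv1)
      have "g \<odot> \<iota> f = f \<odot> gy \<up> k \<odot> \<iota> f" by (simp only: gf)
      also have "\<dots> \<in> ?C" using C.inv_op_closed2[OF fc ykC] .
      finally show "?C #>\<^bsub>group_xyy\<^esub> (g \<odot> \<iota> f) = ?C"
        using G.rcoset_eq_self_iff[OF C.subgroup_axioms] g fc by simp
    qed (use g fc C.subset in auto)
    have "M \<subseteq> ?C" unfolding M_def by (rule congruence_kernel_mono) simp_all
    then have "?C #>\<^bsub>group_xyy\<^esub> (g \<up> p) = ?C"
      using gM g G.rcoset_eq_self_iff[OF C.subgroup_axioms] by blast
    then have "?C #>\<^bsub>group_xyy\<^esub> (f \<up> p) = ?C"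
      using C.rcoset_pow[OF g, of p] C.rcoset_pow[OF fc, of p] gfC by simp
    then have "f \<up> p \<in> ?C"
      using G.rcoset_eq_self_iff[OF C.subgroup_axioms] fc by blast
    then have "f \<in> congruence_kernel n (int p)" unfolding L_def by (rule basegroup_prime_root[OF p f])
    then have "f \<in> congruence_kernel L0 (int p)"
      using congruence_kernel_mono[of L0 n "int p" "int p"] by (auto simp: n_def)
    then have "f \<in> N" by (rule L0[OF f])
    then show "g \<in> N" unfolding gf using ykN by (rule subgroup.m_closed[OF Nsub])
  qed
  moreover have "M \<in> p_power_index_normals p group_xyy"
    unfolding M_def by (rule congruence_kernel_p_power_index[OF p])
  ultimately show ?thesis by blast
qed

lemma pro_p_completion_simps:
  "F \<in> carrier (pro_p_completion p G) \<longleftrightarrow>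
    F \<in> (\<Pi>\<^sub>E N\<in>p_power_index_normals p G. carrier (G Mod N)) \<and>
    (\<forall>M\<in>p_power_index_normals p G. \<forall>N\<in>p_power_index_normals p G. M \<subseteq> N \<longrightarrow> F M \<subseteq> F N)"
  "N \<in> p_power_index_normals p G \<Longrightarrow> (E \<otimes>\<^bsub>pro_p_completion p G\<^esub> F) N = E N \<otimes>\<^bsub>G Mod N\<^esub> F N"
  "N \<in> p_power_index_normals p G \<Longrightarrow> \<one>\<^bsub>pro_p_completion p G\<^esub> N = \<one>\<^bsub>G Mod N\<^esub>"
  by (auto simp: pro_p_completion_def Let_def)

lemma pro_p_completion_pow:
  assumes "N \<in> p_power_index_normals p G"
  shows "(F [^]\<^bsub>pro_p_completion p G\<^esub> (n::nat)) N = F N [^]\<^bsub>G Mod N\<^esub> n"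
  by (induction n) (simp_all add: pro_p_completion_simps(2,3)[OF assms] del: one_FactGroup mult_FactGroup)

lemma pro_p_completion_eq_one:
  assumes G: "group G" and F: "F \<in> carrier (pro_p_completion p G)"
    and comp: "\<And>N. N \<in> p_power_index_normals p G \<Longrightarrow> F N = \<one>\<^bsub>G Mod N\<^esub>"
  shows "F = \<one>\<^bsub>pro_p_completion p G\<^esub>"
proof
  fix N
  have "\<one>\<^bsub>pro_p_completion p G\<^esub> \<in> carrier (pro_p_completion p G)"
    by (rule monoid.one_closed[OF group.is_monoid[OF group_pro_p_completion[OF G]]])
  then show "F N = \<one>\<^bsub>pro_p_completion p G\<^esub> N"
    using F comp[of N] by (cases "N \<in> p_power_index_normals p G")
      (auto simp: pro_p_completion_simps PiE_def extensional_def simp del: one_FactGroup)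
qed

text \<open>It suffices to exclude elements of prime order \<open>q\<close>. For \<open>q \<noteq> p\<close> every component lies in a
\<open>p\<close>-group and is trivial. For \<open>q = p\<close> the component at \<open>N\<close> is determined by the one at \<open>M \<inter> N\<close>, where
\<open>M\<close> is such that \<open>p\<close>-th roots of its elements lie in \<open>N\<close>.\<close>

theorem torsion_free_pro_p_completion:
  assumes p: "prime p"
  shows "torsion_free (pro_p_completion p group_xyy)"
proof -
  let ?I = "p_power_index_normals p group_xyy"
  let ?P = "pro_p_completion p group_xyy"
  interpret P: group ?P by (rule group_pro_p_completion[OF G.is_group])
  have comp: "\<exists>g\<in>carrier group_xyy. F N = N #>\<^bsub>group_xyy\<^esub> g" if "F \<in> carrier ?P" "N \<in> ?I" for F N
  proof -
    have "F N \<in> carrier (group_xyy Mod N)" using that by (auto simp: pro_p_completion_simps)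
    then show ?thesis unfolding carrier_FactGroup by blast
  qed
  have pcase: "F = \<one>\<^bsub>?P\<^esub>" if F: "F \<in> carrier ?P" and pow: "F [^]\<^bsub>?P\<^esub> p = \<one>\<^bsub>?P\<^esub>" for F
  proof (rule pro_p_completion_eq_one[OF G.is_group F])
    fix N assume N: "N \<in> ?I"
    have Nsub: "subgroup N group_xyy" using N normal_imp_subgroup by (auto simp: p_power_index_normals_def)
    obtain M where M: "M \<in> ?I" and root: "\<And>g. g \<in> carrier group_xyy \<Longrightarrow> g \<up> p \<in> M \<Longrightarrow> g \<in> N"
      using p_th_roots_of_deep_elements[OF p N] by blast
    have MN: "M \<inter> N \<in> ?I" by (rule G.p_power_index_normals_Int[OF p M N])
    then interpret MN: normal "M \<inter> N" group_xyy by (simp add: p_power_index_normals_def)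
    obtain g where g: "g \<in> carrier group_xyy" "F (M \<inter> N) = (M \<inter> N) #>\<^bsub>group_xyy\<^esub> g"
      using comp[OF F MN] by blast
    have "(M \<inter> N) #>\<^bsub>group_xyy\<^esub> (g \<up> p) = M \<inter> N"
      using pro_p_completion_pow[OF MN, of F p] unfolding pow pro_p_completion_simps(3)[OF MN] g(2) MN.rcoset_pow[OF g(1)]
      by simp
    then have "g \<up> p \<in> M"
      using G.rcoset_eq_self_iff[OF MN.subgroup_axioms, of "g \<up> p"] g(1) by auto
    then have gN: "g \<in> N" by (rule root[OF g(1)])
    have "F (M \<inter> N) \<subseteq> F N" using F MN N by (auto simp: pro_p_completion_simps)
    moreover have "g \<in> F (M \<inter> N)" unfolding g(2) by (rule G.rcos_self[OF g(1) MN.subgroup_axioms])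
    ultimately have gF: "g \<in> F N" by blast
    obtain h where h: "h \<in> carrier group_xyy" "F N = N #>\<^bsub>group_xyy\<^esub> h" using comp[OF F N] by blast
    have "F N = N #>\<^bsub>group_xyy\<^esub> g" using G.repr_independence[OF _ h(1) Nsub, of g] gF by (simp add: h(2))
    also have "\<dots> = N" by (rule G.coset_join2[OF g(1) Nsub gN])
    finally show "F N = \<one>\<^bsub>group_xyy Mod N\<^esub>" by simp
  qed
  have qcase: "F = \<one>\<^bsub>?P\<^esub>" if F: "F \<in> carrier ?P" and pow: "F [^]\<^bsub>?P\<^esub> q = \<one>\<^bsub>?P\<^esub>" and q: "prime q" "q \<noteq> p" for F and q :: nat
  proof (rule pro_p_completion_eq_one[OF G.is_group F])
    fix N assume N: "N \<in> ?I"
    then interpret N: normal N group_xyy by (simp add: p_power_index_normals_def)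
    interpret Q: group "group_xyy Mod N" by (rule N.factorgroup_is_group)
    have FN: "F N \<in> carrier (group_xyy Mod N)" using F N by (auto simp: pro_p_completion_simps)
    obtain k where k: "order (group_xyy Mod N) = p ^ k"
      using N by (auto simp: p_power_index_normals_def order_FactGroup)
    show "F N = \<one>\<^bsub>group_xyy Mod N\<^esub>"
    proof (rule Q.coprime_pows_one[OF FN])
      show "F N [^]\<^bsub>group_xyy Mod N\<^esub> q = \<one>\<^bsub>group_xyy Mod N\<^esub>"
        using pro_p_completion_pow[OF N, of F q] unfolding pow pro_p_completion_simps(3)[OF N] by (rule HOL.sym)
      show "F N [^]\<^bsub>group_xyy Mod N\<^esub> (p ^ k) = \<one>\<^bsub>group_xyy Mod N\<^esub>"
        using Q.pow_order_eq_1[OF FN] unfolding k .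
      show "coprime q (p ^ k)" using primes_coprime[OF q(1) p q(2)] by simp
    qed
  qed
  have "F [^]\<^bsub>?P\<^esub> n = \<one>\<^bsub>?P\<^esub> \<Longrightarrow> n > 0 \<Longrightarrow> F = \<one>\<^bsub>?P\<^esub>" if F: "F \<in> carrier ?P" for F and n :: nat
  proof (induction n rule: less_induct)
    case (less n)
    show ?case
    proof (cases "n = 1")
      case True
      then show ?thesis using less.prems F by simp
    next
      case False
      then obtain q where q: "prime q" "q dvd n" using prime_factor_nat by blast
      then obtain m where m: "n = m * q" by (metis dvd_def mult.commute)
      have "(F [^]\<^bsub>?P\<^esub> m) [^]\<^bsub>?P\<^esub> q = \<one>\<^bsub>?P\<^esub>" using less.prems F by (simp add: P.nat_pow_pow m)
      then have "F [^]\<^bsub>?P\<^esub> m = \<one>\<^bsub>?P\<^esub>"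
        using pcase[OF P.nat_pow_closed[OF F]] qcase[OF P.nat_pow_closed[OF F] _ q(1)] by (cases "q = p") auto
      moreover have "m > 0" "m < n" using less.prems m prime_gt_1_nat[OF q(1)] by auto
      ultimately show ?thesis using less.IH by blast
    qed
  qed
  then show ?thesis unfolding torsion_free_def by blast
qed

theorem proposition12:
  shows "\<not> CSA_group group_xyy \<and>
    Q_faithful group_xyy \<and>
    residually_torsion_free_nilpotent group_xyy \<and>
    (\<forall>p::nat. prime p \<longrightarrow>
       residually_p p group_xyy \<and> torsion_free (pro_p_completion p group_xyy)) \<and>
    (\<forall>m n :: int. m * n \<noteq> 0 \<longrightarrow> \<not> comm_group (baumslag_solitar m n) \<longrightarrow>
       \<not> (\<exists>H. subgroup H group_xyy \<and> baumslag_solitar m n \<cong> group_xyy\<lparr>carrier := H\<rparr>))"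
  using not_CSA_group_xyy Q_faithful_group_xyy residually_torsion_free_nilpotent_group_xyy
    residually_p_group_xyy torsion_free_pro_p_completion no_nonabelian_baumslag_solitar by blast

end
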